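(* Let $\theta\in\mathbb{Q}^{\operatorname{Irr}G}$ be such that $\theta_\rho<0$ for only finitely many $\rho\in\operatorname{Irr}G$. If $\mathcal{F}$ is a $\theta$-stable $(G,h)$-constellation on $X$, then $\mathcal{F}$ is generated in $D_-$. Moreover, if $D_0=\{\rho\in\operatorname{Irr}G \mid h(\rho)=0\}$, then every $\theta$-semistable $(G,h)$-constellation on $X$ is generated in $D_-$.
   Context: All schemes are noetherian over $\mathbb{C}$ and $G$-modules are rational. $G$ is an infinite reductive algebraic group over $\mathbb{C}$, $X$ is an affine $G$-scheme of finite type, $\operatorname{Irr}G$ is the set of isomorphism classes of irreducible representations $\rho\colon G\to GL(V_\rho)$, and $h\colon\operatorname{Irr}G\to\mathbb{N}_0$ is a function (Hilbert function). For a $G$-equivariant coherent $\mathcal{O}_X$-module $\mathcal{F}$ put $\mathcal{F}_\rho=\operatorname{Hom}^G(V_\rho,H^0(\mathcal{F}))$, so $H^0(\mathcal{F})=\bigoplus_\rho \mathcal{F}_\rho\otimes_{\mathbb{C}}V_\rho$. A $(G,h)$-constellation on $X$ is a $G$-equivariant coherent $\mathcal{O}_X$-module $\mathcal{F}$ with $\dim\mathcal{F}_\rho=h(\rho)$ for all $\rho$. Given $\theta$, write $D_-=\{\rho:\theta_\rho<0\}$, $D_0=\{\rho:\theta_\rho=0\}$, $D_+=\{\rho:\theta_\rho>0\}$; $D_-$ is finite. Put $\theta(\mathcal{F})=\sum_{\rho}\theta_\rho\dim\mathcal{F}_\rho\in\mathbb{R}\cup\{\infty\}$. Standing assumptions: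 $D_-\cap\operatorname{supp}h\neq\emptyset$, $D_+\cap\operatorname{supp}h\neq\emptyset$, and $\theta_\rho=0$ whenever $h(\rho)=0$. A $G$-equivariant coherent sheaf $\mathcal{F}$ is generated in $D_-$ if it is generated as an $\mathcal{O}_X$-module by $\bigoplus_{\rho\in D_-}\mathcal{F}_\rho\otimes V_\rho$. A $(G,h)$-constellation $\mathcal{F}$ is $\theta$-semistable (resp. $\theta$-stable) if $\theta(\mathcal{F})=0$ and $\theta(\mathcal{F}')\ge 0$ (resp. $\theta(\mathcal{F}')>0$) for every non-zero proper $G$-equivariant coherent subsheaf $\mathcal{F}'\subset\mathcal{F}$ that is generated in $D_-$. *)

theory Defs
  imports "HOL-Analysis.Analysis" "HOL-Algebra.Algebra" "HOL-Algebra.Algebraic_Closure_Type"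
begin

section \<open>Complex vector spaces\<close>

text \<open>A complex vector space is a record \<open>V\<close> with \<open>module CC V\<close>; its fields \<open>mult\<close> and \<open>one\<close>
  carry no information.\<close>

abbreviation CC :: "complex ring" where
  "CC \<equiv> ring_of_type_algebra"

definition cspace :: "nat \<Rightarrow> (complex, nat \<Rightarrow> complex) module" where
  "cspace n = \<lparr> carrier = {v. \<forall>i\<ge>n. v i = 0},
     monoid.mult = undefined, monoid.one = undefined,
     ring.zero = (\<lambda>i. 0), ring.add = (\<lambda>v w i. v i + w i),
     smult = (\<lambda>c v i. c * v i) \<rparr>"

text \<open>Linear maps are extensional functions, so that a linear map is determined by its values
  on the carrier.\<close>

definition lin_maps ::
  "(complex, 'v, 'x) module_scheme \<Rightarrow> (complex, 'w, 'y) module_scheme \<Rightarrow> ('v \<Rightarrow> 'w) set" where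
  "lin_maps V W = {f \<in> carrier V \<rightarrow>\<^sub>E carrier W.
     (\<forall>x\<in>carrier V. \<forall>y\<in>carrier V. f (x \<oplus>\<^bsub>V\<^esub> y) = f x \<oplus>\<^bsub>W\<^esub> f y) \<and>
     (\<forall>c. \<forall>x\<in>carrier V. f (c \<odot>\<^bsub>V\<^esub> x) = c \<odot>\<^bsub>W\<^esub> f x)}"

definition has_dim :: "(complex, 'v, 'x) module_scheme \<Rightarrow> nat \<Rightarrow> bool" where
  "has_dim V n \<longleftrightarrow> (\<exists>f\<in>lin_maps (cspace n) V. bij_betw f (carrier (cspace n)) (carrier V))"

definition vdim :: "(complex, 'v, 'x) module_scheme \<Rightarrow> enat" where
  "vdim V = (if \<exists>n. has_dim V n then enat (THE n. has_dim V n) else \<infinity>)"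

definition finite_type_algebra :: "(complex, 'a, 'x) module_scheme \<Rightarrow> bool" where
  "finite_type_algebra A \<longleftrightarrow> algebra CC A \<and>
     (\<exists>S. finite S \<and> S \<subseteq> carrier A \<and>
        (\<forall>B. subring B A \<and> submodule B CC A \<and> S \<subseteq> B \<longrightarrow> B = carrier A))"

section \<open>Affine algebraic groups over the complex numbers\<close>

text \<open>An affine algebraic group is given by its group of complex points together with its ring of
  regular functions. (Algebraic groups in characteristic 0 are reduced, so this loses nothing.)\<close>

record 'g alg_group = "'g monoid" +
  reg_fun :: "('g \<Rightarrow> complex) set"

definition coord_ring :: "('g, 'x) alg_group_scheme \<Rightarrow> (complex, 'g \<Rightarrow> complex) module" where
  "coord_ring G = \<lparr> carrier = reg_fun G,
     monoid.mult = (\<lambda>f h. \<lambda>x\<in>carrier G. f x * h x), monoid.one = (\<lambda>x\<in>carrier G. 1),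
     ring.zero = (\<lambda>x\<in>carrier G. 0), ring.add = (\<lambda>f h. \<lambda>x\<in>carrier G. f x + h x),
     smult = (\<lambda>c f. \<lambda>x\<in>carrier G. c * f x) \<rparr>"

text \<open>The third and fourth conditions say that the points of \<open>G\<close> are exactly the algebra
  homomorphisms from the coordinate ring to the complex numbers, i.e. that \<open>G\<close> is an affine variety;
  the last two say that multiplication and inversion are morphisms.\<close>

definition affine_algebraic_group :: "('g, 'x) alg_group_scheme \<Rightarrow> bool" where
  "affine_algebraic_group G \<longleftrightarrow>
     group G \<and>
     reg_fun G \<subseteq> extensional (carrier G) \<and>
     finite_type_algebra (coord_ring G) \<and>
     (\<forall>\<phi>\<in>ring_hom (coord_ring G) CC.
        (\<forall>c. \<forall>f\<in>reg_fun G. \<phi> (c \<odot>\<^bsub>coord_ring G\<^esub> f) = c * \<phi> f) \<longrightarrow>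
        (\<exists>!x. x \<in> carrier G \<and> (\<forall>f\<in>reg_fun G. \<phi> f = f x))) \<and>
     (\<forall>f\<in>reg_fun G. \<exists>n. \<exists>a\<in>{..<n::nat} \<rightarrow> reg_fun G. \<exists>b\<in>{..<n} \<rightarrow> reg_fun G.
        \<forall>x\<in>carrier G. \<forall>y\<in>carrier G. f (x \<otimes>\<^bsub>G\<^esub> y) = (\<Sum>i<n. a i x * b i y)) \<and>
     (\<forall>f\<in>reg_fun G. (\<lambda>x\<in>carrier G. f (inv\<^bsub>G\<^esub> x)) \<in> reg_fun G)"

section \<open>Rational modules\<close>

definition g_module ::
  "('g, 'x) alg_group_scheme \<Rightarrow> (complex, 'v, 'y) module_scheme \<Rightarrow> ('g \<Rightarrow> 'v \<Rightarrow> 'v) \<Rightarrow> bool" where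
  "g_module G V act \<longleftrightarrow> module CC V \<and>
     (\<forall>g\<in>carrier G. restrict (act g) (carrier V) \<in> lin_maps V V) \<and>
     (\<forall>v\<in>carrier V. act \<one>\<^bsub>G\<^esub> v = v) \<and>
     (\<forall>g\<in>carrier G. \<forall>h\<in>carrier G. \<forall>v\<in>carrier V. act (g \<otimes>\<^bsub>G\<^esub> h) v = act g (act h v))"

text \<open>Rationality: the orbit maps are given by a coaction of the coordinate ring,
  \<open>v \<mapsto> \<Sum> c i \<otimes> w i\<close>.\<close>

definition rational_module ::
  "('g, 'x) alg_group_scheme \<Rightarrow> (complex, 'v, 'y) module_scheme \<Rightarrow> ('g \<Rightarrow> 'v \<Rightarrow> 'v) \<Rightarrow> bool" where
  "rational_module G V act \<longleftrightarrow> g_module G V act \<and>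
     (\<forall>v\<in>carrier V. \<exists>n. \<exists>c\<in>{..<n::nat} \<rightarrow> reg_fun G. \<exists>w\<in>{..<n} \<rightarrow> carrier V.
        \<forall>g\<in>carrier G. act g v = (\<Oplus>\<^bsub>V\<^esub>i\<in>{..<n}. c i g \<odot>\<^bsub>V\<^esub> w i))"

definition g_submodule ::
  "('g, 'x) alg_group_scheme \<Rightarrow> (complex, 'v, 'y) module_scheme \<Rightarrow> ('g \<Rightarrow> 'v \<Rightarrow> 'v) \<Rightarrow> 'v set \<Rightarrow> bool"
  where
  "g_submodule G V act W \<longleftrightarrow> submodule W CC V \<and> (\<forall>g\<in>carrier G. act g ` W \<subseteq> W)"

definition hom_G ::
  "('g, 'x) alg_group_scheme \<Rightarrow> (complex, 'v, 'y) module_scheme \<Rightarrow> ('g \<Rightarrow> 'v \<Rightarrow> 'v) \<Rightarrow>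
   (complex, 'w, 'z) module_scheme \<Rightarrow> ('g \<Rightarrow> 'w \<Rightarrow> 'w) \<Rightarrow> (complex, 'v \<Rightarrow> 'w) module" where
  "hom_G G V actV W actW = \<lparr>
     carrier = {f \<in> lin_maps V W. \<forall>g\<in>carrier G. \<forall>v\<in>carrier V. f (actV g v) = actW g (f v)},
     monoid.mult = undefined, monoid.one = undefined,
     ring.zero = (\<lambda>v\<in>carrier V. \<zero>\<^bsub>W\<^esub>), ring.add = (\<lambda>f h. \<lambda>v\<in>carrier V. f v \<oplus>\<^bsub>W\<^esub> h v),
     smult = (\<lambda>c f. \<lambda>v\<in>carrier V. c \<odot>\<^bsub>W\<^esub> f v) \<rparr>"

text \<open>Finite-dimensional representations are taken on the standard spaces, every one being isomorphic
  to such a representation.\<close>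

type_synonym 'g rep = "nat \<times> ('g \<Rightarrow> (nat \<Rightarrow> complex) \<Rightarrow> nat \<Rightarrow> complex)"

text \<open>Goodman and Wallach's definition of a reductive linear algebraic group over the complex numbers:
  all (finite-dimensional, rational) representations are completely reducible. In characteristic 0
  this is equivalent to the triviality of the unipotent radical.\<close>

definition reductive_group :: "('g, 'x) alg_group_scheme \<Rightarrow> bool" where
  "reductive_group G \<longleftrightarrow> affine_algebraic_group G \<and>
     (\<forall>n act. rational_module G (cspace n) act \<longrightarrow>
        (\<forall>W. g_submodule G (cspace n) act W \<longrightarrow>
           (\<exists>W'. g_submodule G (cspace n) act W' \<and>
              W \<inter> W' = {\<zero>\<^bsub>cspace n\<^esub>} \<and> W <+>\<^bsub>cspace n\<^esub> W' = carrier (cspace n))))"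

definition irreps :: "('g, 'x) alg_group_scheme \<Rightarrow> 'g rep set" where
  "irreps G = {(n, act). rational_module G (cspace n) act \<and> n > 0 \<and>
     (\<forall>W. g_submodule G (cspace n) act W \<longrightarrow> W = {\<zero>\<^bsub>cspace n\<^esub>} \<or> W = carrier (cspace n))}"

definition rep_iso :: "('g, 'x) alg_group_scheme \<Rightarrow> ('g rep \<times> 'g rep) set" where
  "rep_iso G = {((m, act), (n, act')). (m, act) \<in> irreps G \<and> (n, act') \<in> irreps G \<and>
     (\<exists>f\<in>carrier (hom_G G (cspace m) act (cspace n) act').
        bij_betw f (carrier (cspace m)) (carrier (cspace n)))}"

definition Irr :: "('g, 'x) alg_group_scheme \<Rightarrow> 'g rep set set" where
  "Irr G = irreps G // rep_iso G"

definition rep_of :: "'g rep set \<Rightarrow> 'g rep" where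
  "rep_of \<rho> = (SOME r. r \<in> \<rho>)"

definition rep_space :: "'g rep set \<Rightarrow> (complex, nat \<Rightarrow> complex) module" where
  "rep_space \<rho> = cspace (fst (rep_of \<rho>))"

definition rep_act :: "'g rep set \<Rightarrow> 'g \<Rightarrow> (nat \<Rightarrow> complex) \<Rightarrow> nat \<Rightarrow> complex" where
  "rep_act \<rho> = snd (rep_of \<rho>)"

section \<open>The affine scheme \<open>Spec A\<close>\<close>

definition Spec :: "('a, 'x) ring_scheme \<Rightarrow> 'a set set" where
  "Spec A = {p. primeideal p A}"

definition zopen :: "('a, 'x) ring_scheme \<Rightarrow> 'a set set \<Rightarrow> bool" where
  "zopen A U \<longleftrightarrow> (\<exists>S\<subseteq>carrier A. U = {p \<in> Spec A. \<not> S \<subseteq> p})"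

text \<open>The fraction \<open>a / s\<close> in the localization of \<open>A\<close> at the prime \<open>p\<close>, as an equivalence class of
  pairs.\<close>

definition loc_frac :: "('a, 'x) ring_scheme \<Rightarrow> 'a set \<Rightarrow> 'a \<Rightarrow> 'a \<Rightarrow> ('a \<times> 'a) set" where
  "loc_frac A p a s = {(b, t). b \<in> carrier A \<and> t \<in> carrier A - p \<and>
     (\<exists>u\<in>carrier A - p. u \<otimes>\<^bsub>A\<^esub> (t \<otimes>\<^bsub>A\<^esub> a) = u \<otimes>\<^bsub>A\<^esub> (s \<otimes>\<^bsub>A\<^esub> b))}"

definition local_ring :: "('a, 'x) ring_scheme \<Rightarrow> 'a set \<Rightarrow> ('a \<times> 'a) set ring" where
  "local_ring A p = \<lparr> carrier = {loc_frac A p a s | a s. a \<in> carrier A \<and> s \<in> carrier A - p},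
     monoid.mult = (\<lambda>x y. \<Union>(a, s)\<in>x. \<Union>(b, t)\<in>y. loc_frac A p (a \<otimes>\<^bsub>A\<^esub> b) (s \<otimes>\<^bsub>A\<^esub> t)),
     monoid.one = loc_frac A p \<one>\<^bsub>A\<^esub> \<one>\<^bsub>A\<^esub>,
     ring.zero = loc_frac A p \<zero>\<^bsub>A\<^esub> \<one>\<^bsub>A\<^esub>,
     ring.add = (\<lambda>x y. \<Union>(a, s)\<in>x. \<Union>(b, t)\<in>y.
              loc_frac A p (a \<otimes>\<^bsub>A\<^esub> t \<oplus>\<^bsub>A\<^esub> b \<otimes>\<^bsub>A\<^esub> s) (s \<otimes>\<^bsub>A\<^esub> t)) \<rparr>"

type_synonym 'a fsec = "'a set \<Rightarrow> ('a \<times> 'a) set"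

text \<open>The structure sheaf: sections are the functions into the local rings that are locally
  fractions.\<close>

definition str_sheaf :: "('a, 'x) ring_scheme \<Rightarrow> 'a set set \<Rightarrow> 'a fsec ring" where
  "str_sheaf A U = \<lparr>
     carrier = {s \<in> (\<Pi>\<^sub>E p\<in>U. carrier (local_ring A p)).
        \<forall>p\<in>U. \<exists>V a f. zopen A V \<and> p \<in> V \<and> V \<subseteq> U \<and> a \<in> carrier A \<and> f \<in> carrier A \<and>
           (\<forall>q\<in>V. f \<notin> q \<and> s q = loc_frac A q a f)},
     monoid.mult = (\<lambda>s t. \<lambda>p\<in>U. s p \<otimes>\<^bsub>local_ring A p\<^esub> t p),
     monoid.one = (\<lambda>p\<in>U. \<one>\<^bsub>local_ring A p\<^esub>),
     ring.zero = (\<lambda>p\<in>U. \<zero>\<^bsub>local_ring A p\<^esub>),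
     ring.add = (\<lambda>s t. \<lambda>p\<in>U. s p \<oplus>\<^bsub>local_ring A p\<^esub> t p) \<rparr>"

section \<open>Affine \<open>G\<close>-schemes\<close>

text \<open>An affine \<open>G\<close>-scheme of finite type is \<open>Spec A\<close> for a finitely generated complex algebra \<open>A\<close> with
  a rational action of \<open>G\<close> by algebra automorphisms; the point \<open>p\<close> is moved by \<open>g\<close> to
  \<open>gact A g ` p\<close>.\<close>

record ('g, 'a) g_scheme = "(complex, 'a) module" +
  gact :: "'g \<Rightarrow> 'a \<Rightarrow> 'a"

definition affine_g_scheme :: "('g, 'x) alg_group_scheme \<Rightarrow> ('g, 'a, 'y) g_scheme_scheme \<Rightarrow> bool" where
  "affine_g_scheme G A \<longleftrightarrow> finite_type_algebra A \<and> rational_module G A (gact A) \<and>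
     (\<forall>g\<in>carrier G. gact A g \<in> ring_hom A A)"

definition move :: "('g, 'a, 'y) g_scheme_scheme \<Rightarrow> 'g \<Rightarrow> 'a set set \<Rightarrow> 'a set set" where
  "move A g U = (\<lambda>p. gact A g ` p) ` U"

text \<open>The isomorphism \<open>\<O>(U) \<rightarrow> \<O>(g U)\<close> induced by \<open>g\<close>, sending the local fraction \<open>a / s\<close> to
  \<open>g a / g s\<close>.\<close>

definition move_fun ::
  "('g, 'x) alg_group_scheme \<Rightarrow> ('g, 'a, 'y) g_scheme_scheme \<Rightarrow> 'g \<Rightarrow> 'a set set \<Rightarrow> 'a fsec \<Rightarrow> 'a fsec"
  where
  "move_fun G A g U s = (\<lambda>q\<in>move A g U.
     map_prod (gact A g) (gact A g) ` s (gact A (inv\<^bsub>G\<^esub> g) ` q))"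

definition const_fun :: "('g, 'a, 'y) g_scheme_scheme \<Rightarrow> complex \<Rightarrow> 'a fsec" where
  "const_fun A c = (\<lambda>p\<in>Spec A. loc_frac A p (c \<odot>\<^bsub>A\<^esub> \<one>\<^bsub>A\<^esub>) \<one>\<^bsub>A\<^esub>)"

section \<open>Equivariant coherent sheaves\<close>

text \<open>The field \<open>lin\<close> is the linearization: \<open>lin F g U\<close> maps sections over \<open>U\<close> to sections over
  \<open>g U\<close>.\<close>

record ('g, 'a, 'm) g_sheaf =
  sec :: "'a set set \<Rightarrow> ('a fsec, 'm) module"
  res :: "'a set set \<Rightarrow> 'a set set \<Rightarrow> 'm \<Rightarrow> 'm"
  lin :: "'g \<Rightarrow> 'a set set \<Rightarrow> 'm \<Rightarrow> 'm"

definition sheaf_of_modules ::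
  "('g, 'a, 'y) g_scheme_scheme \<Rightarrow> ('g, 'a, 'm) g_sheaf \<Rightarrow> bool" where
  "sheaf_of_modules A F \<longleftrightarrow>
     (\<forall>U. zopen A U \<longrightarrow> module (str_sheaf A U) (sec F U)) \<and>
     (\<forall>U V. zopen A U \<and> zopen A V \<and> V \<subseteq> U \<longrightarrow>
        res F U V \<in> carrier (sec F U) \<rightarrow> carrier (sec F V) \<and>
        (\<forall>s\<in>carrier (sec F U). \<forall>t\<in>carrier (sec F U).
           res F U V (s \<oplus>\<^bsub>sec F U\<^esub> t) = res F U V s \<oplus>\<^bsub>sec F V\<^esub> res F U V t) \<and>
        (\<forall>c\<in>carrier (str_sheaf A U). \<forall>s\<in>carrier (sec F U).
           res F U V (c \<odot>\<^bsub>sec F U\<^esub> s) = restrict c V \<odot>\<^bsub>sec F V\<^esub> res F U V s)) \<and>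
     (\<forall>U. zopen A U \<longrightarrow> (\<forall>s\<in>carrier (sec F U). res F U U s = s)) \<and>
     (\<forall>U V W. zopen A U \<and> zopen A V \<and> zopen A W \<and> W \<subseteq> V \<and> V \<subseteq> U \<longrightarrow>
        (\<forall>s\<in>carrier (sec F U). res F V W (res F U V s) = res F U W s)) \<and>
     (\<forall>\<U> t. (\<forall>V\<in>\<U>. zopen A V \<and> t V \<in> carrier (sec F V)) \<and>
        (\<forall>V\<in>\<U>. \<forall>W\<in>\<U>. res F V (V \<inter> W) (t V) = res F W (V \<inter> W) (t W)) \<longrightarrow>
        (\<exists>!s. s \<in> carrier (sec F (\<Union>\<U>)) \<and> (\<forall>V\<in>\<U>. res F (\<Union>\<U>) V s = t V)))"

text \<open>A set \<open>S\<close> of sections over \<open>U\<close> generates the restriction of \<open>F\<close> to \<open>U\<close> as a module over the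
  structure sheaf: every section is locally a linear combination of elements of \<open>S\<close>.\<close>

definition generates ::
  "('g, 'a, 'y) g_scheme_scheme \<Rightarrow> ('g, 'a, 'm) g_sheaf \<Rightarrow> 'a set set \<Rightarrow> 'm set \<Rightarrow> bool" where
  "generates A F U S \<longleftrightarrow> S \<subseteq> carrier (sec F U) \<and>
     (\<forall>V. zopen A V \<and> V \<subseteq> U \<longrightarrow> (\<forall>s\<in>carrier (sec F V). \<forall>p\<in>V.
        \<exists>W T. zopen A W \<and> p \<in> W \<and> W \<subseteq> V \<and> finite T \<and> T \<subseteq> S \<and>
          (\<exists>c\<in>T \<rightarrow> carrier (str_sheaf A W).
             res F V W s = (\<Oplus>\<^bsub>sec F W\<^esub>e\<in>T. c e \<odot>\<^bsub>sec F W\<^esub> res F U W e))))"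

definition finite_type_sheaf ::
  "('g, 'a, 'y) g_scheme_scheme \<Rightarrow> ('g, 'a, 'm) g_sheaf \<Rightarrow> bool" where
  "finite_type_sheaf A F \<longleftrightarrow>
     (\<forall>p\<in>Spec A. \<exists>U S. zopen A U \<and> p \<in> U \<and> finite S \<and> generates A F U S)"

text \<open>The sections over \<open>V\<close> of the kernel of the homomorphism from the free sheaf of rank \<open>n\<close> on \<open>U\<close> to
  \<open>F\<close> restricted to \<open>U\<close> that is given by the sections \<open>e 0, \<dots>, e (n - 1)\<close> over \<open>U\<close>.\<close>

definition relations ::
  "('g, 'a, 'y) g_scheme_scheme \<Rightarrow> ('g, 'a, 'm) g_sheaf \<Rightarrow> 'a set set \<Rightarrow> nat \<Rightarrow> (nat \<Rightarrow> 'm) \<Rightarrow>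
   'a set set \<Rightarrow> (nat \<Rightarrow> 'a fsec) set" where
  "relations A F U n e V = {r \<in> {..<n} \<rightarrow>\<^sub>E carrier (str_sheaf A V).
     (\<Oplus>\<^bsub>sec F V\<^esub>i\<in>{..<n}. r i \<odot>\<^bsub>sec F V\<^esub> res F U V (e i)) = \<zero>\<^bsub>sec F V\<^esub>}"

text \<open>Coherence in the sense of EGA: finite type, and every homomorphism from a finite free sheaf over
  an open set has a kernel of finite type.\<close>

definition coherent :: "('g, 'a, 'y) g_scheme_scheme \<Rightarrow> ('g, 'a, 'm) g_sheaf \<Rightarrow> bool" where
  "coherent A F \<longleftrightarrow> sheaf_of_modules A F \<and> finite_type_sheaf A F \<and>
     (\<forall>U n. \<forall>e\<in>{..<n} \<rightarrow> carrier (sec F U). zopen A U \<longrightarrow>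
        (\<forall>p\<in>U. \<exists>V R. zopen A V \<and> p \<in> V \<and> V \<subseteq> U \<and> finite R \<and> R \<subseteq> relations A F U n e V \<and>
          (\<forall>W. zopen A W \<and> W \<subseteq> V \<longrightarrow> (\<forall>r\<in>relations A F U n e W. \<forall>q\<in>W.
             \<exists>W'. zopen A W' \<and> q \<in> W' \<and> W' \<subseteq> W \<and>
               (\<exists>d\<in>R \<rightarrow> carrier (str_sheaf A W'). \<forall>i<n.
                  restrict (r i) W' =
                  (\<Oplus>\<^bsub>str_sheaf A W'\<^esub>x\<in>R. d x \<otimes>\<^bsub>str_sheaf A W'\<^esub> restrict (x i) W'))))))"

definition H0 :: "('g, 'a, 'y) g_scheme_scheme \<Rightarrow> ('g, 'a, 'm) g_sheaf \<Rightarrow> (complex, 'm) module" where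
  "H0 A F = \<lparr> carrier = carrier (sec F (Spec A)),
     monoid.mult = undefined, monoid.one = undefined,
     ring.zero = \<zero>\<^bsub>sec F (Spec A)\<^esub>, ring.add = ring.add (sec F (Spec A)),
     smult = (\<lambda>c m. const_fun A c \<odot>\<^bsub>sec F (Spec A)\<^esub> m) \<rparr>"

text \<open>As \<open>G\<close> is a variety, a linearization is given by the isomorphisms attached to the points of
  \<open>G\<close>; that these depend algebraically on the point is expressed, the scheme being affine, by the
  rationality of the \<open>G\<close>-module of global sections.\<close>

definition equivariant_coherent ::
  "('g, 'x) alg_group_scheme \<Rightarrow> ('g, 'a, 'y) g_scheme_scheme \<Rightarrow> ('g, 'a, 'm) g_sheaf \<Rightarrow> bool" where
  "equivariant_coherent G A F \<longleftrightarrow> coherent A F \<and>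
     (\<forall>U. zopen A U \<longrightarrow>
        (\<forall>g\<in>carrier G.
           lin F g U \<in> carrier (sec F U) \<rightarrow> carrier (sec F (move A g U)) \<and>
           (\<forall>s\<in>carrier (sec F U). \<forall>t\<in>carrier (sec F U).
              lin F g U (s \<oplus>\<^bsub>sec F U\<^esub> t) = lin F g U s \<oplus>\<^bsub>sec F (move A g U)\<^esub> lin F g U t) \<and>
           (\<forall>c\<in>carrier (str_sheaf A U). \<forall>s\<in>carrier (sec F U).
              lin F g U (c \<odot>\<^bsub>sec F U\<^esub> s) =
              move_fun G A g U c \<odot>\<^bsub>sec F (move A g U)\<^esub> lin F g U s) \<and>
           (\<forall>V. zopen A V \<and> V \<subseteq> U \<longrightarrow> (\<forall>s\<in>carrier (sec F U).
              res F (move A g U) (move A g V) (lin F g U s) = lin F g V (res F U V s)))) \<and>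
        (\<forall>s\<in>carrier (sec F U). lin F \<one>\<^bsub>G\<^esub> U s = s) \<and>
        (\<forall>g\<in>carrier G. \<forall>h\<in>carrier G. \<forall>s\<in>carrier (sec F U).
           lin F (g \<otimes>\<^bsub>G\<^esub> h) U s = lin F g (move A h U) (lin F h U s))) \<and>
     rational_module G (H0 A F) (\<lambda>g. lin F g (Spec A))"

definition subsheaf :: "('g, 'a, 'm) g_sheaf \<Rightarrow> ('a set set \<Rightarrow> 'm set) \<Rightarrow> ('g, 'a, 'm) g_sheaf" where
  "subsheaf F P = F\<lparr>sec := \<lambda>U. (sec F U)\<lparr>carrier := P U\<rparr>\<rparr>"

definition equivariant_coherent_subsheaf ::
  "('g, 'x) alg_group_scheme \<Rightarrow> ('g, 'a, 'y) g_scheme_scheme \<Rightarrow> ('g, 'a, 'm) g_sheaf \<Rightarrow>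
   ('a set set \<Rightarrow> 'm set) \<Rightarrow> bool" where
  "equivariant_coherent_subsheaf G A F P \<longleftrightarrow>
     (\<forall>U. zopen A U \<longrightarrow> P U \<subseteq> carrier (sec F U)) \<and> equivariant_coherent G A (subsheaf F P)"

definition nonzero_proper ::
  "('g, 'a, 'y) g_scheme_scheme \<Rightarrow> ('g, 'a, 'm) g_sheaf \<Rightarrow> ('a set set \<Rightarrow> 'm set) \<Rightarrow> bool" where
  "nonzero_proper A F P \<longleftrightarrow>
     (\<exists>U. zopen A U \<and> P U \<noteq> {\<zero>\<^bsub>sec F U\<^esub>}) \<and> (\<exists>U. zopen A U \<and> P U \<noteq> carrier (sec F U))"

section \<open>\<open>(G, h)\<close>-constellations and stability\<close>

definition F_comp ::
  "('g, 'x) alg_group_scheme \<Rightarrow> ('g, 'a, 'y) g_scheme_scheme \<Rightarrow> ('g, 'a, 'm) g_sheaf \<Rightarrow>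
   'g rep set \<Rightarrow> (complex, (nat \<Rightarrow> complex) \<Rightarrow> 'm) module" where
  "F_comp G A F \<rho> = hom_G G (rep_space \<rho>) (rep_act \<rho>) (H0 A F) (\<lambda>g. lin F g (Spec A))"

definition constellation ::
  "('g, 'x) alg_group_scheme \<Rightarrow> ('g, 'a, 'y) g_scheme_scheme \<Rightarrow> ('g rep set \<Rightarrow> nat) \<Rightarrow>
   ('g, 'a, 'm) g_sheaf \<Rightarrow> bool" where
  "constellation G A h F \<longleftrightarrow> equivariant_coherent G A F \<and>
     (\<forall>\<rho>\<in>Irr G. vdim (F_comp G A F \<rho>) = enat (h \<rho>))"

definition D_neg :: "('g, 'x) alg_group_scheme \<Rightarrow> ('g rep set \<Rightarrow> rat) \<Rightarrow> 'g rep set set" where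
  "D_neg G \<theta> = {\<rho> \<in> Irr G. \<theta> \<rho> < 0}"

definition D_zero :: "('g, 'x) alg_group_scheme \<Rightarrow> ('g rep set \<Rightarrow> rat) \<Rightarrow> 'g rep set set" where
  "D_zero G \<theta> = {\<rho> \<in> Irr G. \<theta> \<rho> = 0}"

definition D_pos :: "('g, 'x) alg_group_scheme \<Rightarrow> ('g rep set \<Rightarrow> rat) \<Rightarrow> 'g rep set set" where
  "D_pos G \<theta> = {\<rho> \<in> Irr G. \<theta> \<rho> > 0}"

definition supp :: "('g, 'x) alg_group_scheme \<Rightarrow> ('g rep set \<Rightarrow> nat) \<Rightarrow> 'g rep set set" where
  "supp G h = {\<rho> \<in> Irr G. h \<rho> \<noteq> 0}"

text \<open>The sum is an unordered sum in the extended reals; it converges whenever \<open>D_neg G \<theta>\<close> is finite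
  and the dimensions occurring there are finite, as for constellations and their subsheaves.\<close>

definition theta_val ::
  "('g, 'x) alg_group_scheme \<Rightarrow> ('g, 'a, 'y) g_scheme_scheme \<Rightarrow> ('g rep set \<Rightarrow> rat) \<Rightarrow>
   ('g, 'a, 'm) g_sheaf \<Rightarrow> ereal" where
  "theta_val G A \<theta> F =
     (\<Sum>\<^sub>\<infinity>\<rho>\<in>Irr G. ereal (of_rat (\<theta> \<rho>)) * ereal_of_enat (vdim (F_comp G A F \<rho>)))"

text \<open>The image of \<open>F\<^sub>\<rho> \<otimes> V\<^sub>\<rho>\<close> in the global sections is spanned by the values \<open>f v\<close>.\<close>

definition generated_in ::
  "('g, 'x) alg_group_scheme \<Rightarrow> ('g, 'a, 'y) g_scheme_scheme \<Rightarrow> 'g rep set set \<Rightarrow>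
   ('g, 'a, 'm) g_sheaf \<Rightarrow> bool" where
  "generated_in G A D F \<longleftrightarrow> generates A F (Spec A)
     {f v | f v \<rho>. \<rho> \<in> D \<and> f \<in> carrier (F_comp G A F \<rho>) \<and> v \<in> carrier (rep_space \<rho>)}"

definition theta_semistable ::
  "('g, 'x) alg_group_scheme \<Rightarrow> ('g, 'a, 'y) g_scheme_scheme \<Rightarrow> ('g rep set \<Rightarrow> nat) \<Rightarrow>
   ('g rep set \<Rightarrow> rat) \<Rightarrow> ('g, 'a, 'm) g_sheaf \<Rightarrow> bool" where
  "theta_semistable G A h \<theta> F \<longleftrightarrow> constellation G A h F \<and> theta_val G A \<theta> F = 0 \<and>
     (\<forall>P. equivariant_coherent_subsheaf G A F P \<and> nonzero_proper A F P \<and>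
        generated_in G A (D_neg G \<theta>) (subsheaf F P) \<longrightarrow> theta_val G A \<theta> (subsheaf F P) \<ge> 0)"

definition theta_stable ::
  "('g, 'x) alg_group_scheme \<Rightarrow> ('g, 'a, 'y) g_scheme_scheme \<Rightarrow> ('g rep set \<Rightarrow> nat) \<Rightarrow>
   ('g rep set \<Rightarrow> rat) \<Rightarrow> ('g, 'a, 'm) g_sheaf \<Rightarrow> bool" where
  "theta_stable G A h \<theta> F \<longleftrightarrow> constellation G A h F \<and> theta_val G A \<theta> F = 0 \<and>
     (\<forall>P. equivariant_coherent_subsheaf G A F P \<and> nonzero_proper A F P \<and>
        generated_in G A (D_neg G \<theta>) (subsheaf F P) \<longrightarrow> theta_val G A \<theta> (subsheaf F P) > 0)"

end

theory Submission
  imports Defs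
begin

text \<open>
  Let \<open>P\<close> be the \<open>\<O>\<close>-submodule of \<open>\<F>\<close> that is generated by the components \<open>\<F>\<^sub>\<rho> \<otimes> V\<^sub>\<rho>\<close> with \<open>\<rho>\<close> in
  \<open>D\<^sub>-\<close>. The proof consists in testing the (semi)stability of \<open>\<F>\<close> on \<open>P\<close>.

  The set \<open>D\<^sub>-\<close> is finite and the components are finite-dimensional, so \<open>P\<close> is of finite type; the
  relations between sections of \<open>P\<close> are those in \<open>\<F>\<close>, so \<open>P\<close> is coherent. The generators are permuted by
  \<open>G\<close>, so \<open>P\<close> is equivariant (\<open>neg_sub_equivariant\<close>); by construction it is generated in \<open>D\<^sub>-\<close>
  (\<open>generated_in_gen_comp_sections\<close>), and it is nonzero because \<open>D\<^sub>-\<close> meets the support of \<open>h\<close>.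
  Furthermore \<open>P\<^sub>\<rho> = \<F>\<^sub>\<rho>\<close> for \<open>\<rho>\<close> in \<open>D\<^sub>-\<close>, while \<open>dim P\<^sub>\<rho> \<le> h(\<rho>)\<close> for the others, on which \<open>\<theta>\<close> is
  nonnegative. Therefore \<open>\<theta>(P) \<le> \<theta>(\<F>) = 0\<close>. If \<open>\<F>\<close> is stable, then \<open>P\<close> cannot be a proper subsheaf, and
  \<open>\<F> = P\<close> is generated in \<open>D\<^sub>-\<close>.

  If \<open>\<F>\<close> is semistable and \<open>P\<close> is proper, then \<open>\<theta>(P) = 0\<close>. As the sum is finite, it can be compared
  with \<open>\<theta>(\<F>)\<close> term by term (\<open>eq_if_infsum_ereal_ge\<close>), and \<open>dim P\<^sub>\<rho> = h(\<rho>)\<close> whenever \<open>\<theta>\<^sub>\<rho>\<close> is not zero.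
  If \<open>D\<^sub>0\<close> is the set of all \<open>\<rho>\<close> with \<open>h(\<rho>) = 0\<close>, this gives \<open>P\<^sub>\<rho> = \<F>\<^sub>\<rho>\<close> for all \<open>\<rho>\<close>. A contradiction
  results from two theorems. Rational representations of a reductive group are sums of images
  of irreducible ones (\<open>rational_module_is_sum_of_irreducible_images\<close>); hence \<open>P\<close> and \<open>\<F>\<close> have the same
  global sections. A coherent sheaf on an affine scheme is generated by its global sections
  (\<open>submodule_sheaf_eq_if_global_eq\<close>); hence \<open>P = \<F>\<close>.

  The last theorem rests on \<open>extends_after_power\<close>: a section of a coherent sheaf over the basic open set
  \<open>D(f)\<close> extends to the whole spectrum after multiplication with a power of \<open>f\<close>. Coherence enters twice.
  Finite type yields local extensions, because a local combination of generators with fractions as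
  coefficients has a common denominator. The finiteness of relations shows that a section vanishing on
  \<open>D(f)\<close> is killed by a power of \<open>f\<close> (\<open>killed_by_power\<close>), so that the local extensions agree after
  multiplication with a further power and can be glued.
\<close>

section \<open>Ideals and the spectrum\<close>

text \<open>An ideal that contains \<open>J\<close> and is maximal among those without a power of
  \<open>f\<close> is prime.\<close>

lemma (in cring) power_mem_ideal:
  assumes J: "ideal J R" and f: "f \<in> carrier R"
    and prime: "\<And>p. p \<in> Spec R \<Longrightarrow> f \<notin> p \<Longrightarrow> \<not> J \<subseteq> p"
  shows "\<exists>k::nat. f [^] k \<in> J"
proof (rule ccontr)
  assume no: "\<not> (\<exists>k::nat. f [^] k \<in> J)"
  define \<A> where "\<A> = {I. ideal I R \<and> J \<subseteq> I \<and> (\<forall>k::nat. f [^] k \<notin> I)}"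
  have "\<exists>M\<in>\<A>. \<forall>I\<in>\<A>. M \<subseteq> I \<longrightarrow> I = M"
  proof (rule subset_Zorn_nonempty)
    show "\<A> \<noteq> {}" using J no by (auto simp: \<A>_def)
  next
    fix C assume C: "C \<noteq> {}" "subset.chain \<A> C"
    have "subset.chain {I. ideal I R} C"
      using C(2) by (auto simp: \<A>_def subset.chain_def)
    from chain_Union_is_ideal[OF this] C(1) have "ideal (\<Union>C) R" by simp
    moreover have "C \<subseteq> \<A>" using C(2) by (auto simp: subset.chain_def)
    ultimately show "\<Union>C \<in> \<A>" using C(1) unfolding \<A>_def by blast
  qed
  then obtain M where MA: "M \<in> \<A>" and max: "\<And>I. I \<in> \<A> \<Longrightarrow> M \<subseteq> I \<Longrightarrow> I = M"
    by auto
  have M: "ideal M R" "J \<subseteq> M" "\<And>k::nat. f [^] k \<notin> M" using MA by (auto simp: \<A>_def)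
  interpret M: ideal M R by fact
  \<comment> \<open>By maximality, adjoining one more element to \<open>M\<close> produces a power of
    \<open>f\<close>.\<close>
  have big: "\<exists>k::nat. \<exists>m\<in>M. \<exists>r\<in>carrier R. f [^] k = m \<oplus> r \<otimes> a"
    if a: "a \<in> carrier R" "a \<notin> M" for a
  proof -
    let ?I = "M <+>\<^bsub>R\<^esub> PIdl a"
    have I: "ideal ?I R" by (intro add_ideals M(1) cgenideal_ideal a)
    have sub: "M \<subseteq> ?I"
    proof
      fix x assume "x \<in> M"
      moreover have "\<zero> \<in> PIdl a"
        using cgenideal_ideal[OF a(1)] additive_subgroup.zero_closed ideal.axioms(1) by blast
      moreover have "x \<oplus> \<zero> = x" using \<open>x \<in> M\<close> M.Icarr by auto
      ultimately show "x \<in> ?I" unfolding set_add_def' by force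
    qed
    have "\<zero> \<oplus> a \<in> ?I" unfolding set_add_def' using M.zero_closed cgenideal_self[OF a(1)] by blast
    then have "a \<in> ?I" using a by simp
    then have "?I \<notin> \<A>" using max[OF _ sub] a by auto
    then obtain k :: nat where "f [^] k \<in> ?I" using I sub M(2) unfolding \<A>_def by blast
    then show ?thesis unfolding set_add_def' cgenideal_def by blast
  qed
  have "primeideal M R"
  proof (rule primeidealI[OF M(1) cring_axioms])
    show "carrier R \<noteq> M" using M(3)[of 0] by auto
  next
    fix a b assume ab: "a \<in> carrier R" "b \<in> carrier R" "a \<otimes> b \<in> M"
    show "a \<in> M \<or> b \<in> M"
    proof (rule ccontr)
      assume "\<not> ?thesis"
      then obtain k l :: nat and m r n s where
        k: "m \<in> M" "r \<in> carrier R" "f [^] k = m \<oplus> r \<otimes> a" and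
        l: "n \<in> M" "s \<in> carrier R" "f [^] l = n \<oplus> s \<otimes> b"
        using big ab by meson
      note c = k(1,2) l(1,2) ab(1,2) M.Icarr[OF k(1)] M.Icarr[OF l(1)]
      have "f [^] (k + l) = (m \<oplus> r \<otimes> a) \<otimes> (n \<oplus> s \<otimes> b)"
        using nat_pow_mult[OF f, of k l] k l by simp
      also have "\<dots> = (n \<oplus> s \<otimes> b) \<otimes> m \<oplus> ((r \<otimes> a) \<otimes> n \<oplus> (r \<otimes> s) \<otimes> (a \<otimes> b))"
        using c by algebra
      also have "\<dots> \<in> M" using c ab(3) k(1) l(1)
        by (intro M.a_closed M.I_l_closed[OF k(1)] M.I_l_closed[OF l(1)] M.I_l_closed[OF ab(3)] m_closed a_closed)
      finally show False using M(3) by blast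
    qed
  qed
  moreover have "f \<notin> M" using M(3)[of 1] f by simp
  ultimately show False using prime M(2) by (auto simp: Spec_def)
qed

definition basic_open :: "('a, 'x) ring_scheme \<Rightarrow> 'a \<Rightarrow> 'a set set" where
  "basic_open A f = {p \<in> Spec A. f \<notin> p}"

lemma zopen_subset_Spec: "zopen A U \<Longrightarrow> U \<subseteq> Spec A"
  by (auto simp: zopen_def)

lemma zopen_empty: "zopen A {}"
  unfolding zopen_def by (rule exI[of _ "{}"]) auto

lemma zopen_basic_open: "f \<in> carrier A \<Longrightarrow> zopen A (basic_open A f)"
  unfolding zopen_def basic_open_def by (rule exI[of _ "{f}"]) auto

lemma basic_open_subset: "zopen A U \<Longrightarrow> p \<in> U \<Longrightarrow>
   \<exists>f\<in>carrier A. p \<in> basic_open A f \<and> basic_open A f \<subseteq> U"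
  unfolding zopen_def basic_open_def by blast

lemma Spec_primeideal: "p \<in> Spec A \<Longrightarrow> primeideal p A"
  by (simp add: Spec_def)

context cring begin

lemma Spec_ideal: "p \<in> Spec R \<Longrightarrow> ideal p R"
  by (rule primeideal.axioms(1)[OF Spec_primeideal])

lemma Spec_not_one: assumes "p \<in> Spec R" shows "\<one> \<notin> p"
  using primeideal.I_notcarr[OF Spec_primeideal[OF assms]] ideal.one_imp_carrier[OF Spec_ideal[OF assms]]
  by auto

lemma Spec_subset: assumes "p \<in> Spec R" shows "p \<subseteq> carrier R"
  using ideal.Icarr[OF Spec_ideal[OF assms]] by blast

lemma Spec_mult: assumes "p \<in> Spec R" "a \<in> carrier R" "b \<in> carrier R"
  shows "a \<otimes> b \<in> p \<longleftrightarrow> a \<in> p \<or> b \<in> p"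
  using primeideal.I_prime[OF Spec_primeideal[OF assms(1)], of a b]
    ideal.I_l_closed[OF Spec_ideal[OF assms(1)], of b a]
    ideal.I_r_closed[OF Spec_ideal[OF assms(1)], of a b] assms by auto

lemma Spec_pow: "p \<in> Spec R \<Longrightarrow> a \<in> carrier R \<Longrightarrow> a \<notin> p \<Longrightarrow> a [^] (n::nat) \<notin> p"
  by (induction n) (auto simp: Spec_not_one Spec_mult)

lemma Spec_zero: assumes "p \<in> Spec R" shows "\<zero> \<in> p"
  by (rule additive_subgroup.zero_closed[OF ideal.axioms(1)[OF Spec_ideal[OF assms]]])

lemma Spec_add: assumes "p \<in> Spec R" shows "a \<in> p \<Longrightarrow> b \<in> p \<Longrightarrow> a \<oplus> b \<in> p"
  by (rule additive_subgroup.a_closed[OF ideal.axioms(1)[OF Spec_ideal[OF assms]]])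

lemma zopen_Spec: "zopen R (Spec R)"
  unfolding zopen_def using Spec_not_one by (intro exI[of _ "{\<one>}"]) blast

lemma basic_open_one: "basic_open R \<one> = Spec R"
  unfolding basic_open_def using Spec_not_one by blast

lemma basic_open_mult: "a \<in> carrier R \<Longrightarrow> b \<in> carrier R \<Longrightarrow>
   basic_open R (a \<otimes> b) = basic_open R a \<inter> basic_open R b"
  by (auto simp: basic_open_def Spec_mult)

lemma zopen_Int: assumes "zopen R U" "zopen R V" shows "zopen R (U \<inter> V)"
proof -
  obtain S T where S: "S \<subseteq> carrier R" "U = {p \<in> Spec R. \<not> S \<subseteq> p}"
    and T: "T \<subseteq> carrier R" "V = {p \<in> Spec R. \<not> T \<subseteq> p}"
    using assms by (auto simp: zopen_def)
  show ?thesis unfolding zopen_def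
  proof (intro exI conjI)
    show "{a \<otimes> b | a b. a \<in> S \<and> b \<in> T} \<subseteq> carrier R" using S T by auto
    show "U \<inter> V = {p \<in> Spec R. \<not> {a \<otimes> b |a b. a \<in> S \<and> b \<in> T} \<subseteq> p}"
    proof (intro Set.set_eqI iffI)
      fix p assume "p \<in> U \<inter> V"
      then obtain a b where "p \<in> Spec R" "a \<in> S" "a \<notin> p" "b \<in> T" "b \<notin> p" using S T by auto
      moreover have "a \<otimes> b \<notin> p" using calculation Spec_mult S T by blast
      ultimately show "p \<in> {p \<in> Spec R. \<not> {a \<otimes> b |a b. a \<in> S \<and> b \<in> T} \<subseteq> p}" by blast
    next
      fix p assume "p \<in> {p \<in> Spec R. \<not> {a \<otimes> b |a b. a \<in> S \<and> b \<in> T} \<subseteq> p}"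
      then obtain a b where ab: "p \<in> Spec R" "a \<in> S" "b \<in> T" "a \<otimes> b \<notin> p" by blast
      then have "a \<notin> p" "b \<notin> p" using Spec_mult S T by blast+
      then show "p \<in> U \<inter> V" using S T ab by auto
    qed
  qed
qed

end

text \<open>As equations of the union one can take all functions whose basic open set lies in
  it.\<close>

lemma zopen_Union: assumes "\<And>U. U \<in> \<U> \<Longrightarrow> zopen R U" shows "zopen R (\<Union>\<U>)"
proof -
  define S where "S = {f \<in> carrier R. basic_open R f \<subseteq> \<Union>\<U>}"
  have "\<Union>\<U> = {p \<in> Spec R. \<not> S \<subseteq> p}"
  proof (intro Set.set_eqI iffI)
    fix p assume "p \<in> \<Union>\<U>"
    then obtain U where U: "U \<in> \<U>" "p \<in> U" by blast
    then obtain f where "f \<in> carrier R" "p \<in> basic_open R f" "basic_open R f \<subseteq> U"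
      using basic_open_subset[OF assms] by blast
    then show "p \<in> {p \<in> Spec R. \<not> S \<subseteq> p}" using U unfolding S_def basic_open_def by blast
  next
    fix p assume "p \<in> {p \<in> Spec R. \<not> S \<subseteq> p}"
    then obtain f where "p \<in> basic_open R f" "f \<in> S" by (auto simp: basic_open_def)
    then show "p \<in> \<Union>\<U>" by (auto simp: S_def)
  qed
  moreover have "S \<subseteq> carrier R" by (auto simp: S_def)
  ultimately show ?thesis unfolding zopen_def by (intro exI[of _ S] conjI)
qed

lemma zopen_Un: "zopen A U \<Longrightarrow> zopen A V \<Longrightarrow> zopen A (U \<union> V)"
  using zopen_Union[of "{U, V}" A] by auto

section \<open>Local rings and regular functions\<close>

context cring begin

lemma loc_frac_mem_iff:
  "(b, t) \<in> loc_frac R p a s \<longleftrightarrow> b \<in> carrier R \<and> t \<in> carrier R \<and> t \<notin> p \<and>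
     (\<exists>u\<in>carrier R. u \<notin> p \<and> u \<otimes> (t \<otimes> a) = u \<otimes> (s \<otimes> b))"
  by (auto simp: loc_frac_def)

lemma loc_frac_self: "p \<in> Spec R \<Longrightarrow> a \<in> carrier R \<Longrightarrow> s \<in> carrier R \<Longrightarrow> s \<notin> p \<Longrightarrow>
   (a, s) \<in> loc_frac R p a s"
  unfolding loc_frac_mem_iff by (simp add: bexI[of _ \<one>] Spec_not_one)

text \<open>A fraction is the set of all pairs that represent it, so that the transitivity of the
  equivalence of pairs becomes an inclusion of fractions.\<close>

lemma loc_frac_mem_subset:
  assumes p: "p \<in> Spec R" and s: "a \<in> carrier R" "s \<in> carrier R" "s \<notin> p"
    and bt: "(b, t) \<in> loc_frac R p a s"
  shows "loc_frac R p a s \<subseteq> loc_frac R p b t" and "(a, s) \<in> loc_frac R p b t"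
proof -
  obtain u where b: "b \<in> carrier R" and t: "t \<in> carrier R" "t \<notin> p"
    and u: "u \<in> carrier R" "u \<notin> p" "u \<otimes> (t \<otimes> a) = u \<otimes> (s \<otimes> b)"
    using bt unfolding loc_frac_mem_iff by blast
  show "(a, s) \<in> loc_frac R p b t"
    unfolding loc_frac_mem_iff using s u by (intro conjI bexI[of _ u]) simp_all
  show "loc_frac R p a s \<subseteq> loc_frac R p b t"
  proof
    fix x assume "x \<in> loc_frac R p a s"
    then obtain c w v where x: "x = (c, w)" "c \<in> carrier R" "w \<in> carrier R" "w \<notin> p"
      and v: "v \<in> carrier R" "v \<notin> p" "v \<otimes> (w \<otimes> a) = v \<otimes> (s \<otimes> c)"
      using loc_frac_mem_iff by (metis surj_pair)
    have "(u \<otimes> v \<otimes> s) \<otimes> (w \<otimes> b) = (v \<otimes> w) \<otimes> (u \<otimes> (s \<otimes> b))"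
      using b t u v s x by algebra
    also have "\<dots> = (u \<otimes> t) \<otimes> (v \<otimes> (w \<otimes> a))" unfolding u(3)[symmetric]
      using b t u(1,2) v(1,2) s x by algebra
    also have "\<dots> = (u \<otimes> v \<otimes> s) \<otimes> (t \<otimes> c)" unfolding v(3)
      using b t u(1,2) v(1,2) s x by algebra
    finally have "(u \<otimes> v \<otimes> s) \<otimes> (w \<otimes> b) = (u \<otimes> v \<otimes> s) \<otimes> (t \<otimes> c)" .
    moreover have "u \<otimes> v \<otimes> s \<notin> p" using p u v s by (simp add: Spec_mult)
    ultimately show "x \<in> loc_frac R p b t"
      unfolding x loc_frac_mem_iff using x u v s by blast
  qed
qed

lemma loc_frac_eqI:
  assumes p: "p \<in> Spec R" and s: "a \<in> carrier R" "s \<in> carrier R" "s \<notin> p"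
    and bt: "(b, t) \<in> loc_frac R p a s"
  shows "loc_frac R p b t = loc_frac R p a s"
  using loc_frac_mem_subset[OF p s bt] loc_frac_mem_subset[OF p] bt loc_frac_mem_iff s
  by (metis (no_types, lifting) subset_antisym)

lemma loc_frac_eq:
  assumes p: "p \<in> Spec R" and "a \<in> carrier R" "s \<in> carrier R" "s \<notin> p"
    "b \<in> carrier R" "t \<in> carrier R" "t \<notin> p" "u \<in> carrier R" "u \<notin> p" "u \<otimes> (t \<otimes> a) = u \<otimes> (s \<otimes> b)"
  shows "loc_frac R p b t = loc_frac R p a s"
  by (rule loc_frac_eqI) (use assms in \<open>auto simp: loc_frac_mem_iff\<close>)

lemma loc_frac_eq1:
  assumes p: "p \<in> Spec R" and "a \<in> carrier R" "s \<in> carrier R" "s \<notin> p"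
    "b \<in> carrier R" "t \<in> carrier R" "t \<notin> p" "t \<otimes> a = s \<otimes> b"
  shows "loc_frac R p b t = loc_frac R p a s"
  by (rule loc_frac_eq[where u = \<one>]) (use assms Spec_not_one in auto)

text \<open>The operations of the local ring are unions over all representatives; the union collapses
  because its members coincide.\<close>

lemma local_ring_mult:
  assumes p: "p \<in> Spec R" and a: "a \<in> carrier R" "s \<in> carrier R" "s \<notin> p"
    and b: "b \<in> carrier R" "t \<in> carrier R" "t \<notin> p"
  shows "loc_frac R p a s \<otimes>\<^bsub>local_ring R p\<^esub> loc_frac R p b t = loc_frac R p (a \<otimes> b) (s \<otimes> t)"
proof -
  have *: "loc_frac R p (a' \<otimes> b') (s' \<otimes> t') = loc_frac R p (a \<otimes> b) (s \<otimes> t)"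
    if as: "(a', s') \<in> loc_frac R p a s" and bt: "(b', t') \<in> loc_frac R p b t" for a' s' b' t'
  proof -
    obtain u where u: "a' \<in> carrier R" "s' \<in> carrier R" "s' \<notin> p" "u \<in> carrier R" "u \<notin> p"
      "u \<otimes> (s' \<otimes> a) = u \<otimes> (s \<otimes> a')" using as unfolding loc_frac_mem_iff by blast
    obtain v where v: "b' \<in> carrier R" "t' \<in> carrier R" "t' \<notin> p" "v \<in> carrier R" "v \<notin> p"
      "v \<otimes> (t' \<otimes> b) = v \<otimes> (t \<otimes> b')" using bt unfolding loc_frac_mem_iff by blast
    have "(u \<otimes> v) \<otimes> (s' \<otimes> t' \<otimes> (a \<otimes> b)) = (u \<otimes> (s' \<otimes> a)) \<otimes> (v \<otimes> (t' \<otimes> b))"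
      using u(1-5) v(1-5) a b by algebra
    also have "\<dots> = (u \<otimes> v) \<otimes> (s \<otimes> t \<otimes> (a' \<otimes> b'))"
      unfolding u(6) v(6) using u(1-5) v(1-5) a b by algebra
    finally show ?thesis using p u v a b
      by (intro loc_frac_eq[where u = "u \<otimes> v"]) (auto simp: Spec_mult)
  qed
  have "loc_frac R p a s \<otimes>\<^bsub>local_ring R p\<^esub> loc_frac R p b t =
     (\<Union>x\<in>loc_frac R p a s. \<Union>y\<in>loc_frac R p b t. loc_frac R p (a \<otimes> b) (s \<otimes> t))"
    unfolding local_ring_def monoid.simps
    by (intro SUP_cong refl) (use * in \<open>auto split: prod.split\<close>)
  then show ?thesis using loc_frac_self[OF p a] loc_frac_self[OF p b] by auto
qed

lemma local_ring_add:
  assumes p: "p \<in> Spec R" and a: "a \<in> carrier R" "s \<in> carrier R" "s \<notin> p"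
    and b: "b \<in> carrier R" "t \<in> carrier R" "t \<notin> p"
  shows "loc_frac R p a s \<oplus>\<^bsub>local_ring R p\<^esub> loc_frac R p b t =
    loc_frac R p (a \<otimes> t \<oplus> b \<otimes> s) (s \<otimes> t)"
proof -
  have *: "loc_frac R p (a' \<otimes> t' \<oplus> b' \<otimes> s') (s' \<otimes> t') = loc_frac R p (a \<otimes> t \<oplus> b \<otimes> s) (s \<otimes> t)"
    if as: "(a', s') \<in> loc_frac R p a s" and bt: "(b', t') \<in> loc_frac R p b t" for a' s' b' t'
  proof -
    obtain u where u: "a' \<in> carrier R" "s' \<in> carrier R" "s' \<notin> p" "u \<in> carrier R" "u \<notin> p"
      "u \<otimes> (s' \<otimes> a) = u \<otimes> (s \<otimes> a')" using as unfolding loc_frac_mem_iff by blast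
    obtain v where v: "b' \<in> carrier R" "t' \<in> carrier R" "t' \<notin> p" "v \<in> carrier R" "v \<notin> p"
      "v \<otimes> (t' \<otimes> b) = v \<otimes> (t \<otimes> b')" using bt unfolding loc_frac_mem_iff by blast
    have "(u \<otimes> v) \<otimes> (s' \<otimes> t' \<otimes> (a \<otimes> t \<oplus> b \<otimes> s)) =
        (v \<otimes> t' \<otimes> t) \<otimes> (u \<otimes> (s' \<otimes> a)) \<oplus> (u \<otimes> s' \<otimes> s) \<otimes> (v \<otimes> (t' \<otimes> b))"
      using u(1-5) v(1-5) a b by algebra
    also have "\<dots> = (u \<otimes> v) \<otimes> (s \<otimes> t \<otimes> (a' \<otimes> t' \<oplus> b' \<otimes> s'))"
      unfolding u(6) v(6) using u(1-5) v(1-5) a b by algebra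
    finally show ?thesis using p u v a b
      by (intro loc_frac_eq[where u = "u \<otimes> v"]) (auto simp: Spec_mult)
  qed
  have "loc_frac R p a s \<oplus>\<^bsub>local_ring R p\<^esub> loc_frac R p b t =
     (\<Union>x\<in>loc_frac R p a s. \<Union>y\<in>loc_frac R p b t. loc_frac R p (a \<otimes> t \<oplus> b \<otimes> s) (s \<otimes> t))"
    unfolding local_ring_def ring_record_simps
    by (intro SUP_cong refl) (use * in \<open>auto split: prod.split\<close>)
  then show ?thesis using loc_frac_self[OF p a] loc_frac_self[OF p b] by auto
qed

end

section \<open>The structure sheaf\<close>

lemma str_sheaf_simps:
  "\<one>\<^bsub>str_sheaf A U\<^esub> = (\<lambda>p\<in>U. loc_frac A p \<one>\<^bsub>A\<^esub> \<one>\<^bsub>A\<^esub>)"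
  "\<zero>\<^bsub>str_sheaf A U\<^esub> = (\<lambda>p\<in>U. loc_frac A p \<zero>\<^bsub>A\<^esub> \<one>\<^bsub>A\<^esub>)"
  "s \<otimes>\<^bsub>str_sheaf A U\<^esub> t = (\<lambda>p\<in>U. s p \<otimes>\<^bsub>local_ring A p\<^esub> t p)"
  "s \<oplus>\<^bsub>str_sheaf A U\<^esub> t = (\<lambda>p\<in>U. s p \<oplus>\<^bsub>local_ring A p\<^esub> t p)"
  by (simp_all add: str_sheaf_def local_ring_def)

definition frac_sec :: "('a, 'x) ring_scheme \<Rightarrow> 'a set set \<Rightarrow> 'a \<Rightarrow> 'a \<Rightarrow> 'a fsec" where
  "frac_sec A U a b = (\<lambda>p\<in>U. loc_frac A p a b)"

lemma restrict_frac_sec: "V \<subseteq> U \<Longrightarrow> restrict (frac_sec A U a b) V = frac_sec A V a b"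
  by (auto simp: frac_sec_def restrict_def fun_eq_iff)

lemma local_ring_carrier_iff: "x \<in> carrier (local_ring A p) \<longleftrightarrow>
   (\<exists>a s. x = loc_frac A p a s \<and> a \<in> carrier A \<and> s \<in> carrier A \<and> s \<notin> p)"
  by (auto simp: local_ring_def)

lemma str_sheaf_localE:
  assumes "s \<in> carrier (str_sheaf A U)" "p \<in> U"
  obtains V a f where "zopen A V" "p \<in> V" "V \<subseteq> U" "a \<in> carrier A" "f \<in> carrier A"
    "\<And>q. q \<in> V \<Longrightarrow> f \<notin> q \<and> s q = loc_frac A q a f"
proof -
  have "\<forall>p\<in>U. \<exists>V a f. zopen A V \<and> p \<in> V \<and> V \<subseteq> U \<and> a \<in> carrier A \<and> f \<in> carrier A \<and>
           (\<forall>q\<in>V. f \<notin> q \<and> s q = loc_frac A q a f)" using assms(1) by (simp add: str_sheaf_def)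
  from bspec[OF this assms(2)] that show ?thesis by auto
qed

lemma str_sheaf_PiE: "s \<in> carrier (str_sheaf A U) \<Longrightarrow> s \<in> (\<Pi>\<^sub>E p\<in>U. carrier (local_ring A p))"
  by (simp add: str_sheaf_def)

context cring begin

lemma str_sheaf_locally_frac:
  assumes s: "s \<in> carrier (str_sheaf R U)" and p: "p \<in> U"
  shows "\<exists>f\<in>carrier R. \<exists>a\<in>carrier R. \<exists>b\<in>carrier R. p \<in> basic_open R f \<and> basic_open R f \<subseteq> U \<and>
     (\<forall>q\<in>basic_open R f. b \<notin> q) \<and> restrict s (basic_open R f) = frac_sec R (basic_open R f) a b"
proof -
  obtain V a b where V: "zopen R V" "p \<in> V" "V \<subseteq> U" "a \<in> carrier R" "b \<in> carrier R"
    "\<And>q. q \<in> V \<Longrightarrow> b \<notin> q \<and> s q = loc_frac R q a b"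
    using str_sheaf_localE[OF s p] by blast
  obtain f where f: "f \<in> carrier R" "p \<in> basic_open R f" "basic_open R f \<subseteq> V"
    using basic_open_subset[OF V(1,2)] by blast
  have "restrict s (basic_open R f) = frac_sec R (basic_open R f) a b"
    using f V(6) by (auto simp: frac_sec_def restrict_def fun_eq_iff)
  then show ?thesis using f V by blast
qed

lemma frac_sec_closed:
  assumes "zopen R U" "a \<in> carrier R" "b \<in> carrier R" "\<And>p. p \<in> U \<Longrightarrow> b \<notin> p"
  shows "frac_sec R U a b \<in> carrier (str_sheaf R U)"
proof -
  have "\<exists>V a' f. zopen R V \<and> p \<in> V \<and> V \<subseteq> U \<and> a' \<in> carrier R \<and> f \<in> carrier R \<and>
           (\<forall>q\<in>V. f \<notin> q \<and> frac_sec R U a b q = loc_frac R q a' f)" if "p \<in> U" for p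
    using assms that by (intro exI[of _ U] exI[of _ a] exI[of _ b]) (simp add: frac_sec_def)
  moreover have "frac_sec R U a b \<in> (\<Pi>\<^sub>E p\<in>U. carrier (local_ring R p))"
    using assms unfolding frac_sec_def by (fastforce simp: local_ring_carrier_iff)
  ultimately show ?thesis by (simp add: str_sheaf_def)
qed

lemma str_sheaf_restrict_closed:
  assumes "zopen R V" "V \<subseteq> U" and s: "s \<in> carrier (str_sheaf R U)"
  shows "restrict s V \<in> carrier (str_sheaf R V)"
proof -
  have "\<exists>W a f. zopen R W \<and> p \<in> W \<and> W \<subseteq> V \<and> a \<in> carrier R \<and> f \<in> carrier R \<and>
           (\<forall>q\<in>W. f \<notin> q \<and> restrict s V q = loc_frac R q a f)" if p: "p \<in> V" for p
  proof -
    obtain W a f where W: "zopen R W" "p \<in> W" "W \<subseteq> U" "a \<in> carrier R" "f \<in> carrier R"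
      "\<And>q. q \<in> W \<Longrightarrow> f \<notin> q \<and> s q = loc_frac R q a f"
      using str_sheaf_localE[OF s, of p] p assms(2) by blast
    show ?thesis using W p zopen_Int[OF assms(1) W(1)]
      by (intro exI[of _ "V \<inter> W"] exI[of _ a] exI[of _ f]) auto
  qed
  moreover have "restrict s V \<in> (\<Pi>\<^sub>E p\<in>V. carrier (local_ring R p))"
    using str_sheaf_PiE[OF s] assms(2) by auto
  ultimately show ?thesis by (simp add: str_sheaf_def)
qed

lemma frac_sec_mult:
  assumes "U \<subseteq> Spec R" "a \<in> carrier R" "b \<in> carrier R" "s \<in> carrier R" "t \<in> carrier R"
    "\<And>p. p \<in> U \<Longrightarrow> s \<notin> p" "\<And>p. p \<in> U \<Longrightarrow> t \<notin> p"
  shows "frac_sec R U a s \<otimes>\<^bsub>str_sheaf R U\<^esub> frac_sec R U b t = frac_sec R U (a \<otimes> b) (s \<otimes> t)"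
  unfolding frac_sec_def str_sheaf_simps by (rule restrict_ext) (use assms in \<open>simp add: subset_iff local_ring_mult\<close>)

lemma frac_sec_add:
  assumes "U \<subseteq> Spec R" "a \<in> carrier R" "b \<in> carrier R" "s \<in> carrier R" "t \<in> carrier R"
    "\<And>p. p \<in> U \<Longrightarrow> s \<notin> p" "\<And>p. p \<in> U \<Longrightarrow> t \<notin> p"
  shows "frac_sec R U a s \<oplus>\<^bsub>str_sheaf R U\<^esub> frac_sec R U b t =
    frac_sec R U (a \<otimes> t \<oplus> b \<otimes> s) (s \<otimes> t)"
  unfolding frac_sec_def str_sheaf_simps by (rule restrict_ext) (use assms in \<open>simp add: subset_iff local_ring_add\<close>)

lemma frac_sec_eq:
  assumes "U \<subseteq> Spec R" "a \<in> carrier R" "b \<in> carrier R" "s \<in> carrier R" "t \<in> carrier R"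
    "\<And>p. p \<in> U \<Longrightarrow> s \<notin> p" "\<And>p. p \<in> U \<Longrightarrow> t \<notin> p" "t \<otimes> a = s \<otimes> b"
  shows "frac_sec R U b t = frac_sec R U a s"
  unfolding frac_sec_def by (rule restrict_ext, rule loc_frac_eq1) (use assms in \<open>auto simp: subset_iff\<close>)

abbreviation const_sec :: "'a set set \<Rightarrow> 'a \<Rightarrow> 'a fsec" where
  "const_sec U a \<equiv> frac_sec R U a \<one>"

lemma const_sec_one: "const_sec U \<one> = \<one>\<^bsub>str_sheaf R U\<^esub>"
  by (simp add: frac_sec_def str_sheaf_simps)

lemma const_sec_zero: "const_sec U \<zero> = \<zero>\<^bsub>str_sheaf R U\<^esub>"
  by (simp add: frac_sec_def str_sheaf_simps)

context
  fixes U assumes U: "zopen R U"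
begin

lemma one_not_mem_zopen: "p \<in> U \<Longrightarrow> \<one> \<notin> p"
  using U zopen_subset_Spec Spec_not_one by blast

lemma const_sec_closed: "a \<in> carrier R \<Longrightarrow> const_sec U a \<in> carrier (str_sheaf R U)"
  using frac_sec_closed[OF U] one_not_mem_zopen by simp

lemma const_sec_mult: "a \<in> carrier R \<Longrightarrow> b \<in> carrier R \<Longrightarrow>
    const_sec U (a \<otimes> b) = const_sec U a \<otimes>\<^bsub>str_sheaf R U\<^esub> const_sec U b"
  using frac_sec_mult[OF zopen_subset_Spec[OF U], of a b \<one> \<one>] one_not_mem_zopen by simp

lemma const_sec_add: "a \<in> carrier R \<Longrightarrow> b \<in> carrier R \<Longrightarrow>
    const_sec U (a \<oplus> b) = const_sec U a \<oplus>\<^bsub>str_sheaf R U\<^esub> const_sec U b"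
  using frac_sec_add[OF zopen_subset_Spec[OF U], of a b \<one> \<one>] one_not_mem_zopen by simp

lemma inverse_mult_const_sec:
  assumes "b \<in> carrier R" "\<And>p. p \<in> U \<Longrightarrow> b \<notin> p"
  shows "frac_sec R U \<one> b \<otimes>\<^bsub>str_sheaf R U\<^esub> const_sec U b = \<one>\<^bsub>str_sheaf R U\<^esub>"
proof -
  have "frac_sec R U \<one> b \<otimes>\<^bsub>str_sheaf R U\<^esub> const_sec U b = frac_sec R U (\<one> \<otimes> b) (b \<otimes> \<one>)"
    using assms one_not_mem_zopen by (intro frac_sec_mult zopen_subset_Spec[OF U]) auto
  also have "\<dots> = const_sec U \<one>"
    using assms one_not_mem_zopen by (intro frac_sec_eq zopen_subset_Spec[OF U]) auto
  finally show ?thesis by (simp add: const_sec_one)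
qed

lemma const_sec_mult_frac_sec:
  assumes "a \<in> carrier R" "b \<in> carrier R" "\<And>p. p \<in> U \<Longrightarrow> b \<notin> p"
  shows "const_sec U b \<otimes>\<^bsub>str_sheaf R U\<^esub> frac_sec R U a b = const_sec U a"
proof -
  have "const_sec U b \<otimes>\<^bsub>str_sheaf R U\<^esub> frac_sec R U a b = frac_sec R U (b \<otimes> a) (\<one> \<otimes> b)"
    using assms one_not_mem_zopen by (intro frac_sec_mult zopen_subset_Spec[OF U]) auto
  also have "\<dots> = const_sec U a"
    using assms one_not_mem_zopen by (intro frac_sec_eq zopen_subset_Spec[OF U]) auto
  finally show ?thesis .
qed

end

text \<open>The maximal ideal of the local ring. It serves to show that a linear combination of
  fractions can be \<open>1\<close> at \<open>p\<close> only if one of their numerators does not vanish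
  at \<open>p\<close>.\<close>

definition local_max_ideal :: "'a set \<Rightarrow> ('a \<times> 'a) set set" where
  "local_max_ideal p = {loc_frac R p a s | a s. a \<in> p \<and> s \<in> carrier R \<and> s \<notin> p}"

lemma one_not_in_local_max_ideal:
  assumes p: "p \<in> Spec R" shows "loc_frac R p \<one> \<one> \<notin> local_max_ideal p"
proof
  assume "loc_frac R p \<one> \<one> \<in> local_max_ideal p"
  then obtain a s where as: "a \<in> p" "s \<in> carrier R" "s \<notin> p" "loc_frac R p \<one> \<one> = loc_frac R p a s"
    by (auto simp: local_max_ideal_def)
  have a: "a \<in> carrier R" using Spec_subset[OF p] as by auto
  have "(\<one>, \<one>) \<in> loc_frac R p a s" using as loc_frac_self[OF p, of \<one> \<one>] Spec_not_one[OF p] by simp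
  then obtain u where u: "u \<in> carrier R" "u \<notin> p" "u \<otimes> (\<one> \<otimes> a) = u \<otimes> (s \<otimes> \<one>)"
    unfolding loc_frac_mem_iff by blast
  then have "u \<otimes> a = u \<otimes> s" using a as by simp
  then show False using Spec_mult[OF p u(1) a] Spec_mult[OF p u(1) as(2)] u as by auto
qed

lemma local_max_ideal_zero: "p \<in> Spec R \<Longrightarrow> loc_frac R p \<zero> \<one> \<in> local_max_ideal p"
  unfolding local_max_ideal_def using Spec_zero Spec_not_one by blast

lemma local_max_ideal_add:
  assumes p: "p \<in> Spec R" and "x \<in> local_max_ideal p" "y \<in> local_max_ideal p"
  shows "x \<oplus>\<^bsub>local_ring R p\<^esub> y \<in> local_max_ideal p"
proof -
  obtain a s where a: "a \<in> p" "s \<in> carrier R" "s \<notin> p" "x = loc_frac R p a s"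
    using assms by (auto simp: local_max_ideal_def)
  obtain b t where b: "b \<in> p" "t \<in> carrier R" "t \<notin> p" "y = loc_frac R p b t"
    using assms by (auto simp: local_max_ideal_def)
  have c: "a \<in> carrier R" "b \<in> carrier R" using a b Spec_subset[OF p] by auto
  have "x \<oplus>\<^bsub>local_ring R p\<^esub> y = loc_frac R p (a \<otimes> t \<oplus> b \<otimes> s) (s \<otimes> t)"
    using a b c p by (simp add: local_ring_add)
  moreover have "a \<otimes> t \<oplus> b \<otimes> s \<in> p" using a b c p by (intro Spec_add) (auto simp: Spec_mult)
  moreover have "s \<otimes> t \<notin> p" using a b p by (auto simp: Spec_mult)
  ultimately show ?thesis unfolding local_max_ideal_def using a b by blast
qed

lemma local_max_ideal_mult:
  assumes p: "p \<in> Spec R" and "x \<in> carrier (local_ring R p)" "y \<in> local_max_ideal p"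
  shows "x \<otimes>\<^bsub>local_ring R p\<^esub> y \<in> local_max_ideal p"
proof -
  obtain a s where a: "a \<in> carrier R" "s \<in> carrier R" "s \<notin> p" "x = loc_frac R p a s"
    using assms by (auto simp: local_ring_carrier_iff)
  obtain b t where b: "b \<in> p" "t \<in> carrier R" "t \<notin> p" "y = loc_frac R p b t"
    using assms by (auto simp: local_max_ideal_def)
  have c: "b \<in> carrier R" using b Spec_subset[OF p] by auto
  have "x \<otimes>\<^bsub>local_ring R p\<^esub> y = loc_frac R p (a \<otimes> b) (s \<otimes> t)"
    using a b c p by (simp add: local_ring_mult)
  moreover have "a \<otimes> b \<in> p" using a b c p by (auto simp: Spec_mult)
  moreover have "s \<otimes> t \<notin> p" using a b p by (auto simp: Spec_mult)
  ultimately show ?thesis unfolding local_max_ideal_def using a b by blast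
qed

end

text \<open>An automorphism acts on the spectrum through the images of prime ideals. The inverse is part
  of the data, because the image under \<open>\<sigma>\<close> is studied as the preimage under
  \<open>\<tau>\<close>.\<close>

locale ring_aut = cring R for R (structure) +
  fixes \<sigma> \<tau> :: "'a \<Rightarrow> 'a"
  assumes hom: "\<sigma> \<in> ring_hom R R" "\<tau> \<in> ring_hom R R"
    and inverse: "x \<in> carrier R \<Longrightarrow> \<sigma> (\<tau> x) = x" "x \<in> carrier R \<Longrightarrow> \<tau> (\<sigma> x) = x"
begin

lemma closed [simp]: "x \<in> carrier R \<Longrightarrow> \<sigma> x \<in> carrier R" "x \<in> carrier R \<Longrightarrow> \<tau> x \<in> carrier R"
  using hom ring_hom_closed by metis+

lemma image_eq_vimage: "I \<subseteq> carrier R \<Longrightarrow> \<sigma> ` I = {x \<in> carrier R. \<tau> x \<in> I}"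
  using inverse closed by (auto simp: image_iff subset_iff) metis

lemma inv_image: assumes "p \<subseteq> carrier R" shows "\<tau> ` \<sigma> ` p = p"
proof -
  have "(\<lambda>x. \<tau> (\<sigma> x)) ` p = (\<lambda>x. x) ` p" by (rule image_cong) (use assms inverse in auto)
  then show ?thesis by (simp add: image_image)
qed

lemma image_mem_iff: "p \<in> Spec R \<Longrightarrow> a \<in> carrier R \<Longrightarrow> \<sigma> a \<in> \<sigma> ` p \<longleftrightarrow> a \<in> p"
  using inverse Spec_subset[of p] by (auto simp: image_eq_vimage)

lemma image_Spec: assumes "p \<in> Spec R" shows "\<sigma> ` p \<in> Spec R"
proof -
  interpret t: ring_hom_ring R R \<tau>
    by unfold_locales (rule hom(2))
  show ?thesis unfolding Spec_def image_eq_vimage[OF Spec_subset[OF assms]]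
    using t.primeideal_vimage[OF cring_axioms Spec_primeideal[OF assms]] by simp
qed

lemma inv_aut: "ring_aut R \<tau> \<sigma>"
  using hom inverse by unfold_locales auto

lemma map_loc_frac:
  assumes p: "p \<in> Spec R" and a: "a \<in> carrier R" "s \<in> carrier R" "s \<notin> p"
  shows "map_prod \<sigma> \<sigma> ` loc_frac R p a s = loc_frac R (\<sigma> ` p) (\<sigma> a) (\<sigma> s)"
proof -
  \<comment> \<open>One inclusion for an arbitrary automorphism; applied to the inverse, it gives the
    other one.\<close>
  have sub: "map_prod \<sigma> \<sigma> ` loc_frac R p a s \<subseteq> loc_frac R (\<sigma> ` p) (\<sigma> a) (\<sigma> s)"
    if r: "ring_aut R \<sigma> \<tau>" and p: "p \<in> Spec R" and a: "a \<in> carrier R" "s \<in> carrier R"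
    for \<sigma> \<tau> p a s
  proof
    interpret r: ring_aut R \<sigma> \<tau> by fact
    fix x assume "x \<in> map_prod \<sigma> \<sigma> ` loc_frac R p a s"
    then obtain b t where bt: "(b, t) \<in> loc_frac R p a s" "x = (\<sigma> b, \<sigma> t)" by auto
    then obtain u where u: "b \<in> carrier R" "t \<in> carrier R" "t \<notin> p" "u \<in> carrier R" "u \<notin> p"
      "u \<otimes> (t \<otimes> a) = u \<otimes> (s \<otimes> b)" unfolding loc_frac_mem_iff by blast
    have "\<sigma> (u \<otimes> (t \<otimes> a)) = \<sigma> (u \<otimes> (s \<otimes> b))" using u by simp
    then have "\<sigma> u \<otimes> (\<sigma> t \<otimes> \<sigma> a) = \<sigma> u \<otimes> (\<sigma> s \<otimes> \<sigma> b)"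
      using u(1-5) a by (simp add: ring_hom_mult[OF r.hom(1)])
    moreover have "\<sigma> u \<notin> \<sigma> ` p" "\<sigma> t \<notin> \<sigma> ` p" using r.image_mem_iff[OF p] u by auto
    ultimately show "x \<in> loc_frac R (\<sigma> ` p) (\<sigma> a) (\<sigma> s)"
      unfolding bt loc_frac_mem_iff using r.closed u by (intro conjI bexI[of _ "\<sigma> u"]) auto
  qed
  show ?thesis
  proof
    show "map_prod \<sigma> \<sigma> ` loc_frac R p a s \<subseteq> loc_frac R (\<sigma> ` p) (\<sigma> a) (\<sigma> s)"
      using sub[OF ring_aut_axioms] p a by blast
    show "loc_frac R (\<sigma> ` p) (\<sigma> a) (\<sigma> s) \<subseteq> map_prod \<sigma> \<sigma> ` loc_frac R p a s"
    proof
      fix x assume x: "x \<in> loc_frac R (\<sigma> ` p) (\<sigma> a) (\<sigma> s)"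
      obtain b t where bt: "x = (b, t)" by (cases x)
      have c: "b \<in> carrier R" "t \<in> carrier R" using x unfolding bt loc_frac_mem_iff by auto
      have "map_prod \<tau> \<tau> x \<in> loc_frac R (\<tau> ` \<sigma> ` p) (\<tau> (\<sigma> a)) (\<tau> (\<sigma> s))"
        using sub[OF inv_aut image_Spec[OF p] closed(1)[OF a(1)] closed(1)[OF a(2)]] x by blast
      then have "map_prod \<tau> \<tau> x \<in> loc_frac R p a s"
        using inverse(2) a inv_image[OF Spec_subset[OF p]] by simp
      moreover have "x = map_prod \<sigma> \<sigma> (map_prod \<tau> \<tau> x)" using inverse(1) c bt by simp
      ultimately show "x \<in> map_prod \<sigma> \<sigma> ` loc_frac R p a s" by blast
    qed
  qed
qed

lemma image_zopen: assumes "zopen R U" shows "zopen R ((`) \<sigma> ` U)"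
proof -
  obtain S where S: "S \<subseteq> carrier R" "U = {p \<in> Spec R. \<not> S \<subseteq> p}" using assms by (auto simp: zopen_def)
  interpret t: ring_aut R \<tau> \<sigma> by (rule inv_aut)
  have "(`) \<sigma> ` U = {p \<in> Spec R. \<not> \<sigma> ` S \<subseteq> p}"
  proof (intro Set.set_eqI iffI)
    fix q assume "q \<in> (`) \<sigma> ` U"
    then obtain p f where p: "p \<in> Spec R" "f \<in> S" "f \<notin> p" "q = \<sigma> ` p" using S by auto
    then have "\<sigma> f \<notin> q" using image_mem_iff[OF p(1), of f] S by auto
    then show "q \<in> {p \<in> Spec R. \<not> \<sigma> ` S \<subseteq> p}" using image_Spec p by auto
  next
    fix q assume "q \<in> {p \<in> Spec R. \<not> \<sigma> ` S \<subseteq> p}"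
    then obtain f where q: "q \<in> Spec R" "f \<in> S" "\<sigma> f \<notin> q" by auto
    then have f: "f \<in> carrier R" using S by auto
    have "f \<notin> \<tau> ` q" using t.image_mem_iff[OF q(1), of "\<sigma> f"] q f inverse by auto
    then have "\<tau> ` q \<in> U" using t.image_Spec[OF q(1)] q S by auto
    moreover have "q = \<sigma> ` \<tau> ` q" using t.inv_image[OF Spec_subset[OF q(1)]] by simp
    ultimately show "q \<in> (`) \<sigma> ` U" by blast
  qed
  moreover have "\<sigma> ` S \<subseteq> carrier R" using S(1) by auto
  ultimately show ?thesis unfolding zopen_def by (intro exI[of _ "\<sigma> ` S"] conjI)
qed

lemma image_Spec_eq: "(`) \<sigma> ` Spec R = Spec R"
proof -
  interpret t: ring_aut R \<tau> \<sigma> by (rule inv_aut)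
  show ?thesis
  proof
    show "(`) \<sigma> ` Spec R \<subseteq> Spec R" using image_Spec by blast
    show "Spec R \<subseteq> (`) \<sigma> ` Spec R"
    proof
      fix p assume p: "p \<in> Spec R"
      have "p = \<sigma> ` \<tau> ` p" using t.inv_image[OF Spec_subset[OF p]] by simp
      then show "p \<in> (`) \<sigma> ` Spec R" using t.image_Spec[OF p] by (rule image_eqI)
    qed
  qed
qed

text \<open>If a section is \<open>a / f\<close> near \<open>p\<close>, then the transported one is
  \<open>\<sigma> a / \<sigma> f\<close> near \<open>\<sigma> p\<close>.\<close>

lemma transport_section_closed:
  assumes U: "zopen R U" and c: "c \<in> carrier (str_sheaf R U)"
  shows "(\<lambda>q\<in>(`) \<sigma> ` U. map_prod \<sigma> \<sigma> ` c (\<tau> ` q)) \<in> carrier (str_sheaf R ((`) \<sigma> ` U))"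
    (is "?d \<in> _")
proof -
  have loc: "\<exists>V a f. zopen R V \<and> q \<in> V \<and> V \<subseteq> (`) \<sigma> ` U \<and> a \<in> carrier R \<and> f \<in> carrier R \<and>
           (\<forall>q\<in>V. f \<notin> q \<and> ?d q = loc_frac R q a f)" if q: "q \<in> (`) \<sigma> ` U" for q
  proof -
    obtain p where p: "p \<in> U" "q = \<sigma> ` p" using q by auto
    obtain V a f where W: "zopen R V" "p \<in> V" "V \<subseteq> U" "a \<in> carrier R" "f \<in> carrier R"
      "\<And>q. q \<in> V \<Longrightarrow> f \<notin> q \<and> c q = loc_frac R q a f"
      using str_sheaf_localE[OF c p(1)] by blast
    have "\<sigma> f \<notin> \<sigma> ` r \<and> ?d (\<sigma> ` r) = loc_frac R (\<sigma> ` r) (\<sigma> a) (\<sigma> f)" if r: "r \<in> V" for r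
    proof -
      have "r \<in> Spec R" using r W(1) zopen_subset_Spec by blast
      then show ?thesis using W r by (auto simp: image_mem_iff inv_image[OF Spec_subset] map_loc_frac)
    qed
    then show ?thesis using W p image_zopen[OF W(1)]
      by (intro exI[of _ "(`) \<sigma> ` V"] exI[of _ "\<sigma> a"] exI[of _ "\<sigma> f"]) auto
  qed
  moreover have "?d \<in> (\<Pi>\<^sub>E p\<in>(`) \<sigma> ` U. carrier (local_ring R p))"
  proof
    fix q assume "q \<in> (`) \<sigma> ` U"
    from loc[OF this] show "?d q \<in> carrier (local_ring R q)" unfolding local_ring_carrier_iff by metis
  qed auto
  ultimately show ?thesis by (simp add: str_sheaf_def)
qed

end

section \<open>Linear combinations\<close>

lemma (in abelian_monoid) finsum_in:
  assumes "\<zero> \<in> H" "\<And>x y. x \<in> H \<Longrightarrow> y \<in> H \<Longrightarrow> x \<oplus> y \<in> H" "H \<subseteq> carrier G"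
    and "f \<in> T \<rightarrow> H"
  shows "finsum G f T \<in> H"
proof (cases "finite T")
  case True
  then show ?thesis using assms(4)
  proof (induction T)
    case (insert x T)
    then have "f \<in> T \<rightarrow> carrier G" "f x \<in> carrier G" using assms(3) by auto
    then show ?case using insert assms by (simp add: Pi_iff)
  qed (simp add: assms)
qed (simp add: assms)

lemma finsum_additive:
  assumes "abelian_group M" "abelian_group N"
    and "\<phi> \<in> carrier M \<rightarrow> carrier N"
    and add: "\<And>x y. x \<in> carrier M \<Longrightarrow> y \<in> carrier M \<Longrightarrow> \<phi> (x \<oplus>\<^bsub>M\<^esub> y) = \<phi> x \<oplus>\<^bsub>N\<^esub> \<phi> y"
    and f: "f \<in> T \<rightarrow> carrier M"
  shows "\<phi> (finsum M f T) = finsum N (\<lambda>x. \<phi> (f x)) T" and "\<phi> \<zero>\<^bsub>M\<^esub> = \<zero>\<^bsub>N\<^esub>"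
proof -
  interpret M: abelian_group M by fact
  interpret N: abelian_group N by fact
  have c: "\<phi> x \<in> carrier N" if "x \<in> carrier M" for x using assms(3) that by auto
  show 0: "\<phi> \<zero>\<^bsub>M\<^esub> = \<zero>\<^bsub>N\<^esub>"
    using add[of "\<zero>\<^bsub>M\<^esub>" "\<zero>\<^bsub>M\<^esub>"] c[of "\<zero>\<^bsub>M\<^esub>"] by simp
  show "\<phi> (finsum M f T) = finsum N (\<lambda>x. \<phi> (f x)) T"
  proof (cases "finite T")
    case True
    then show ?thesis using f
    proof (induction T)
      case (insert x T)
      then have "f \<in> T \<rightarrow> carrier M" "f x \<in> carrier M" by auto
      moreover from this have "(\<lambda>x. \<phi> (f x)) \<in> T \<rightarrow> carrier N" using c by auto
      ultimately show ?case using insert c by (simp add: add)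
    qed (simp add: 0)
  qed (simp add: 0)
qed

lemma finsum_restrict_carrier:
  assumes "abelian_group M" "abelian_group (M\<lparr>carrier := H\<rparr>)" "H \<subseteq> carrier M" "f \<in> T \<rightarrow> H"
  shows "finsum (M\<lparr>carrier := H\<rparr>) f T = finsum M f T"
  using finsum_additive(1)[OF assms(2,1), of "\<lambda>x. x" f T] assms(3,4) by auto

text \<open>The generators form a family indexed by \<open>S\<close>, since one set of global sections
  generates over every open set by way of its restrictions, which need not be distinct.\<close>

definition lin_span :: "('r, 'x) ring_scheme \<Rightarrow> ('r, 'm, 'y) module_scheme \<Rightarrow> ('e \<Rightarrow> 'm) \<Rightarrow> 'e set \<Rightarrow> 'm set"
  where "lin_span R M \<phi> S = {x. \<exists>T c. finite T \<and> T \<subseteq> S \<and> c \<in> T \<rightarrow> carrier R \<and>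
    x = (\<Oplus>\<^bsub>M\<^esub>e\<in>T. c e \<odot>\<^bsub>M\<^esub> \<phi> e)}"

context module
begin

text \<open>Closure under negation is automatic, since \<open>- x = (- 1) x\<close>.\<close>

lemma submoduleI_smult:
  assumes "H \<subseteq> carrier M" "\<zero>\<^bsub>M\<^esub> \<in> H" "\<And>x y. x \<in> H \<Longrightarrow> y \<in> H \<Longrightarrow> x \<oplus>\<^bsub>M\<^esub> y \<in> H"
    and smult: "\<And>a x. a \<in> carrier R \<Longrightarrow> x \<in> H \<Longrightarrow> a \<odot>\<^bsub>M\<^esub> x \<in> H"
  shows "submodule H R M"
proof (rule submoduleI)
  fix x assume "x \<in> H"
  moreover from this have "\<ominus>\<^bsub>M\<^esub> x = (\<ominus> \<one>) \<odot>\<^bsub>M\<^esub> x" using assms(1) by (auto simp: smult_l_minus)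
  ultimately show "\<ominus>\<^bsub>M\<^esub> x \<in> H" using smult by simp
qed (use assms in auto)

lemma submodule_zero: "submodule H R M \<Longrightarrow> \<zero>\<^bsub>M\<^esub> \<in> H"
  using subgroup.one_closed[OF submodule.axioms(1)] by force

lemma finsum_in_submodule: "submodule H R M \<Longrightarrow> f \<in> T \<rightarrow> H \<Longrightarrow> finsum M f T \<in> H"
  using submoduleE submodule_zero by (intro M.finsum_in) auto

lemma lin_span_least:
  assumes "submodule H R M" "\<And>e. e \<in> S \<Longrightarrow> \<phi> e \<in> H"
  shows "lin_span R M \<phi> S \<subseteq> H"
  using assms by (auto simp: lin_span_def subset_iff intro!: finsum_in_submodule submodule.smult_closed)

lemma lin_span_base: assumes "\<phi> \<in> S \<rightarrow> carrier M" "e \<in> S" shows "\<phi> e \<in> lin_span R M \<phi> S"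
  unfolding lin_span_def mem_Collect_eq using assms
  by (intro exI[of _ "{e}"] exI[of _ "\<lambda>_. \<one>"]) (auto simp: Pi_iff)

lemma lin_span_closed: "\<phi> \<in> S \<rightarrow> carrier M \<Longrightarrow> lin_span R M \<phi> S \<subseteq> carrier M"
  by (rule lin_span_least[OF carrier_is_submodule]) auto

lemma lin_span_add:
  assumes \<phi>: "\<phi> \<in> S \<rightarrow> carrier M" and "x \<in> lin_span R M \<phi> S" "y \<in> lin_span R M \<phi> S"
  shows "x \<oplus>\<^bsub>M\<^esub> y \<in> lin_span R M \<phi> S"
proof -
  obtain T c where T: "finite T" "T \<subseteq> S" "c \<in> T \<rightarrow> carrier R" "x = (\<Oplus>\<^bsub>M\<^esub>e\<in>T. c e \<odot>\<^bsub>M\<^esub> \<phi> e)"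
    using assms(2) by (auto simp: lin_span_def)
  obtain T' c' where T': "finite T'" "T' \<subseteq> S" "c' \<in> T' \<rightarrow> carrier R" "y = (\<Oplus>\<^bsub>M\<^esub>e\<in>T'. c' e \<odot>\<^bsub>M\<^esub> \<phi> e)"
    using assms(3) by (auto simp: lin_span_def)
  define d where "d = (\<lambda>e. if e \<in> T then c e else \<zero>)"
  define d' where "d' = (\<lambda>e. if e \<in> T' then c' e else \<zero>)"
  have \<phi>c: "\<phi> e \<in> carrier M" if "e \<in> T \<union> T'" for e using \<phi> T T' that by auto
  have dc: "d e \<in> carrier R" "d' e \<in> carrier R" for e using T T' by (auto simp: d_def d'_def)
  have x: "x = (\<Oplus>\<^bsub>M\<^esub>e\<in>T \<union> T'. d e \<odot>\<^bsub>M\<^esub> \<phi> e)" unfolding T(4)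
    by (rule M.add.finprod_mono_neutral_cong_left) (use T(1-3) T'(1-3) \<phi>c dc in \<open>auto simp: d_def Pi_iff\<close>)
  have y: "y = (\<Oplus>\<^bsub>M\<^esub>e\<in>T \<union> T'. d' e \<odot>\<^bsub>M\<^esub> \<phi> e)" unfolding T'(4)
    by (rule M.add.finprod_mono_neutral_cong_left) (use T(1-3) T'(1-3) \<phi>c dc in \<open>auto simp: d'_def Pi_iff\<close>)
  have "x \<oplus>\<^bsub>M\<^esub> y = (\<Oplus>\<^bsub>M\<^esub>e\<in>T \<union> T'. d e \<odot>\<^bsub>M\<^esub> \<phi> e \<oplus>\<^bsub>M\<^esub> d' e \<odot>\<^bsub>M\<^esub> \<phi> e)"
    unfolding x y using \<phi>c dc by (intro M.finsum_addf[symmetric]) auto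
  also have "\<dots> = (\<Oplus>\<^bsub>M\<^esub>e\<in>T \<union> T'. (d e \<oplus> d' e) \<odot>\<^bsub>M\<^esub> \<phi> e)"
    using \<phi>c dc by (intro M.finsum_cong') (auto simp: smult_l_distr)
  finally show ?thesis unfolding lin_span_def mem_Collect_eq
    using T(1-3) T'(1-3) dc by (intro exI[of _ "T \<union> T'"] exI[of _ "\<lambda>e. d e \<oplus> d' e"]) auto
qed

lemma lin_span_smult:
  assumes \<phi>: "\<phi> \<in> S \<rightarrow> carrier M" and "x \<in> lin_span R M \<phi> S" and a: "a \<in> carrier R"
  shows "a \<odot>\<^bsub>M\<^esub> x \<in> lin_span R M \<phi> S"
proof -
  obtain T c where T: "finite T" "T \<subseteq> S" "c \<in> T \<rightarrow> carrier R" "x = (\<Oplus>\<^bsub>M\<^esub>e\<in>T. c e \<odot>\<^bsub>M\<^esub> \<phi> e)"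
    using assms(2) by (auto simp: lin_span_def)
  have \<phi>c: "\<phi> e \<in> carrier M" if "e \<in> T" for e using \<phi> T that by auto
  have cc: "c e \<in> carrier R" if "e \<in> T" for e using T that by auto
  have "a \<odot>\<^bsub>M\<^esub> x = (\<Oplus>\<^bsub>M\<^esub>e\<in>T. a \<odot>\<^bsub>M\<^esub> (c e \<odot>\<^bsub>M\<^esub> \<phi> e))" unfolding T(4)
    using T(1) a \<phi>c cc by (intro finsum_smult_ldistr) auto
  also have "\<dots> = (\<Oplus>\<^bsub>M\<^esub>e\<in>T. (a \<otimes> c e) \<odot>\<^bsub>M\<^esub> \<phi> e)"
    using \<phi>c cc a by (intro M.finsum_cong') (auto simp: smult_assoc1)
  finally show ?thesis unfolding lin_span_def mem_Collect_eq
    using T(1-3) cc a by (intro exI[of _ T] exI[of _ "\<lambda>e. a \<otimes> c e"]) auto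
qed

lemma submodule_lin_span:
  assumes \<phi>: "\<phi> \<in> S \<rightarrow> carrier M" shows "submodule (lin_span R M \<phi> S) R M"
proof (rule submoduleI_smult)
  show "\<zero>\<^bsub>M\<^esub> \<in> lin_span R M \<phi> S"
    unfolding lin_span_def mem_Collect_eq by (intro exI[of _ "{}"]) auto
qed (use lin_span_closed[OF \<phi>] lin_span_add[OF \<phi>] lin_span_smult[OF \<phi>] in auto)

end

section \<open>Sheaves of modules\<close>

locale module_sheaf = cring A for A :: "('g, 'a, 'y) g_scheme_scheme" (structure) +
  fixes F :: "('g, 'a, 'm) g_sheaf"
  assumes sheaf: "sheaf_of_modules A F"
begin

abbreviation D :: "'a \<Rightarrow> 'a set set" where "D \<equiv> basic_open A"

abbreviation Reg :: "'a set set \<Rightarrow> 'a fsec set" where "Reg U \<equiv> carrier (str_sheaf A U)"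

abbreviation Sec :: "'a set set \<Rightarrow> 'm set" where "Sec U \<equiv> carrier (sec F U)"

abbreviation zero_sec :: "'a set set \<Rightarrow> 'm" where "zero_sec U \<equiv> \<zero>\<^bsub>sec F U\<^esub>"

abbreviation local_span :: "'m set \<Rightarrow> 'a set set \<Rightarrow> 'm set" where
  "local_span S U \<equiv> lin_span (str_sheaf A U) (sec F U) (res F (Spec A) U) S"

lemmas sheaf_axioms =
  sheaf[unfolded sheaf_of_modules_def, THEN conjunct1, THEN spec, THEN mp]
  sheaf[unfolded sheaf_of_modules_def, THEN conjunct2, THEN conjunct1, THEN spec, THEN spec, THEN mp]
  sheaf[unfolded sheaf_of_modules_def, THEN conjunct2, THEN conjunct2, THEN conjunct1, THEN spec, THEN mp]
  sheaf[unfolded sheaf_of_modules_def, THEN conjunct2, THEN conjunct2, THEN conjunct2, THEN conjunct1,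
    THEN spec, THEN spec, THEN spec, THEN mp]
  sheaf[unfolded sheaf_of_modules_def, THEN conjunct2, THEN conjunct2, THEN conjunct2, THEN conjunct2,
    THEN spec, THEN spec, THEN mp]

lemma sec_module: "zopen A U \<Longrightarrow> module (str_sheaf A U) (sec F U)"
  by (rule sheaf_axioms(1))

lemma sec_abelian: "zopen A U \<Longrightarrow> abelian_group (sec F U)"
  using sec_module module.axioms by blast

context
  fixes U V assumes U: "zopen A U" and V: "zopen A V" and VU: "V \<subseteq> U"
begin

lemma res_Pi: "res F U V \<in> Sec U \<rightarrow> Sec V"
  using sheaf_axioms(2)[OF conjI[OF U conjI[OF V VU]]] by blast

lemma res_closed: "s \<in> Sec U \<Longrightarrow> res F U V s \<in> Sec V"
  using res_Pi by auto

lemma res_add: "s \<in> Sec U \<Longrightarrow> t \<in> Sec U \<Longrightarrow>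
   res F U V (s \<oplus>\<^bsub>sec F U\<^esub> t) = res F U V s \<oplus>\<^bsub>sec F V\<^esub> res F U V t"
  using sheaf_axioms(2)[OF conjI[OF U conjI[OF V VU]]] by blast

lemma res_smult: "c \<in> Reg U \<Longrightarrow> s \<in> Sec U \<Longrightarrow>
   res F U V (c \<odot>\<^bsub>sec F U\<^esub> s) = restrict c V \<odot>\<^bsub>sec F V\<^esub> res F U V s"
  using sheaf_axioms(2)[OF conjI[OF U conjI[OF V VU]]] by blast

lemma res_zero: "res F U V (zero_sec U) = zero_sec V"
  using finsum_additive(2)[OF sec_abelian[OF U] sec_abelian[OF V] res_Pi] res_add by blast

lemma res_finsum: "f \<in> T \<rightarrow> Sec U \<Longrightarrow>
    res F U V (finsum (sec F U) f T) = finsum (sec F V) (\<lambda>x. res F U V (f x)) T"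
  using finsum_additive(1)[OF sec_abelian[OF U] sec_abelian[OF V] res_Pi] res_add by blast

lemma res_comp: "zopen A W \<Longrightarrow> W \<subseteq> V \<Longrightarrow> s \<in> Sec U \<Longrightarrow>
    res F V W (res F U V s) = res F U W s"
  using sheaf_axioms(4)[of U V W] U V VU by simp

end

lemma res_id: "zopen A U \<Longrightarrow> s \<in> Sec U \<Longrightarrow> res F U U s = s"
  using sheaf_axioms(3) by blast

lemma glue:
  assumes "\<And>V. V \<in> \<U> \<Longrightarrow> zopen A V \<and> t V \<in> Sec V"
    "\<And>V W. V \<in> \<U> \<Longrightarrow> W \<in> \<U> \<Longrightarrow> res F V (V \<inter> W) (t V) = res F W (V \<inter> W) (t W)"
  shows "\<exists>!s. s \<in> Sec (\<Union>\<U>) \<and> (\<forall>V\<in>\<U>. res F (\<Union>\<U>) V s = t V)"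
  using sheaf_axioms(5)[of \<U> t] assms by blast

lemma res_eq_subset:
  assumes "zopen A U" "zopen A U'" "zopen A V" "V \<subseteq> U" "V \<subseteq> U'" "zopen A W" "W \<subseteq> V"
    and "s \<in> Sec U" "s' \<in> Sec U'" "res F U V s = res F U' V s'"
  shows "res F U W s = res F U' W s'"
  using res_comp[OF assms(1,3,4,6,7,8)] res_comp[OF assms(2,3,5,6,7,9)] assms(10) by simp

text \<open>This is the uniqueness of gluing for the cover by all open sets on which the two sections
  agree.\<close>

lemma eq_if_locally_eq:
  assumes U: "zopen A U" and s: "s \<in> Sec U" "t \<in> Sec U"
    and loc: "\<And>p. p \<in> U \<Longrightarrow> \<exists>W. zopen A W \<and> p \<in> W \<and> W \<subseteq> U \<and> res F U W s = res F U W t"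
  shows "s = t"
proof -
  define \<U> where "\<U> = {W. zopen A W \<and> W \<subseteq> U \<and> res F U W s = res F U W t}"
  have cover: "\<Union>\<U> = U" using loc by (auto simp: \<U>_def)
  have "\<exists>!x. x \<in> Sec (\<Union>\<U>) \<and> (\<forall>V\<in>\<U>. res F (\<Union>\<U>) V x = res F U V s)"
  proof (rule glue)
    fix V W assume "V \<in> \<U>" "W \<in> \<U>"
    then show "res F V (V \<inter> W) (res F U V s) = res F W (V \<inter> W) (res F U W s)"
      using U s zopen_Int by (simp add: \<U>_def res_comp)
  qed (use U s in \<open>auto simp: \<U>_def intro: res_closed\<close>)
  then show ?thesis unfolding cover using s by (auto simp: \<U>_def)
qed

text \<open>The subsheaves of modules. Because of the third condition, sections that are glued in \<open>F\<close> from
  sections of \<open>P\<close> belong to \<open>P\<close>.\<close>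

definition submodule_sheaf :: "('a set set \<Rightarrow> 'm set) \<Rightarrow> bool" where
  "submodule_sheaf P \<longleftrightarrow> (\<forall>U. zopen A U \<longrightarrow> submodule (P U) (str_sheaf A U) (sec F U)) \<and>
     (\<forall>U V s. zopen A U \<and> zopen A V \<and> V \<subseteq> U \<and> s \<in> P U \<longrightarrow> res F U V s \<in> P V) \<and>
     (\<forall>U s. zopen A U \<and> s \<in> Sec U \<and>
        (\<forall>p\<in>U. \<exists>W. zopen A W \<and> p \<in> W \<and> W \<subseteq> U \<and> res F U W s \<in> P W) \<longrightarrow> s \<in> P U)"

lemma subsheaf_simps [simp]: "sec (subsheaf F P) U = (sec F U)\<lparr>carrier := P U\<rparr>"
   "res (subsheaf F P) = res F" "lin (subsheaf F P) = lin F"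
  by (simp_all add: subsheaf_def)

context
  fixes P assumes P: "submodule_sheaf P"
begin

lemma P_submodule: "zopen A U \<Longrightarrow> submodule (P U) (str_sheaf A U) (sec F U)"
  using P unfolding submodule_sheaf_def by blast

lemma P_subset: "zopen A U \<Longrightarrow> P U \<subseteq> Sec U"
  using module.submoduleE(1)[OF sec_module P_submodule] .

lemma P_res: "zopen A U \<Longrightarrow> zopen A V \<Longrightarrow> V \<subseteq> U \<Longrightarrow> s \<in> P U \<Longrightarrow> res F U V s \<in> P V"
  using P unfolding submodule_sheaf_def by blast

lemma P_local:
  assumes "zopen A U" "s \<in> Sec U"
    "\<And>p. p \<in> U \<Longrightarrow> \<exists>W. zopen A W \<and> p \<in> W \<and> W \<subseteq> U \<and> res F U W s \<in> P W"
  shows "s \<in> P U"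
  using P assms unfolding submodule_sheaf_def by blast

lemma P_module: "zopen A U \<Longrightarrow> module (str_sheaf A U) ((sec F U)\<lparr>carrier := P U\<rparr>)"
  using submodule.submodule_is_module[OF P_submodule sec_module] .

lemma P_finsum: "zopen A U \<Longrightarrow> f \<in> T \<rightarrow> P U \<Longrightarrow>
   finsum ((sec F U)\<lparr>carrier := P U\<rparr>) f T = finsum (sec F U) f T"
  using finsum_restrict_carrier[OF sec_abelian _ P_subset] module.axioms(2)[OF P_module] by blast

lemma sheaf_subsheaf: "sheaf_of_modules A (subsheaf F P)"
proof -
  have glue': "\<exists>!s. s \<in> P (\<Union>\<U>) \<and> (\<forall>V\<in>\<U>. res F (\<Union>\<U>) V s = t V)"
    if t: "\<forall>V\<in>\<U>. zopen A V \<and> t V \<in> P V"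
      "\<forall>V\<in>\<U>. \<forall>W\<in>\<U>. res F V (V \<inter> W) (t V) = res F W (V \<inter> W) (t W)" for \<U> t
  proof -
    have Z: "zopen A (\<Union>\<U>)" using t by (intro zopen_Union) auto
    have ex: "\<exists>!s. s \<in> Sec (\<Union>\<U>) \<and> (\<forall>V\<in>\<U>. res F (\<Union>\<U>) V s = t V)"
      using t P_subset by (intro glue) blast+
    then obtain s where s: "s \<in> Sec (\<Union>\<U>)" "\<forall>V\<in>\<U>. res F (\<Union>\<U>) V s = t V" by blast
    have "s \<in> P (\<Union>\<U>)" using Z s(1)
    proof (rule P_local)
      fix p assume "p \<in> \<Union>\<U>"
      then obtain V where "V \<in> \<U>" "p \<in> V" by blast
      then show "\<exists>W. zopen A W \<and> p \<in> W \<and> W \<subseteq> \<Union>\<U> \<and> res F (\<Union>\<U>) W s \<in> P W"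
        using t s by (intro exI[of _ V]) auto
    qed
    then show ?thesis using ex s(2) P_subset[OF Z] by (intro ex1I[of _ s]) (use s in blast)+
  qed
  have g: "\<forall>\<U> t. (\<forall>V\<in>\<U>. zopen A V \<and> t V \<in> P V) \<and>
        (\<forall>V\<in>\<U>. \<forall>W\<in>\<U>. res F V (V \<inter> W) (t V) = res F W (V \<inter> W) (t W)) \<longrightarrow>
        (\<exists>!s. s \<in> P (\<Union>\<U>) \<and> (\<forall>V\<in>\<U>. res F (\<Union>\<U>) V s = t V))"
    by (intro allI impI glue') blast+
  have in_sec: "s \<in> Sec U" if "zopen A U" "s \<in> P U" for U s using P_subset that by blast
  show ?thesis unfolding sheaf_of_modules_def
    apply (intro conjI)
    subgoal using P_module by simp
    subgoal using P_res by (auto simp: in_sec res_add res_smult)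
    subgoal by (simp add: in_sec res_id)
    subgoal by (simp add: in_sec res_comp)
    subgoal using g by simp
    done
qed

text \<open>That a combination of sections of \<open>P\<close> vanishes can be checked in
  \<open>F\<close>. Hence a subsheaf of a coherent sheaf is coherent as soon as it is of finite
  type.\<close>

lemma relations_subsheaf:
  assumes "zopen A U" "zopen A V" "V \<subseteq> U" "e \<in> {..<n} \<rightarrow> P U"
  shows "relations A (subsheaf F P) U n e V = relations A F U n e V"
proof -
  have "(\<Oplus>\<^bsub>(sec F V)\<lparr>carrier := P V\<rparr>\<^esub>i\<in>{..<n}. r i \<odot>\<^bsub>sec F V\<^esub> res F U V (e i)) =
      (\<Oplus>\<^bsub>sec F V\<^esub>i\<in>{..<n}. r i \<odot>\<^bsub>sec F V\<^esub> res F U V (e i))"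
    if "r \<in> {..<n} \<rightarrow>\<^sub>E Reg V" for r
  proof (rule P_finsum[OF assms(2)], rule Pi_I)
    fix i assume i: "i \<in> {..<n}"
    then have "res F U V (e i) \<in> P V" using assms by (intro P_res[OF assms(1-3)]) auto
    then show "r i \<odot>\<^bsub>sec F V\<^esub> res F U V (e i) \<in> P V"
      using that i by (intro submodule.smult_closed[OF P_submodule[OF assms(2)]]) auto
  qed
  then show ?thesis unfolding relations_def by (auto simp: PiE_def)
qed

end

lemma generates_iff: "generates A F U S \<longleftrightarrow> S \<subseteq> Sec U \<and>
     (\<forall>V. zopen A V \<and> V \<subseteq> U \<longrightarrow> (\<forall>s\<in>Sec V. \<forall>p\<in>V.
        \<exists>W. zopen A W \<and> p \<in> W \<and> W \<subseteq> V \<and>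
          res F V W s \<in> lin_span (str_sheaf A W) (sec F W) (res F U W) S))"
  unfolding generates_def lin_span_def mem_Collect_eq
  by (intro conj_cong all_cong ball_cong ex_cong1 refl) blast

text \<open>The image of the homomorphism from the free sheaf on \<open>S\<close> to \<open>F\<close>: the sections that are locally
  linear combinations.\<close>

definition gen :: "'m set \<Rightarrow> 'a set set \<Rightarrow> 'm set" where
  "gen S U = {s \<in> Sec U. \<forall>p\<in>U. \<exists>W. zopen A W \<and> p \<in> W \<and> W \<subseteq> U \<and>
      res F U W s \<in> local_span S W}"

context
  fixes S assumes S: "S \<subseteq> Sec (Spec A)"
begin

lemma res_S: "zopen A W \<Longrightarrow> res F (Spec A) W \<in> S \<rightarrow> Sec W"
  using S res_Pi[OF zopen_Spec _ zopen_subset_Spec] by blast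

lemma submodule_span: "zopen A W \<Longrightarrow>
    submodule (local_span S W) (str_sheaf A W) (sec F W)"
  by (rule module.submodule_lin_span[OF sec_module res_S])

lemma span_res:
  assumes "zopen A W" "zopen A V" "V \<subseteq> W"
    "s \<in> local_span S W"
  shows "res F W V s \<in> local_span S V"
proof -
  obtain T c where T: "finite T" "T \<subseteq> S" "c \<in> T \<rightarrow> Reg W"
    and s: "s = (\<Oplus>\<^bsub>sec F W\<^esub>e\<in>T. c e \<odot>\<^bsub>sec F W\<^esub> res F (Spec A) W e)"
    using assms(4) unfolding lin_span_def by blast
  have e: "res F (Spec A) W e \<in> Sec W" if "e \<in> T" for e
    using res_S[OF assms(1)] that T by blast
  interpret W: module "str_sheaf A W" "sec F W" by (rule sec_module[OF assms(1)])
  interpret V: module "str_sheaf A V" "sec F V" by (rule sec_module[OF assms(2)])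
  have "res F W V s = (\<Oplus>\<^bsub>sec F V\<^esub>e\<in>T. res F W V (c e \<odot>\<^bsub>sec F W\<^esub> res F (Spec A) W e))"
    unfolding s by (rule res_finsum[OF assms(1-3)]) (use T e in auto)
  also have "\<dots> = (\<Oplus>\<^bsub>sec F V\<^esub>e\<in>T. restrict (c e) V \<odot>\<^bsub>sec F V\<^esub> res F (Spec A) V e)"
  proof (rule V.M.finsum_cong'[OF refl])
    show "res F W V (c e \<odot>\<^bsub>sec F W\<^esub> res F (Spec A) W e) = restrict (c e) V \<odot>\<^bsub>sec F V\<^esub> res F (Spec A) V e"
      if "e \<in> T" for e
      using that T S e res_comp[OF zopen_Spec assms(1) zopen_subset_Spec[OF assms(1)] assms(2,3), of e]
      by (simp add: res_smult[OF assms(1-3)] Pi_iff subset_iff)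
    show "(\<lambda>e. restrict (c e) V \<odot>\<^bsub>sec F V\<^esub> res F (Spec A) V e) \<in> T \<rightarrow> Sec V"
      using T res_S[OF assms(2)] str_sheaf_restrict_closed[OF assms(2,3)] by (auto simp: Pi_iff subset_iff)
  qed
  finally show ?thesis unfolding lin_span_def mem_Collect_eq
    using T str_sheaf_restrict_closed[OF assms(2,3)]
    by (intro exI[of _ T] exI[of _ "\<lambda>e. restrict (c e) V"]) (auto simp: Pi_iff)
qed

lemma gen_base: "zopen A W \<Longrightarrow> e \<in> S \<Longrightarrow> res F (Spec A) W e \<in> gen S W"
  unfolding gen_def mem_Collect_eq
proof (intro conjI ballI exI[of _ W])
  assume W: "zopen A W" and e: "e \<in> S"
  show c: "res F (Spec A) W e \<in> Sec W" using res_S[OF W] e by blast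
  show "res F W W (res F (Spec A) W e) \<in> local_span S W"
    unfolding res_id[OF W c] by (rule module.lin_span_base[OF sec_module[OF W] res_S[OF W] e])
qed auto

lemma gen_in: "e \<in> S \<Longrightarrow> e \<in> gen S (Spec A)"
  using gen_base[OF zopen_Spec, of e] res_id[OF zopen_Spec, of e] S by auto

lemma submodule_gen: assumes U: "zopen A U" shows "submodule (gen S U) (str_sheaf A U) (sec F U)"
proof -
  let ?L = "local_span S"
  interpret U: module "str_sheaf A U" "sec F U" by (rule sec_module[OF U])
  have add: "s \<oplus>\<^bsub>sec F U\<^esub> t \<in> gen S U" if s: "s \<in> gen S U" and t: "t \<in> gen S U" for s t
    unfolding gen_def mem_Collect_eq
  proof (intro conjI ballI)
    have c: "s \<in> Sec U" "t \<in> Sec U" using s t by (auto simp: gen_def)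
    then show "s \<oplus>\<^bsub>sec F U\<^esub> t \<in> Sec U" by simp
    fix p assume p: "p \<in> U"
    obtain V where V: "zopen A V" "p \<in> V" "V \<subseteq> U" "res F U V s \<in> ?L V" using s p by (auto simp: gen_def)
    obtain W where W: "zopen A W" "p \<in> W" "W \<subseteq> U" "res F U W t \<in> ?L W" using t p by (auto simp: gen_def)
    have Z: "zopen A (V \<inter> W)" by (rule zopen_Int[OF V(1) W(1)])
    have "res F U (V \<inter> W) s \<in> ?L (V \<inter> W)"
      using span_res[OF V(1) Z _ V(4)] res_comp[OF U V(1,3) Z _ c(1)] by simp
    moreover have "res F U (V \<inter> W) t \<in> ?L (V \<inter> W)"
      using span_res[OF W(1) Z _ W(4)] res_comp[OF U W(1,3) Z _ c(2)] by simp
    ultimately have "res F U (V \<inter> W) (s \<oplus>\<^bsub>sec F U\<^esub> t) \<in> ?L (V \<inter> W)"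
      unfolding res_add[OF U Z le_infI1[OF V(3)] c]
      by (rule module.lin_span_add[OF sec_module[OF Z] res_S[OF Z]])
    then show "\<exists>W. zopen A W \<and> p \<in> W \<and> W \<subseteq> U \<and> res F U W (s \<oplus>\<^bsub>sec F U\<^esub> t) \<in> ?L W"
      using Z V W by (intro exI[of _ "V \<inter> W"]) auto
  qed
  have smult: "a \<odot>\<^bsub>sec F U\<^esub> s \<in> gen S U" if s: "s \<in> gen S U" and a: "a \<in> Reg U" for a s
    unfolding gen_def mem_Collect_eq
  proof (intro conjI ballI)
    have c: "s \<in> Sec U" using s by (auto simp: gen_def)
    then show "a \<odot>\<^bsub>sec F U\<^esub> s \<in> Sec U" using a by simp
    fix p assume p: "p \<in> U"
    obtain V where V: "zopen A V" "p \<in> V" "V \<subseteq> U" "res F U V s \<in> ?L V" using s p by (auto simp: gen_def)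
    have "res F U V (a \<odot>\<^bsub>sec F U\<^esub> s) \<in> ?L V" unfolding res_smult[OF U V(1,3) a c]
      by (rule module.lin_span_smult[OF sec_module[OF V(1)] res_S[OF V(1)] V(4)
         str_sheaf_restrict_closed[OF V(1,3) a]])
    then show "\<exists>W. zopen A W \<and> p \<in> W \<and> W \<subseteq> U \<and> res F U W (a \<odot>\<^bsub>sec F U\<^esub> s) \<in> ?L W"
      using V by (intro exI[of _ V]) auto
  qed
  show ?thesis
  proof (rule U.submoduleI_smult)
    show "gen S U \<subseteq> Sec U" by (auto simp: gen_def)
    show "zero_sec U \<in> gen S U" unfolding gen_def mem_Collect_eq
      using U res_zero[OF U U] module.submodule_zero[OF U.module_axioms submodule_span[OF U]]
      by (intro conjI ballI exI[of _ U]) auto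
  qed (use add smult in auto)
qed

lemma submodule_sheaf_gen: "submodule_sheaf (gen S)"
  unfolding submodule_sheaf_def
proof (intro conjI allI impI; (elim conjE)?)
  show "submodule (gen S U) (str_sheaf A U) (sec F U)" if "zopen A U" for U
    by (rule submodule_gen[OF that])
next
  fix U V s assume UV: "zopen A U" "zopen A V" "V \<subseteq> U" and s: "s \<in> gen S U"
  have c: "s \<in> Sec U" using s by (auto simp: gen_def)
  show "res F U V s \<in> gen S V" unfolding gen_def mem_Collect_eq
  proof (intro conjI ballI)
    show "res F U V s \<in> Sec V" by (rule res_closed[OF UV c])
    fix p assume p: "p \<in> V"
    then have "p \<in> U" using UV by auto
    then obtain W where W: "zopen A W" "p \<in> W" "W \<subseteq> U"
      "res F U W s \<in> local_span S W"
      using s unfolding gen_def by blast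
    have Z: "zopen A (V \<inter> W)" by (rule zopen_Int[OF UV(2) W(1)])
    have "res F U (V \<inter> W) s = res F V (V \<inter> W) (res F U V s)"
      using res_comp[OF UV Z _ c] by simp
    then show "\<exists>W. zopen A W \<and> p \<in> W \<and> W \<subseteq> V \<and>
       res F V W (res F U V s) \<in> local_span S W"
      using span_res[OF W(1) Z _ W(4)] res_comp[OF UV(1) W(1,3) Z _ c] Z p W
      by (intro exI[of _ "V \<inter> W"]) auto
  qed
next
  fix U s assume U: "zopen A U" and s: "s \<in> Sec U"
    and loc: "\<forall>p\<in>U. \<exists>W. zopen A W \<and> p \<in> W \<and> W \<subseteq> U \<and> res F U W s \<in> gen S W"
  show "s \<in> gen S U" unfolding gen_def mem_Collect_eq
  proof (intro conjI ballI s)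
    fix p assume p: "p \<in> U"
    then obtain W where W: "zopen A W" "p \<in> W" "W \<subseteq> U" "res F U W s \<in> gen S W" using loc by blast
    then obtain V where V: "zopen A V" "p \<in> V" "V \<subseteq> W"
      "res F W V (res F U W s) \<in> local_span S V"
      by (auto simp: gen_def)
    then show "\<exists>W. zopen A W \<and> p \<in> W \<and> W \<subseteq> U \<and>
       res F U W s \<in> local_span S W"
      using res_comp[OF U W(1,3) V(1,3) s] W by (intro exI[of _ V]) auto
  qed
qed

lemma gen_least:
  assumes P: "submodule_sheaf P" "S \<subseteq> P (Spec A)" and U: "zopen A U"
  shows "gen S U \<subseteq> P U"
proof
  fix s assume s: "s \<in> gen S U"
  show "s \<in> P U" using U
  proof (rule P_local[OF P(1)])
    show "s \<in> Sec U" using s by (auto simp: gen_def)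
    fix p assume "p \<in> U"
    then obtain W where W: "zopen A W" "p \<in> W" "W \<subseteq> U"
      "res F U W s \<in> local_span S W"
      using s by (auto simp: gen_def)
    have "local_span S W \<subseteq> P W"
      using P_res[OF P(1) zopen_Spec W(1) zopen_subset_Spec[OF W(1)]] P(2)
      by (intro module.lin_span_least[OF sec_module[OF W(1)] P_submodule[OF P(1) W(1)]]) auto
    then show "\<exists>W. zopen A W \<and> p \<in> W \<and> W \<subseteq> U \<and> res F U W s \<in> P W"
      using W by (intro exI[of _ W]) auto
  qed
qed

lemma generates_if_gen_eq:
  assumes "\<And>U. zopen A U \<Longrightarrow> Sec U \<subseteq> gen S U"
  shows "generates A F (Spec A) S"
  unfolding generates_iff using S assms by (auto simp: gen_def)

end

end

section \<open>Extending sections of coherent sheaves\<close>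

lemma (in cring) ideal_Collect:
  assumes "Q \<zero>" "\<And>a b. a \<in> carrier R \<Longrightarrow> b \<in> carrier R \<Longrightarrow> Q a \<Longrightarrow> Q b \<Longrightarrow> Q (a \<oplus> b)"
    and mult: "\<And>x a. x \<in> carrier R \<Longrightarrow> a \<in> carrier R \<Longrightarrow> Q a \<Longrightarrow> Q (x \<otimes> a)"
  shows "ideal {a \<in> carrier R. Q a} R"
proof (intro idealI subgroup.intro ring_axioms)
  fix a x assume a: "a \<in> {a \<in> carrier R. Q a}" and x: "x \<in> carrier R"
  show xa: "x \<otimes> a \<in> {a \<in> carrier R. Q a}" using mult a x by auto
  show "a \<otimes> x \<in> {a \<in> carrier R. Q a}" using xa a x m_comm[of x a] by auto
next
  fix a assume a: "a \<in> {a \<in> carrier R. Q a}"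
  have "inv\<^bsub>add_monoid R\<^esub> a = \<ominus> a" by (simp add: a_inv_def)
  also have "\<dots> = (\<ominus> \<one>) \<otimes> a" using a by (simp add: l_minus)
  finally show "inv\<^bsub>add_monoid R\<^esub> a \<in> {a \<in> carrier R. Q a}" using mult[of "\<ominus> \<one>" a] a by simp
qed (use assms in auto)

text \<open>The passage from points to powers: the elements with property \<open>Q\<close> form an
  ideal, which is contained in no prime ideal that avoids \<open>g\<close>.\<close>

lemma (in cring) power_if_locally:
  assumes g: "g \<in> carrier R" and "Q \<zero>"
    and "\<And>a b. a \<in> carrier R \<Longrightarrow> b \<in> carrier R \<Longrightarrow> Q a \<Longrightarrow> Q b \<Longrightarrow> Q (a \<oplus> b)"
    and "\<And>x a. x \<in> carrier R \<Longrightarrow> a \<in> carrier R \<Longrightarrow> Q a \<Longrightarrow> Q (x \<otimes> a)"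
    and loc: "\<And>p. p \<in> basic_open R g \<Longrightarrow> \<exists>a\<in>carrier R. Q a \<and> a \<notin> p"
  shows "\<exists>k::nat. Q (g [^] k)"
proof -
  have "\<exists>k::nat. g [^] k \<in> {a \<in> carrier R. Q a}"
  proof (rule power_mem_ideal[OF ideal_Collect g])
    show "\<not> {a \<in> carrier R. Q a} \<subseteq> p" if "p \<in> Spec R" "g \<notin> p" for p
      using loc[of p] that by (auto simp: basic_open_def)
  qed (use assms in auto)
  then show ?thesis by auto
qed

context module_sheaf
begin

text \<open>Sections over \<open>U\<close> as a module over the ring \<open>A\<close> itself, whose
  elements act through the fractions \<open>a / 1\<close>.\<close>

definition ascl :: "'a set set \<Rightarrow> 'a \<Rightarrow> 'm \<Rightarrow> 'm" where
  "ascl U a s = const_sec U a \<odot>\<^bsub>sec F U\<^esub> s"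

context
  fixes U assumes U: "zopen A U"
begin

interpretation U: module "str_sheaf A U" "sec F U" by (rule sec_module[OF U])

lemma ascl_closed: "a \<in> carrier A \<Longrightarrow> s \<in> Sec U \<Longrightarrow> ascl U a s \<in> Sec U"
  by (simp add: ascl_def const_sec_closed[OF U])

lemma ascl_mult: "a \<in> carrier A \<Longrightarrow> b \<in> carrier A \<Longrightarrow> s \<in> Sec U \<Longrightarrow>
   ascl U (a \<otimes> b) s = ascl U a (ascl U b s)"
  by (simp add: ascl_def const_sec_mult[OF U] const_sec_closed[OF U] U.smult_assoc1)

lemma ascl_add: "a \<in> carrier A \<Longrightarrow> b \<in> carrier A \<Longrightarrow> s \<in> Sec U \<Longrightarrow>
   ascl U (a \<oplus> b) s = ascl U a s \<oplus>\<^bsub>sec F U\<^esub> ascl U b s"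
  by (simp add: ascl_def const_sec_add[OF U] const_sec_closed[OF U] U.smult_l_distr)

lemma ascl_add_right: "a \<in> carrier A \<Longrightarrow> s \<in> Sec U \<Longrightarrow> t \<in> Sec U \<Longrightarrow>
   ascl U a (s \<oplus>\<^bsub>sec F U\<^esub> t) = ascl U a s \<oplus>\<^bsub>sec F U\<^esub> ascl U a t"
  by (simp add: ascl_def const_sec_closed[OF U] U.smult_r_distr)

lemma ascl_one: "s \<in> Sec U \<Longrightarrow> ascl U \<one> s = s"
  by (simp add: ascl_def const_sec_one)

lemma ascl_zero: "s \<in> Sec U \<Longrightarrow> ascl U \<zero> s = zero_sec U"
  by (simp add: ascl_def const_sec_zero)

lemma ascl_zero_right: "a \<in> carrier A \<Longrightarrow> ascl U a (zero_sec U) = zero_sec U"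
  by (simp add: ascl_def const_sec_closed[OF U])

lemma ascl_commute: "a \<in> carrier A \<Longrightarrow> b \<in> carrier A \<Longrightarrow> s \<in> Sec U \<Longrightarrow>
   ascl U a (ascl U b s) = ascl U b (ascl U a s)"
  using ascl_mult[of a b s] ascl_mult[of b a s] m_comm[of a b] by simp

lemma zero_sec_closed: "zero_sec U \<in> Sec U"
  by simp

lemma add_sec_closed: "s \<in> Sec U \<Longrightarrow> t \<in> Sec U \<Longrightarrow>
   s \<oplus>\<^bsub>sec F U\<^esub> t \<in> Sec U"
  by simp

lemma res_ascl:
  assumes "zopen A V" "V \<subseteq> U" "a \<in> carrier A" "s \<in> Sec U"
  shows "res F U V (ascl U a s) = ascl V a (res F U V s)"
  using assms U by (simp add: ascl_def res_smult const_sec_closed restrict_frac_sec)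

lemma divide_by_unit:
  assumes b: "b \<in> carrier A" "\<And>p. p \<in> U \<Longrightarrow> b \<notin> p" and s: "s \<in> Sec U"
  shows "frac_sec A U \<one> b \<odot>\<^bsub>sec F U\<^esub> ascl U b s = s"
    and "ascl U b (frac_sec A U \<one> b \<odot>\<^bsub>sec F U\<^esub> s) = s"
proof -
  have c: "frac_sec A U \<one> b \<in> Reg U" "const_sec U b \<in> Reg U"
    using b const_sec_closed[OF U] frac_sec_closed[OF U] by auto
  show "frac_sec A U \<one> b \<odot>\<^bsub>sec F U\<^esub> ascl U b s = s"
    using c s inverse_mult_const_sec[OF U b] by (simp add: ascl_def flip: U.smult_assoc1)
  show "ascl U b (frac_sec A U \<one> b \<odot>\<^bsub>sec F U\<^esub> s) = s"
    using c s inverse_mult_const_sec[OF U b] U.R.m_comm[OF c]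
    by (simp add: ascl_def flip: U.smult_assoc1)
qed

lemma ascl_cancel:
  assumes b: "b \<in> carrier A" "\<And>p. p \<in> U \<Longrightarrow> b \<notin> p"
    and "s \<in> Sec U" "t \<in> Sec U" "ascl U b s = ascl U b t"
  shows "s = t"
  using divide_by_unit(1)[OF b assms(3)] divide_by_unit(1)[OF b assms(4)] assms(5) by metis

lemma ascl_unit_surj:
  assumes b: "b \<in> carrier A" "\<And>p. p \<in> U \<Longrightarrow> b \<notin> p" and "s \<in> Sec U"
  shows "\<exists>t\<in>Sec U. ascl U b t = s"
  using divide_by_unit(2)[OF b assms(3)] frac_sec_closed[OF U _ b(1)] b assms(3)
  by (intro bexI[of _ "frac_sec A U \<one> b \<odot>\<^bsub>sec F U\<^esub> s"]) auto

lemma ascl_power_add: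
  assumes "f \<in> carrier A" "s \<in> Sec U"
  shows "ascl U (f [^] (m + n :: nat)) s = ascl U (f [^] m) (ascl U (f [^] n) s)"
  using assms by (simp add: ascl_mult flip: nat_pow_mult)

lemma minus_sec:
  assumes "s \<in> Sec U" "t \<in> Sec U"
  shows "\<exists>d\<in>Sec U. d \<oplus>\<^bsub>sec F U\<^esub> t = s"
  using assms by (intro bexI[of _ "s \<ominus>\<^bsub>sec F U\<^esub> t"])
    (auto simp: a_minus_def U.M.a_assoc U.M.l_neg)

lemma zero_if_add_eq:
  assumes "d \<in> Sec U" "t \<in> Sec U" "d \<oplus>\<^bsub>sec F U\<^esub> t = t"
  shows "d = zero_sec U"
  using assms by simp

lemma zero_add_sec: "t \<in> Sec U \<Longrightarrow> zero_sec U \<oplus>\<^bsub>sec F U\<^esub> t = t"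
  by simp

end

lemma D_zopen: "f \<in> carrier A \<Longrightarrow> zopen A (D f)"
  by (rule zopen_basic_open)

lemma D_power: "f \<in> carrier A \<Longrightarrow> p \<in> D f \<Longrightarrow> f [^] (n::nat) \<notin> p"
  by (auto simp: basic_open_def Spec_pow)

lemma D_zero: "D \<zero> = {}"
  by (auto simp: basic_open_def Spec_zero)

lemma D_add_subset: "D (a \<oplus> b) \<subseteq> D a \<union> D b"
  by (auto simp: basic_open_def dest: Spec_add)

lemma D_subset_D_pow: "f \<in> carrier A \<Longrightarrow> D f \<subseteq> D (f [^] (k::nat))"
  by (auto simp: basic_open_def Spec_pow)

lemma eq_on_empty: "s \<in> Sec {} \<Longrightarrow> t \<in> Sec {} \<Longrightarrow> s = t"
  by (rule eq_if_locally_eq[OF zopen_empty]) auto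

lemma eq_if_eq_on_cover:
  assumes U: "zopen A U" and V: "zopen A V" "V \<subseteq> U" and W: "zopen A W" "W \<subseteq> U" and cover: "U \<subseteq> V \<union> W"
    and s: "s \<in> Sec U" "t \<in> Sec U"
    and eq: "res F U V s = res F U V t" "res F U W s = res F U W t"
  shows "s = t"
  by (rule eq_if_locally_eq[OF U s]) (use V W eq cover in blast)

lemma glue_two:
  assumes U: "zopen A U" and V: "zopen A V"
    and s: "s \<in> Sec U" and t: "t \<in> Sec V"
    and eq: "res F U (U \<inter> V) s = res F V (U \<inter> V) t"
  shows "\<exists>x\<in>Sec (U \<union> V). res F (U \<union> V) U x = s \<and> res F (U \<union> V) V x = t"
proof (cases "U = V")
  case True
  then have "s = t" using eq res_id U V s t by simp
  then show ?thesis using True res_id U s by auto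
next
  case False
  define \<tau> where "\<tau> = (\<lambda>W. if W = U then s else t)"
  have \<tau>: "\<tau> U = s" "\<tau> V = t" using False by (auto simp: \<tau>_def)
  have "\<exists>!x. x \<in> Sec (\<Union>{U, V}) \<and> (\<forall>W\<in>{U, V}. res F (\<Union>{U, V}) W x = \<tau> W)"
  proof (rule glue)
    show "zopen A W \<and> \<tau> W \<in> Sec W" if "W \<in> {U, V}" for W
      using that U V s t \<tau> by auto
    show "res F W1 (W1 \<inter> W2) (\<tau> W1) = res F W2 (W1 \<inter> W2) (\<tau> W2)"
      if "W1 \<in> {U, V}" "W2 \<in> {U, V}" for W1 W2
      using that eq \<tau> by (auto simp: Int_commute)
  qed
  then show ?thesis using \<tau> by auto
qed

lemmas sheaf_simps = res_closed res_comp res_ascl res_zero ascl_closed zero_sec_closed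
  D_zopen zopen_Int basic_open_mult

text \<open>Quasi-compactness of basic open sets, as an induction principle: the functions \<open>a\<close> such that \<open>Q\<close> holds
  on \<open>D a\<close> form an ideal.\<close>

lemma basic_open_cover_induct:
  assumes g: "g \<in> carrier A" and empty: "Q {}"
    and union: "\<And>a b. a \<in> carrier A \<Longrightarrow> b \<in> carrier A \<Longrightarrow> Q (D a) \<Longrightarrow> Q (D b) \<Longrightarrow> Q (D a \<union> D b)"
    and mono: "\<And>U V. zopen A U \<Longrightarrow> zopen A V \<Longrightarrow> V \<subseteq> U \<Longrightarrow> Q U \<Longrightarrow> Q V"
    and local: "\<And>p. p \<in> D g \<Longrightarrow> \<exists>a\<in>carrier A. p \<in> D a \<and> Q (D a)"
  shows "Q (D g)"
proof -
  have "\<exists>k::nat. Q (D (g [^] k))"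
  proof (rule power_if_locally[OF g])
    show "Q (D \<zero>)" using empty by (simp add: D_zero)
    show "Q (D (a \<oplus> b))" if "a \<in> carrier A" "b \<in> carrier A" "Q (D a)" "Q (D b)" for a b
      using mono[OF zopen_Un _ D_add_subset[of a b]] union that by (simp add: D_zopen)
    show "Q (D (x \<otimes> a))" if "x \<in> carrier A" "a \<in> carrier A" "Q (D a)" for x a
      using mono[of "D a"] that by (simp add: sheaf_simps)
    show "\<exists>a\<in>carrier A. Q (D a) \<and> a \<notin> p" if "p \<in> D g" for p
      using local[OF that] by (auto simp: basic_open_def)
  qed
  then show ?thesis using mono[OF _ _ D_subset_D_pow[OF g]] g by (auto simp: D_zopen)
qed

end

text \<open>The finiteness of relations that coherence demands, at a single point.\<close>

definition relations_fg_at ::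
  "('g, 'a, 'y) g_scheme_scheme \<Rightarrow> ('g, 'a, 'm) g_sheaf \<Rightarrow> 'a set set \<Rightarrow> nat \<Rightarrow> (nat \<Rightarrow> 'm) \<Rightarrow> 'a set \<Rightarrow> bool"
  where "relations_fg_at A F U n e p \<longleftrightarrow>
    (\<exists>V R. zopen A V \<and> p \<in> V \<and> V \<subseteq> U \<and> finite R \<and> R \<subseteq> relations A F U n e V \<and>
       (\<forall>W. zopen A W \<and> W \<subseteq> V \<longrightarrow> (\<forall>r\<in>relations A F U n e W. \<forall>q\<in>W.
          \<exists>W'. zopen A W' \<and> q \<in> W' \<and> W' \<subseteq> W \<and> (\<exists>d\<in>R \<rightarrow> carrier (str_sheaf A W'). \<forall>i<n.
             restrict (r i) W' = (\<Oplus>\<^bsub>str_sheaf A W'\<^esub>x\<in>R. d x \<otimes>\<^bsub>str_sheaf A W'\<^esub> restrict (x i) W')))))"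

lemma coherent_iff: "coherent A F \<longleftrightarrow> sheaf_of_modules A F \<and> finite_type_sheaf A F \<and>
   (\<forall>U n. \<forall>e\<in>{..<n} \<rightarrow> carrier (sec F U). zopen A U \<longrightarrow> (\<forall>p\<in>U. relations_fg_at A F U n e p))"
  unfolding coherent_def relations_fg_at_def by (rule refl)

locale coherent_sheaf = cring A for A :: "('g, 'a, 'y) g_scheme_scheme" (structure) +
  fixes F :: "('g, 'a, 'm) g_sheaf"
  assumes coherent: "coherent A F"

sublocale coherent_sheaf \<subseteq> module_sheaf A F
  using coherent by unfold_locales (auto simp: coherent_def)

context coherent_sheaf
begin

text \<open>Each of finitely many regular functions is a fraction on some neighbourhood of
  \<open>p\<close>; the neighbourhoods are intersected.\<close>

lemma common_fraction_neighbourhood: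
  assumes V: "zopen A V" "p \<in> V" and "finite R" "\<And>r. r \<in> R \<Longrightarrow> c r \<in> Reg V"
  shows "\<exists>w\<in>carrier A. p \<in> D w \<and> D w \<subseteq> V \<and> (\<forall>r\<in>R. \<exists>a\<in>carrier A. \<exists>b\<in>carrier A.
     (\<forall>q\<in>D w. b \<notin> q) \<and> restrict (c r) (D w) = frac_sec A (D w) a b)"
  using assms(3,4)
proof (induction R)
  case empty
  then show ?case using basic_open_subset[OF V] by auto
next
  case (insert r R)
  have "\<exists>w\<in>carrier A. p \<in> D w \<and> D w \<subseteq> V \<and> (\<forall>r\<in>R. \<exists>a\<in>carrier A. \<exists>b\<in>carrier A.
     (\<forall>q\<in>D w. b \<notin> q) \<and> restrict (c r) (D w) = frac_sec A (D w) a b)"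
    by (rule insert.IH) (use insert.prems in auto)
  then obtain w where w: "w \<in> carrier A" "p \<in> D w" "D w \<subseteq> V" "\<forall>r\<in>R. \<exists>a\<in>carrier A. \<exists>b\<in>carrier A.
     (\<forall>q\<in>D w. b \<notin> q) \<and> restrict (c r) (D w) = frac_sec A (D w) a b" by blast
  obtain v a b where v: "v \<in> carrier A" "a \<in> carrier A" "b \<in> carrier A" "p \<in> D v" "D v \<subseteq> V"
     "\<forall>q\<in>D v. b \<notin> q" "restrict (c r) (D v) = frac_sec A (D v) a b"
    using str_sheaf_locally_frac[OF insert.prems[of r] V(2)] by blast
  have D: "D (v \<otimes> w) = D v \<inter> D w" using v w by (simp add: basic_open_mult)
  have rr: "restrict (c x) (D (v \<otimes> w)) = frac_sec A (D (v \<otimes> w)) a' b'"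
    if "restrict (c x) W = frac_sec A W a' b'" "D (v \<otimes> w) \<subseteq> W" for x a' b' W
  proof -
    have "restrict (c x) (D (v \<otimes> w)) = restrict (restrict (c x) W) (D (v \<otimes> w))"
      using that(2) by (simp add: Int_absorb1)
    then show ?thesis using that restrict_frac_sec by metis
  qed
  have "\<exists>a\<in>carrier A. \<exists>b\<in>carrier A.
     (\<forall>q\<in>D (v \<otimes> w). b \<notin> q) \<and> restrict (c x) (D (v \<otimes> w)) = frac_sec A (D (v \<otimes> w)) a b"
    if x: "x \<in> insert r R" for x
  proof (cases "x = r")
    case True
    then show ?thesis using v rr[OF v(7)] D by auto
  next
    case False
    then obtain a' b' where "a' \<in> carrier A" "b' \<in> carrier A" "\<forall>q\<in>D w. b' \<notin> q"
       "restrict (c x) (D w) = frac_sec A (D w) a' b'" using w(4) x by blast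
    then show ?thesis using rr[of x "D w"] D by auto
  qed
  then have "\<forall>x\<in>insert r R. \<exists>a\<in>carrier A. \<exists>b\<in>carrier A.
     (\<forall>q\<in>D (v \<otimes> w). b \<notin> q) \<and> restrict (c x) (D (v \<otimes> w)) = frac_sec A (D (v \<otimes> w)) a b" by blast
  moreover have "p \<in> D (v \<otimes> w)" "D (v \<otimes> w) \<subseteq> V" "v \<otimes> w \<in> carrier A" using v(1,4,5) w(1,2) D by auto
  ultimately show ?case by blast
qed

text \<open>Coherence, applied to the single section \<open>t\<close>, makes the annihilator of \<open>t\<close> finitely generated near
  \<open>p\<close>, say on \<open>D w\<close> and by fractions. At a point \<open>q\<close> of \<open>D w\<close> in \<open>D f\<close> the function \<open>1\<close> annihilates \<open>t\<close> and is
  therefore a combination of these fractions, one of whose numerators must be nonzero at \<open>q\<close>. So the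
  elements of \<open>A\<close> that kill \<open>t\<close> on \<open>D w\<close> have no common zero in \<open>D (w f)\<close>, and among them is a power of
  \<open>w f\<close>. The factor \<open>w\<close> is invertible on \<open>D w\<close>.\<close>

lemma killed_by_power_locally:
  assumes U: "zopen A U" and f: "f \<in> carrier A" and t: "t \<in> Sec U"
    and van: "res F U (U \<inter> D f) t = zero_sec (U \<inter> D f)" and p: "p \<in> U"
  shows "\<exists>w\<in>carrier A. \<exists>k::nat. p \<in> D w \<and> D w \<subseteq> U \<and>
     ascl (D w) (f [^] k) (res F U (D w) t) = zero_sec (D w)"
proof -
  let ?rel = "relations A F U (Suc 0) (\<lambda>_. t)"
  have "\<forall>U n. \<forall>e\<in>{..<n} \<rightarrow> Sec U. zopen A U \<longrightarrow> (\<forall>p\<in>U. relations_fg_at A F U n e p)"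
    using coherent by (simp add: coherent_iff)
  then have "relations_fg_at A F U (Suc 0) (\<lambda>_. t) p" using U t p by blast
  then obtain V R where VR: "zopen A V \<and> p \<in> V \<and> V \<subseteq> U \<and> finite R \<and> R \<subseteq> ?rel V \<and>
          (\<forall>W. zopen A W \<and> W \<subseteq> V \<longrightarrow> (\<forall>r\<in>?rel W. \<forall>q\<in>W.
             \<exists>W'. zopen A W' \<and> q \<in> W' \<and> W' \<subseteq> W \<and> (\<exists>d\<in>R \<rightarrow> Reg W'. \<forall>i<Suc 0.
                  restrict (r i) W' = (\<Oplus>\<^bsub>str_sheaf A W'\<^esub>x\<in>R. d x \<otimes>\<^bsub>str_sheaf A W'\<^esub> restrict (x i) W'))))"
    unfolding relations_fg_at_def by (elim exE) (rule that)
  note V = VR[THEN conjunct1] VR[THEN conjunct2, THEN conjunct1] VR[THEN conjunct2, THEN conjunct2, THEN conjunct1]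
    VR[THEN conjunct2, THEN conjunct2, THEN conjunct2, THEN conjunct1]
    VR[THEN conjunct2, THEN conjunct2, THEN conjunct2, THEN conjunct2, THEN conjunct1]
  note gen = VR[THEN conjunct2, THEN conjunct2, THEN conjunct2, THEN conjunct2, THEN conjunct2,
    THEN spec, THEN mp, OF conjI, THEN bspec, THEN bspec]
  have rel: "r \<in> ?rel W \<longleftrightarrow> r \<in> {..<Suc 0} \<rightarrow>\<^sub>E Reg W \<and>
      r 0 \<odot>\<^bsub>sec F W\<^esub> res F U W t = zero_sec W" if W: "zopen A W" "W \<subseteq> U" for W r
  proof -
    interpret W: module "str_sheaf A W" "sec F W" by (rule sec_module[OF W(1)])
    have tW: "res F U W t \<in> Sec W" by (rule res_closed[OF U W t])
    show ?thesis unfolding relations_def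
      using tW by (auto simp: lessThan_Suc PiE_iff)
  qed
  have R0: "r 0 \<in> Reg V" "r 0 \<odot>\<^bsub>sec F V\<^esub> res F U V t = zero_sec V" if "r \<in> R" for r
    using rel[OF V(1,3), of r] V(5) that by (auto simp: PiE_iff)
  obtain w where w: "w \<in> carrier A" "p \<in> D w" "D w \<subseteq> V"
    and fr: "\<And>r. r \<in> R \<Longrightarrow> \<exists>a\<in>carrier A. \<exists>b\<in>carrier A.
     (\<forall>q\<in>D w. b \<notin> q) \<and> restrict (r 0) (D w) = frac_sec A (D w) a b"
    using common_fraction_neighbourhood[OF V(1,2,4), of "\<lambda>r. r 0"] R0(1) by auto
  note Dw = D_zopen[OF w(1)]
  have wg: "D w \<subseteq> U" using w V by auto
  define t' where "t' = res F U (D w) t"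
  have t': "t' \<in> Sec (D w)" unfolding t'_def by (rule res_closed[OF U Dw wg t])
  interpret w: module "str_sheaf A (D w)" "sec F (D w)" by (rule sec_module[OF Dw])
  have "\<exists>k::nat. ascl (D w) ((w \<otimes> f) [^] k) t' = zero_sec (D w)"
  proof (rule power_if_locally)
    show "w \<otimes> f \<in> carrier A" using w f by simp
    show "ascl (D w) \<zero> t' = zero_sec (D w)" by (rule ascl_zero[OF Dw t'])
    show "ascl (D w) (a \<oplus> b) t' = zero_sec (D w)"
      if "a \<in> carrier A" "b \<in> carrier A" "ascl (D w) a t' = zero_sec (D w)" "ascl (D w) b t' = zero_sec (D w)" for a b
      using that t' by (simp add: ascl_add[OF Dw])
    show "ascl (D w) (x \<otimes> a) t' = zero_sec (D w)"
      if "x \<in> carrier A" "a \<in> carrier A" "ascl (D w) a t' = zero_sec (D w)" for x a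
      using that t' by (simp add: ascl_mult[OF Dw] ascl_zero_right[OF Dw])
    fix q assume "q \<in> D (w \<otimes> f)"
    then have qw: "q \<in> D w" "q \<in> D f" using w f by (auto simp: basic_open_mult)
    then have qS: "q \<in> Spec A" by (simp add: basic_open_def)
    define W where "W = D w \<inter> D f"
    have W: "zopen A W" "W \<subseteq> D w" "q \<in> W" "W \<subseteq> U" "W \<subseteq> V" "W \<subseteq> U \<inter> D f"
      using w f wg qw by (auto simp: W_def D_zopen zopen_Int)
    define r where "r = (\<lambda>i\<in>{..<Suc 0}. \<one>\<^bsub>str_sheaf A W\<^esub>)"
    interpret W: module "str_sheaf A W" "sec F W" by (rule sec_module[OF W(1)])
    have Uf: "zopen A (U \<inter> D f)" "U \<inter> D f \<subseteq> U" using U f by (auto simp: D_zopen zopen_Int)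
    have "res F U W t = zero_sec W"
      using res_comp[OF U Uf W(1,6) t] van res_zero[OF Uf(1) W(1,6)] by simp
    then have "r \<in> ?rel W" unfolding rel[OF W(1,4)] by (auto simp: r_def)
    from gen[OF W(1,5) this W(3)]
    obtain W' d where W': "zopen A W'" "q \<in> W'" "W' \<subseteq> W" "d \<in> R \<rightarrow> Reg W'"
      "restrict (r 0) W' = (\<Oplus>\<^bsub>str_sheaf A W'\<^esub>x\<in>R. d x \<otimes>\<^bsub>str_sheaf A W'\<^esub> restrict (x 0) W')"
      using lessI[of 0] by blast
    have W'V: "W' \<subseteq> V" using W'(3) W(5) by auto
    interpret W': module "str_sheaf A W'" "sec F W'" by (rule sec_module[OF W'(1)])
    have "\<exists>x\<in>R. \<exists>a\<in>carrier A. \<exists>b\<in>carrier A. a \<notin> q \<and> (\<forall>q\<in>D w. b \<notin> q) \<and> restrict (x 0) (D w) = frac_sec A (D w) a b"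
    proof (rule ccontr)
      assume neg: "\<not> ?thesis"
      \<comment> \<open>If all numerators vanished at \<open>q\<close>, then all combinations would lie
        in the maximal ideal at \<open>q\<close>.\<close>
      let ?H = "{s \<in> Reg W'. s q \<in> local_max_ideal q}"
      have "(\<Oplus>\<^bsub>str_sheaf A W'\<^esub>x\<in>R. d x \<otimes>\<^bsub>str_sheaf A W'\<^esub> restrict (x 0) W') \<in> ?H"
      proof (rule W'.R.finsum_in)
        show "\<zero>\<^bsub>str_sheaf A W'\<^esub> \<in> ?H"
          using W'.R.zero_closed W'(2) local_max_ideal_zero[OF qS] by (simp add: str_sheaf_simps(2))
        show "s \<oplus>\<^bsub>str_sheaf A W'\<^esub> u \<in> ?H" if "s \<in> ?H" "u \<in> ?H" for s u
        proof -
          have "(s \<oplus>\<^bsub>str_sheaf A W'\<^esub> u) q = s q \<oplus>\<^bsub>local_ring A q\<^esub> u q"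
            using W' by (simp add: str_sheaf_simps)
          then show ?thesis using that local_max_ideal_add[OF qS] by auto
        qed
        show "(\<lambda>x. d x \<otimes>\<^bsub>str_sheaf A W'\<^esub> restrict (x 0) W') \<in> R \<rightarrow> ?H"
        proof
          fix x assume x: "x \<in> R"
          then have dx: "d x \<in> Reg W'" using W' by auto
          have x0: "restrict (x 0) W' \<in> Reg W'"
            by (rule str_sheaf_restrict_closed[OF W'(1) W'V R0(1)[OF x]])
          obtain a b where ab: "a \<in> carrier A" "b \<in> carrier A" "\<forall>q\<in>D w. b \<notin> q"
            "restrict (x 0) (D w) = frac_sec A (D w) a b" using fr[OF x] by blast
          then have aq: "a \<in> q" using neg x by blast
          have "x 0 q = restrict (x 0) (D w) q" using qw by simp
          also have "\<dots> = loc_frac A q a b" unfolding ab(4) using qw by (simp add: frac_sec_def)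
          finally have "x 0 q \<in> local_max_ideal q" unfolding local_max_ideal_def using aq ab qw by blast
          moreover have "d x q \<in> carrier (local_ring A q)" using str_sheaf_PiE[OF dx] W'(2) by auto
          ultimately have "(d x \<otimes>\<^bsub>str_sheaf A W'\<^esub> restrict (x 0) W') q \<in> local_max_ideal q"
            using W'(2) local_max_ideal_mult[OF qS] by (simp add: str_sheaf_simps)
          then show "d x \<otimes>\<^bsub>str_sheaf A W'\<^esub> restrict (x 0) W' \<in> ?H" using dx x0 by simp
        qed
      qed auto
      then have "restrict (r 0) W' q \<in> local_max_ideal q" unfolding W'(5)[symmetric] by simp
      moreover have "restrict (r 0) W' q = loc_frac A q \<one> \<one>"
        using W'(2) W(3) by (simp add: r_def str_sheaf_simps)
      ultimately show False using one_not_in_local_max_ideal[OF qS] by simp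
    qed
    then obtain x a b where x: "x \<in> R" "a \<in> carrier A" "b \<in> carrier A" "a \<notin> q" "\<forall>q\<in>D w. b \<notin> q"
       "restrict (x 0) (D w) = frac_sec A (D w) a b" by blast
    have fc: "frac_sec A (D w) a b \<in> Reg (D w)"
      using x by (intro frac_sec_closed[OF Dw]) auto
    have "ascl (D w) a t' = const_sec (D w) b \<odot>\<^bsub>sec F (D w)\<^esub> (frac_sec A (D w) a b \<odot>\<^bsub>sec F (D w)\<^esub> t')"
      using const_sec_mult_frac_sec[OF Dw x(2,3)] x(5) fc t' const_sec_closed[OF Dw x(3)]
      by (simp add: ascl_def flip: w.smult_assoc1)
    also have "frac_sec A (D w) a b \<odot>\<^bsub>sec F (D w)\<^esub> t' = res F V (D w) (x 0 \<odot>\<^bsub>sec F V\<^esub> res F U V t)"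
      using res_smult[OF V(1) Dw w(3) R0(1)[OF x(1)] res_closed[OF U V(1,3) t]]
        res_comp[OF U V(1,3) Dw w(3) t] x(6) by (simp add: t'_def)
    also have "\<dots> = zero_sec (D w)" using R0(2)[OF x(1)] res_zero[OF V(1) Dw w(3)] by simp
    finally have "ascl (D w) a t' = zero_sec (D w)" using const_sec_closed[OF Dw x(3)] by simp
    then show "\<exists>a\<in>carrier A. ascl (D w) a t' = zero_sec (D w) \<and> a \<notin> q" using x by blast
  qed
  then obtain k :: nat where "ascl (D w) ((w \<otimes> f) [^] k) t' = zero_sec (D w)" by blast
  then have "ascl (D w) (w [^] k) (ascl (D w) (f [^] k) t') = zero_sec (D w)"
    using w f t' by (simp add: nat_pow_distrib ascl_mult[OF Dw])
  then have "ascl (D w) (w [^] k) (ascl (D w) (f [^] k) t') = ascl (D w) (w [^] k) (zero_sec (D w))"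
    using w by (simp add: ascl_zero_right[OF Dw])
  then have "ascl (D w) (f [^] k) t' = zero_sec (D w)"
    using ascl_cancel[OF Dw, of "w [^] k"] D_power[OF w(1)] w f ascl_closed[OF Dw _ t'] by simp
  then show ?thesis using w wg unfolding t'_def by blast
qed

text \<open>The local exponents of the previous lemma have a common bound, because \<open>D g\<close> is quasi-compact.\<close>

lemma killed_by_power:
  assumes g: "g \<in> carrier A" and f: "f \<in> carrier A" and t: "t \<in> Sec (D g)"
    and van: "res F (D g) (D g \<inter> D f) t = zero_sec (D g \<inter> D f)"
  shows "\<exists>N::nat. ascl (D g) (f [^] N) t = zero_sec (D g)"
proof -
  note Dg = D_zopen[OF g]
  let ?t = "\<lambda>N::nat. ascl (D g) (f [^] N) t"
  define Q where "Q = (\<lambda>U. \<exists>N. res F (D g) (D g \<inter> U) (?t N) = zero_sec (D g \<inter> U))"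
  have ft: "?t N \<in> Sec (D g)" for N using f t Dg by (simp add: ascl_closed)
  have raise: "res F (D g) (D g \<inter> U) (?t (M + N)) = zero_sec (D g \<inter> U)"
    if U: "zopen A U" and "res F (D g) (D g \<inter> U) (?t N) = zero_sec (D g \<inter> U)" for U M N
  proof -
    have gU: "zopen A (D g \<inter> U)" by (rule zopen_Int[OF Dg U])
    show ?thesis using that(2) f ft t
      by (simp add: ascl_power_add[OF Dg] res_ascl[OF Dg gU] ascl_zero_right[OF gU])
  qed
  have "Q (D g)"
  proof (rule basic_open_cover_induct[OF g])
    show "Q {}" unfolding Q_def using eq_on_empty[OF res_closed[OF Dg zopen_empty _ ft] zero_sec_closed[OF zopen_empty]] by simp
  next
    fix a b assume ab: "a \<in> carrier A" "b \<in> carrier A" and "Q (D a)" "Q (D b)"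
    then obtain M N where M: "res F (D g) (D g \<inter> D a) (?t M) = zero_sec (D g \<inter> D a)" and
      N: "res F (D g) (D g \<inter> D b) (?t N) = zero_sec (D g \<inter> D b)" unfolding Q_def by blast
    have Z: "zopen A (D g \<inter> D a)" "zopen A (D g \<inter> D b)" "zopen A (D g \<inter> (D a \<union> D b))"
      using Dg ab by (auto simp: D_zopen intro!: zopen_Int zopen_Un)
    have sub: "D g \<inter> D a \<subseteq> D g \<inter> (D a \<union> D b)" "D g \<inter> D b \<subseteq> D g \<inter> (D a \<union> D b)" by auto
    have "res F (D g) (D g \<inter> (D a \<union> D b)) (?t (M + N)) = zero_sec (D g \<inter> (D a \<union> D b))"
    proof (rule eq_if_eq_on_cover[OF Z(3,1) sub(1) Z(2) sub(2)])
      show "res F (D g) (D g \<inter> (D a \<union> D b)) (?t (M + N)) \<in> Sec (D g \<inter> (D a \<union> D b))"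
        by (rule res_closed[OF Dg Z(3) _ ft]) auto
    qed (use raise[OF D_zopen M, of N] raise[OF D_zopen N, of M] ab zero_sec_closed[OF Z(3)]
        res_comp[OF Dg Z(3) _ Z(1) sub(1) ft] res_comp[OF Dg Z(3) _ Z(2) sub(2) ft]
        res_zero[OF Z(3,1) sub(1)] res_zero[OF Z(3,2) sub(2)] in \<open>auto simp: add.commute\<close>)
    then show "Q (D a \<union> D b)" unfolding Q_def by blast
  next
    fix U V assume Z: "zopen A U" "zopen A V" and sub: "V \<subseteq> U" and "Q U"
    then obtain N where N: "res F (D g) (D g \<inter> U) (?t N) = zero_sec (D g \<inter> U)" unfolding Q_def by blast
    have gZ: "zopen A (D g \<inter> U)" "zopen A (D g \<inter> V)" "D g \<inter> V \<subseteq> D g \<inter> U" using Z Dg sub zopen_Int by auto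
    have "res F (D g) (D g \<inter> V) (?t N) = zero_sec (D g \<inter> V)"
      using res_comp[OF Dg gZ(1) _ gZ(2,3) ft, of N] N res_zero[OF gZ] by simp
    then show "Q V" unfolding Q_def by blast
  next
    fix p assume "p \<in> D g"
    from killed_by_power_locally[OF Dg f t van this]
    obtain w and k :: nat where w: "w \<in> carrier A" "p \<in> D w" "D w \<subseteq> D g"
       "ascl (D w) (f [^] k) (res F (D g) (D w) t) = zero_sec (D w)" by blast
    then have "Q (D w)" unfolding Q_def using f t Dg
      by (intro exI[of _ k]) (simp add: Int_absorb1 res_ascl D_zopen)
    then show "\<exists>a\<in>carrier A. p \<in> D a \<and> Q (D a)" using w by blast
  qed
  then show ?thesis unfolding Q_def using res_id[OF Dg ft] by auto
qed

lemma equal_after_power: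
  assumes g: "g \<in> carrier A" and f: "f \<in> carrier A" and s: "s \<in> Sec (D g)" and t: "t \<in> Sec (D g)"
    and eq: "res F (D g) (D g \<inter> D f) s = res F (D g) (D g \<inter> D f) t"
  shows "\<exists>N::nat. ascl (D g) (f [^] N) s = ascl (D g) (f [^] N) t"
proof -
  note Dg = D_zopen[OF g]
  have gf: "zopen A (D g \<inter> D f)" "D g \<inter> D f \<subseteq> D g" using g f by (auto simp: D_zopen zopen_Int)
  obtain d where d: "d \<in> Sec (D g)" "d \<oplus>\<^bsub>sec F (D g)\<^esub> t = s"
    using minus_sec[OF Dg s t] by blast
  have "res F (D g) (D g \<inter> D f) d = zero_sec (D g \<inter> D f)"
    using res_add[OF Dg gf d(1) t] eq d(2)
    by (intro zero_if_add_eq[OF gf(1) res_closed[OF Dg gf d(1)] res_closed[OF Dg gf t]]) simp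
  then obtain N :: nat where N: "ascl (D g) (f [^] N) d = zero_sec (D g)"
    using killed_by_power[OF g f d(1)] by blast
  have fN: "f [^] N \<in> carrier A" using f by simp
  show ?thesis using ascl_add_right[OF Dg fN d(1) t] N d(2)
      zero_add_sec[OF Dg ascl_closed[OF Dg fN t]] by (intro exI[of _ N]) simp
qed

text \<open>If \<open>F\<close> is generated on \<open>D g\<close>, then near \<open>x\<close> a section over \<open>D g \<inter> D f\<close> is a combination of generators whose
  coefficients are fractions. A common denominator \<open>h\<close> clears them near \<open>x\<close>; the discrepancy away from \<open>x\<close>
  is killed by a further power of a function that does not vanish at \<open>x\<close>.\<close>

lemma numerators_of_local_section:
  assumes g: "g \<in> carrier A" and f: "f \<in> carrier A" and s: "s \<in> Sec (D g \<inter> D f)"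
    and gen: "generates A F U S" and U: "zopen A U" "D g \<subseteq> U" and x: "x \<in> D g \<inter> D f"
  shows "\<exists>h\<in>carrier A. h \<notin> x \<and> (\<exists>m\<in>Sec (D g). res F (D g) (D g \<inter> D f) m = ascl (D g \<inter> D f) h s)"
proof -
  note Dg = D_zopen[OF g]
  let ?gf = "D g \<inter> D f"
  have gf: "zopen A ?gf" "?gf \<subseteq> D g" using g f by (auto simp: D_zopen zopen_Int)
  have xS: "x \<in> Spec A" using x by (auto simp: basic_open_def)
  have S: "S \<subseteq> Sec U" using gen by (auto simp: generates_iff)
  obtain W where W: "zopen A W" "x \<in> W" "W \<subseteq> ?gf"
     "res F ?gf W s \<in> lin_span (str_sheaf A W) (sec F W) (res F U W) S"
    using gen gf U s x unfolding generates_iff by (meson order_trans)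
  have WU: "W \<subseteq> U" and Wg: "W \<subseteq> D g" using W gf U by auto
  \<comment> \<open>\<open>K\<close> consists of the sections that satisfy the claim near
    \<open>x\<close>. It is a submodule and contains the generators, hence also
    \<open>s\<close>.\<close>
  define K where "K = {s' \<in> Sec W. \<exists>h\<in>carrier A. h \<notin> x \<and> (\<exists>V m. zopen A V \<and> x \<in> V \<and> V \<subseteq> W \<and>
     m \<in> Sec (D g) \<and> res F (D g) V m = ascl V h (res F W V s'))}"
  have KI: "s' \<in> K" if "s' \<in> Sec W" "h \<in> carrier A" "h \<notin> x" "zopen A V" "x \<in> V" "V \<subseteq> W"
     "m \<in> Sec (D g)" "res F (D g) V m = ascl V h (res F W V s')" for s' h V m
    unfolding K_def using that by blast
  have shrink: "res F (D g) V' m = ascl V' h (res F W V' s')"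
    if "zopen A V" "V \<subseteq> W" "h \<in> carrier A" "s' \<in> Sec W" "m \<in> Sec (D g)"
      "res F (D g) V m = ascl V h (res F W V s')" "zopen A V'" "V' \<subseteq> V" for s' h V V' m
  proof -
    have "V \<subseteq> D g" using that(2) Wg by blast
    then have "res F (D g) V' m = res F V V' (ascl V h (res F W V s'))"
      using that Dg by (simp flip: that(6) add: res_comp)
    then show ?thesis using that W(1) by (simp add: res_ascl res_closed res_comp)
  qed
  interpret W: module "str_sheaf A W" "sec F W" by (rule sec_module[OF W(1)])
  have "submodule K (str_sheaf A W) (sec F W)"
  proof (rule W.submoduleI_smult)
    show "K \<subseteq> Sec W" by (auto simp: K_def)
    show "zero_sec W \<in> K"
      by (rule KI[of _ \<one> W "zero_sec (D g)"])
        (use W Wg Spec_not_one[OF xS] zero_sec_closed[OF Dg] in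
          \<open>auto simp: res_zero[OF Dg W(1) Wg] res_zero[OF W(1) W(1)] ascl_zero_right\<close>)
  next
    fix s1 s2 assume s1: "s1 \<in> K" and s2: "s2 \<in> K"
    obtain h1 V1 m1 where 1: "s1 \<in> Sec W" "h1 \<in> carrier A" "h1 \<notin> x" "zopen A V1" "x \<in> V1" "V1 \<subseteq> W"
     "m1 \<in> Sec (D g)" "res F (D g) V1 m1 = ascl V1 h1 (res F W V1 s1)"
      using s1 unfolding K_def by blast
    obtain h2 V2 m2 where 2: "s2 \<in> Sec W" "h2 \<in> carrier A" "h2 \<notin> x" "zopen A V2" "x \<in> V2" "V2 \<subseteq> W"
     "m2 \<in> Sec (D g)" "res F (D g) V2 m2 = ascl V2 h2 (res F W V2 s2)"
      using s2 unfolding K_def by blast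
    let ?V = "V1 \<inter> V2"
    have V: "zopen A ?V" "?V \<subseteq> W" "?V \<subseteq> D g" using 1 2 Wg zopen_Int by auto
    have e1: "res F (D g) ?V m1 = ascl ?V h1 (res F W ?V s1)"
      using shrink[OF 1(4,6,2,1,7,8) V(1)] by simp
    have e2: "res F (D g) ?V m2 = ascl ?V h2 (res F W ?V s2)"
      using shrink[OF 2(4,6,2,1,7,8) V(1)] by simp
    have c: "res F W ?V s1 \<in> Sec ?V" "res F W ?V s2 \<in> Sec ?V"
      using res_closed[OF W(1) V(1,2)] 1 2 by auto
    define m where "m = ascl (D g) h2 m1 \<oplus>\<^bsub>sec F (D g)\<^esub> ascl (D g) h1 m2"
    have mc: "ascl (D g) h2 m1 \<in> Sec (D g)" "ascl (D g) h1 m2 \<in> Sec (D g)"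
      using ascl_closed[OF Dg] 1 2 by auto
    show "s1 \<oplus>\<^bsub>sec F W\<^esub> s2 \<in> K"
    proof (rule KI[of _ "h1 \<otimes> h2" ?V m])
      have "res F (D g) ?V m = ascl ?V h2 (res F (D g) ?V m1) \<oplus>\<^bsub>sec F ?V\<^esub> ascl ?V h1 (res F (D g) ?V m2)"
        unfolding m_def using 1 2 by (simp add: res_add[OF Dg V(1,3) mc] res_ascl[OF Dg V(1,3)])
      also have "\<dots> = ascl ?V (h1 \<otimes> h2) (res F W ?V s1) \<oplus>\<^bsub>sec F ?V\<^esub> ascl ?V (h1 \<otimes> h2) (res F W ?V s2)"
        unfolding e1 e2 using c 1(2) 2(2) ascl_commute[OF V(1), of h1 h2] by (simp add: ascl_mult[OF V(1)])
      also have "\<dots> = ascl ?V (h1 \<otimes> h2) (res F W ?V (s1 \<oplus>\<^bsub>sec F W\<^esub> s2))"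
        using 1 2 c by (simp add: res_add[OF W(1) V(1,2)] ascl_add_right[OF V(1)])
      finally show "res F (D g) ?V m = ascl ?V (h1 \<otimes> h2) (res F W ?V (s1 \<oplus>\<^bsub>sec F W\<^esub> s2))" .
      show "m \<in> Sec (D g)" unfolding m_def by (rule add_sec_closed[OF Dg mc])
    qed (use 1 2 V xS in \<open>auto simp: Spec_mult\<close>)
  next
    fix c s1 assume c: "c \<in> Reg W" and s1: "s1 \<in> K"
    obtain h1 V1 m1 where 1: "s1 \<in> Sec W" "h1 \<in> carrier A" "h1 \<notin> x" "zopen A V1" "x \<in> V1" "V1 \<subseteq> W"
     "m1 \<in> Sec (D g)" "res F (D g) V1 m1 = ascl V1 h1 (res F W V1 s1)"
      using s1 unfolding K_def by blast
    obtain v a b where v: "v \<in> carrier A" "a \<in> carrier A" "b \<in> carrier A" "x \<in> D v" "D v \<subseteq> W"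
      "\<forall>q\<in>D v. b \<notin> q" "restrict c (D v) = frac_sec A (D v) a b"
      using str_sheaf_locally_frac[OF c W(2)] by blast
    let ?V = "V1 \<inter> D v"
    have V: "zopen A ?V" "?V \<subseteq> W" "?V \<subseteq> D g" using 1 v Wg zopen_Int D_zopen by auto
    interpret V: module "str_sheaf A ?V" "sec F ?V" by (rule sec_module[OF V(1)])
    have cc: "restrict c ?V = frac_sec A ?V a b"
    proof -
      have "restrict c ?V = restrict (restrict c (D v)) ?V" by (simp add: Int_absorb1)
      then show ?thesis unfolding v(7) by (simp add: restrict_frac_sec)
    qed
    have fc: "frac_sec A ?V a b \<in> Reg ?V" using frac_sec_closed[OF V(1)] v by auto
    have e1: "res F (D g) ?V m1 = ascl ?V h1 (res F W ?V s1)"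
      using shrink[OF 1(4,6,2,1,7,8) V(1)] by simp
    have sc: "res F W ?V s1 \<in> Sec ?V" using res_closed[OF W(1) V(1,2)] 1 by auto
    show "c \<odot>\<^bsub>sec F W\<^esub> s1 \<in> K"
    proof (rule KI[of _ "h1 \<otimes> b" ?V "ascl (D g) a m1"])
      have "ascl ?V (h1 \<otimes> b) (res F W ?V (c \<odot>\<^bsub>sec F W\<^esub> s1)) =
        ascl ?V h1 (ascl ?V b (frac_sec A ?V a b \<odot>\<^bsub>sec F ?V\<^esub> res F W ?V s1))"
        using 1 v sc fc by (simp add: ascl_mult[OF V(1)] res_smult[OF W(1) V(1,2) c] cc)
      also have "ascl ?V b (frac_sec A ?V a b \<odot>\<^bsub>sec F ?V\<^esub> res F W ?V s1) = ascl ?V a (res F W ?V s1)"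
        using const_sec_mult_frac_sec[OF V(1) v(2,3)] v(6) fc sc const_sec_closed[OF V(1) v(3)]
        by (simp add: ascl_def flip: V.smult_assoc1)
      also have "ascl ?V h1 (ascl ?V a (res F W ?V s1)) = ascl ?V a (res F (D g) ?V m1)"
        unfolding e1 by (rule ascl_commute[OF V(1) 1(2) v(2) sc])
      finally show "res F (D g) ?V (ascl (D g) a m1) = ascl ?V (h1 \<otimes> b) (res F W ?V (c \<odot>\<^bsub>sec F W\<^esub> s1))"
        using res_ascl[OF Dg V(1,3) v(2) 1(7)] by simp
    qed (use 1 v V xS c ascl_closed[OF Dg v(2) 1(7)] in \<open>auto simp: Spec_mult\<close>)
  qed
  moreover have "res F U W e \<in> K" if "e \<in> S" for e
  proof (rule KI[of _ \<one> W "res F U (D g) e"])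
    have e: "e \<in> Sec U" using that S by auto
    show eW: "res F U W e \<in> Sec W" by (rule res_closed[OF U(1) W(1) WU e])
    show "res F (D g) W (res F U (D g) e) = ascl W \<one> (res F W W (res F U W e))"
      using res_comp[OF U(1) Dg U(2) W(1) Wg e] res_id[OF W(1) eW] ascl_one[OF W(1) eW] by simp
    show "res F U (D g) e \<in> Sec (D g)" by (rule res_closed[OF U(1) Dg U(2) e])
  qed (use W Spec_not_one[OF xS] in auto)
  ultimately have "res F ?gf W s \<in> K" using W.lin_span_least W(4) by blast
  then obtain h V m where h: "h \<in> carrier A" "h \<notin> x" "zopen A V" "x \<in> V" "V \<subseteq> W"
     "m \<in> Sec (D g)" "res F (D g) V m = ascl V h (res F W V (res F ?gf W s))"
    unfolding K_def by blast
  obtain v where v: "v \<in> carrier A" "x \<in> D v" "D v \<subseteq> V" using basic_open_subset[OF h(3,4)] by blast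
  note Dv = D_zopen[OF v(1)]
  have gfv: "D (g \<otimes> f) = ?gf" "g \<otimes> f \<in> carrier A" using g f by (auto simp: basic_open_mult)
  have vv: "D v \<subseteq> ?gf" "?gf \<inter> D v = D v" using v h W by auto
  have sW: "res F ?gf W s \<in> Sec W" by (rule res_closed[OF gf(1) W(1,3) s])
  have "res F ?gf (D v) (ascl ?gf h s) = ascl (D v) h (res F W (D v) (res F ?gf W s))"
    using res_ascl[OF gf(1) Dv vv(1) h(1) s] res_comp[OF gf(1) W(1,3) Dv _ s] v(3) h(5) by simp
  also have "\<dots> = res F ?gf (D v) (res F (D g) ?gf m)"
    using shrink[OF h(3,5,1) sW h(6,7) Dv v(3)] res_comp[OF Dg gf Dv vv(1) h(6)] by simp
  finally obtain N :: nat where "ascl ?gf (v [^] N) (ascl ?gf h s) = ascl ?gf (v [^] N) (res F (D g) ?gf m)"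
    using equal_after_power[OF gfv(2) v(1)] ascl_closed[OF gf(1) h(1) s] res_closed[OF Dg gf h(6)]
    unfolding gfv(1) vv(2) by blast
  then have "res F (D g) ?gf (ascl (D g) (v [^] N) m) = ascl ?gf (v [^] N \<otimes> h) s"
    using v h s by (simp add: res_ascl[OF Dg gf] ascl_mult[OF gf(1)])
  moreover have "v [^] N \<otimes> h \<notin> x" using Spec_mult[OF xS] Spec_pow[OF xS v(1)] v h by (auto simp: basic_open_def)
  moreover have "ascl (D g) (v [^] N) m \<in> Sec (D g)" using v h ascl_closed[OF Dg] by auto
  ultimately show ?thesis using v h by (intro bexI[of _ "v [^] N \<otimes> h"] conjI bexI[of _ "ascl (D g) (v [^] N) m"]) auto
qed

text \<open>The elements \<open>a\<close> such that \<open>a s\<close> extends from \<open>D g \<inter>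
  D f\<close> to \<open>D g\<close> form an ideal. By the previous lemma they have no common zero in
  \<open>D (g f)\<close>, so a power of \<open>g f\<close> is among them.\<close>

lemma extends_locally:
  assumes f: "f \<in> carrier A" and s: "s \<in> Sec (D f)" and p: "p \<in> Spec A"
  shows "\<exists>g\<in>carrier A. p \<in> D g \<and> (\<exists>N::nat. \<exists>m\<in>Sec (D g).
    res F (D g) (D g \<inter> D f) m = res F (D f) (D g \<inter> D f) (ascl (D f) (f [^] N) s))"
proof -
  have "finite_type_sheaf A F" using coherent by (simp add: coherent_def)
  then obtain U S where U: "zopen A U" "p \<in> U" "generates A F U S"
    using p unfolding finite_type_sheaf_def by blast
  obtain g where g: "g \<in> carrier A" "p \<in> D g" "D g \<subseteq> U" using basic_open_subset[OF U(1,2)] by blast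
  note Dg = D_zopen[OF g(1)]
  let ?gf = "D g \<inter> D f"
  have gf: "zopen A ?gf" "?gf \<subseteq> D g" "?gf \<subseteq> D f" using g f by (auto simp: D_zopen zopen_Int)
  define s' where "s' = res F (D f) ?gf s"
  have s': "s' \<in> Sec ?gf" unfolding s'_def by (rule res_closed[OF D_zopen[OF f] gf(1,3) s])
  let ?Q = "\<lambda>a. \<exists>m\<in>Sec (D g). res F (D g) ?gf m = ascl ?gf a s'"
  have "\<exists>k::nat. ?Q ((g \<otimes> f) [^] k)"
  proof (rule power_if_locally)
    show "g \<otimes> f \<in> carrier A" using g f by simp
    show "?Q \<zero>"
      using zero_sec_closed[OF Dg] res_zero[OF Dg gf(1,2)] ascl_zero[OF gf(1) s'] by metis
    show "?Q (a \<oplus> b)" if "a \<in> carrier A" "b \<in> carrier A" "?Q a" "?Q b" for a b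
      using that res_add[OF Dg gf(1,2)] add_sec_closed[OF Dg] ascl_add[OF gf(1) _ _ s'] by metis
    show "?Q (x \<otimes> a)" if "x \<in> carrier A" "a \<in> carrier A" "?Q a" for x a
      using that res_ascl[OF Dg gf(1,2)] ascl_closed[OF Dg] ascl_mult[OF gf(1) _ _ s'] by metis
    show "\<exists>a\<in>carrier A. ?Q a \<and> a \<notin> x" if "x \<in> D (g \<otimes> f)" for x
    proof -
      have "x \<in> ?gf" using that g f by (simp add: basic_open_mult)
      from numerators_of_local_section[OF g(1) f s' U(3,1) g(3) this] show ?thesis by blast
    qed
  qed
  then obtain k :: nat and m where m: "m \<in> Sec (D g)"
    "res F (D g) ?gf m = ascl ?gf ((g \<otimes> f) [^] k) s'" by blast
  have gk: "g [^] k \<in> carrier A" and fk: "f [^] k \<in> carrier A" using g f by auto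
  \<comment> \<open>\<open>g\<close> is invertible on \<open>D g\<close>, so that its power can be divided out.\<close>
  obtain m' where m': "m' \<in> Sec (D g)" "ascl (D g) (g [^] k) m' = m"
    using ascl_unit_surj[OF Dg gk D_power[OF g(1)] m(1)] by blast
  have "res F (D g) ?gf m' = ascl ?gf (f [^] k) s'"
  proof (rule ascl_cancel[OF gf(1) gk])
    show "g [^] k \<notin> q" if "q \<in> ?gf" for q using D_power[OF g(1)] that by blast
    show "ascl ?gf (g [^] k) (res F (D g) ?gf m') = ascl ?gf (g [^] k) (ascl ?gf (f [^] k) s')"
      using res_ascl[OF Dg gf(1,2) gk m'(1)] m'(2) m(2) ascl_mult[OF gf(1) gk fk s'] g f
      by (simp add: nat_pow_distrib)
  qed (use res_closed[OF Dg gf(1,2) m'(1)] ascl_closed[OF gf(1) fk s'] in auto)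
  then have "res F (D g) ?gf m' = res F (D f) ?gf (ascl (D f) (f [^] k) s)"
    unfolding s'_def using res_ascl[OF D_zopen[OF f] gf(1,3) fk s] by simp
  then show ?thesis using g m' by blast
qed

text \<open>The local extensions become compatible after multiplication with a further power of \<open>f\<close>, by
  \<open>equal_after_power\<close> on the intersections of basic open sets, and can then be glued.\<close>

lemma extends_after_power:
  assumes f: "f \<in> carrier A" and s: "s \<in> Sec (D f)"
  shows "\<exists>N::nat. \<exists>m\<in>Sec (Spec A). res F (Spec A) (D f) m = ascl (D f) (f [^] N) s"
proof -
  note Df = D_zopen[OF f]
  let ?s = "\<lambda>N::nat. ascl (D f) (f [^] N) s"
  define E where "E = (\<lambda>U N m. m \<in> Sec U \<and> res F U (U \<inter> D f) m = res F (D f) (U \<inter> D f) (?s N))"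
  define Q where "Q = (\<lambda>U. \<exists>N m. E U N m)"
  have fN: "f [^] (N::nat) \<in> carrier A" for N using f by simp
  have fs: "?s N \<in> Sec (D f)" for N by (rule ascl_closed[OF Df fN s])
  have raise: "E U (M + N) (ascl U (f [^] M) m)" if U: "zopen A U" and "E U N m" for U M N m
  proof -
    have Uf: "zopen A (U \<inter> D f)" by (rule zopen_Int[OF U Df])
    show ?thesis using that fN fs s f unfolding E_def
      by (simp add: ascl_closed[OF U] res_ascl[OF U Uf] ascl_power_add[OF Df] res_ascl[OF Df Uf])
  qed
  have shrink: "E V N (res F U V m)" if Z: "zopen A U" "zopen A V" and VU: "V \<subseteq> U" and E: "E U N m" for U V N m
  proof -
    have m: "m \<in> Sec U" using E by (simp add: E_def)
    have W: "zopen A (U \<inter> D f)" "zopen A (V \<inter> D f)" "V \<inter> D f \<subseteq> U \<inter> D f"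
      using Z Df VU zopen_Int by auto
    have "res F U (V \<inter> D f) m = res F (D f) (V \<inter> D f) (?s N)"
      using res_eq_subset[OF Z(1) Df W(1) _ _ W(2,3) m fs, of N] E by (simp add: E_def)
    then show ?thesis using res_comp[OF Z VU W(2) _ m] res_closed[OF Z VU m] by (simp add: E_def)
  qed
  have "Q (D \<one>)"
  proof (rule basic_open_cover_induct)
    have "res F {} {} (zero_sec {}) = res F (D f) {} (?s 0)"
      by (rule eq_on_empty[OF res_closed[OF zopen_empty zopen_empty _ zero_sec_closed[OF zopen_empty]]
        res_closed[OF Df zopen_empty _ fs]]) auto
    then have "E {} 0 (zero_sec {})" unfolding E_def using zero_sec_closed[OF zopen_empty]
      by (simp only: Int_empty_left simp_thms)
    then show "Q {}" unfolding Q_def by blast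
  next
    fix a b assume ab: "a \<in> carrier A" "b \<in> carrier A" and "Q (D a)" "Q (D b)"
    then obtain M m N n where "E (D a) M m" "E (D b) N n" unfolding Q_def by blast
    then have "E (D a) (N + M) (ascl (D a) (f [^] N) m)" "E (D b) (M + N) (ascl (D b) (f [^] M) n)"
      using raise ab D_zopen by auto
    then obtain L m n where L: "E (D a) L m" "E (D b) L n" by (metis add.commute)
    note Da = D_zopen[OF ab(1)] and Db = D_zopen[OF ab(2)]
    have m: "m \<in> Sec (D a)" and n: "n \<in> Sec (D b)" using L by (auto simp: E_def)
    let ?V = "D a \<inter> D b"
    have abc: "a \<otimes> b \<in> carrier A" and Dab: "D (a \<otimes> b) = ?V" using ab by (auto simp: basic_open_mult)
    have V: "zopen A ?V" "?V \<subseteq> D a" "?V \<subseteq> D b" using zopen_Int[OF Da Db] by auto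
    have "res F ?V (?V \<inter> D f) (res F (D a) ?V m) = res F ?V (?V \<inter> D f) (res F (D b) ?V n)"
      using shrink[OF Da V(1,2) L(1)] shrink[OF Db V(1,3) L(2)] by (simp add: E_def)
    then obtain K :: nat where K: "ascl ?V (f [^] K) (res F (D a) ?V m) = ascl ?V (f [^] K) (res F (D b) ?V n)"
      using equal_after_power[OF abc f] res_closed[OF Da V(1,2) m] res_closed[OF Db V(1,3) n]
      unfolding Dab by blast
    define m' n' where "m' = ascl (D a) (f [^] K) m" and "n' = ascl (D b) (f [^] K) n"
    have E': "E (D a) (K + L) m'" "E (D b) (K + L) n'" unfolding m'_def n'_def using raise Da Db L by auto
    have "res F (D a) ?V m' = res F (D b) ?V n'"
      unfolding m'_def n'_def using K m n by (simp add: res_ascl[OF Da V(1,2) fN] res_ascl[OF Db V(1,3) fN])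
    then obtain y where y: "y \<in> Sec (D a \<union> D b)"
      "res F (D a \<union> D b) (D a) y = m'" "res F (D a \<union> D b) (D b) y = n'"
      using glue_two[OF Da Db] E' unfolding E_def by blast
    let ?U = "D a \<union> D b"
    have U: "zopen A ?U" by (rule zopen_Un[OF Da Db])
    have Uf: "zopen A (?U \<inter> D f)" by (rule zopen_Int[OF U Df])
    have part: "res F (?U \<inter> D f) (D d \<inter> D f) (res F ?U (?U \<inter> D f) y) =
        res F (?U \<inter> D f) (D d \<inter> D f) (res F (D f) (?U \<inter> D f) (?s (K + L)))"
      if d: "d \<in> carrier A" "D d \<subseteq> ?U" "E (D d) (K + L) (res F ?U (D d) y)" for d
    proof -
      have W: "zopen A (D d \<inter> D f)" "D d \<inter> D f \<subseteq> ?U \<inter> D f" "D d \<inter> D f \<subseteq> D d"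
        using D_zopen d(1,2) f zopen_Int by auto
      show ?thesis using d(3) res_comp[OF U Uf _ W(1,2) y(1)] res_comp[OF Df Uf _ W(1,2) fs, of "K + L"]
          res_comp[OF U D_zopen[OF d(1)] d(2) W(1,3) y(1)] by (simp add: E_def)
    qed
    have "res F ?U (?U \<inter> D f) y = res F (D f) (?U \<inter> D f) (?s (K + L))"
    proof (rule eq_if_eq_on_cover[OF Uf, of "D a \<inter> D f" "D b \<inter> D f"])
      show "res F ?U (?U \<inter> D f) y \<in> Sec (?U \<inter> D f)" using res_closed[OF U Uf _ y(1)] by simp
      show "res F (D f) (?U \<inter> D f) (?s (K + L)) \<in> Sec (?U \<inter> D f)" using res_closed[OF Df Uf _ fs] by simp
    qed (use part[OF ab(1)] part[OF ab(2)] E' y zopen_Int Da Db Df in auto)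
    then show "Q ?U" unfolding Q_def E_def using y(1) by blast
  next
    fix U V assume "zopen A U" "zopen A V" "V \<subseteq> U" "Q U"
    then show "Q V" unfolding Q_def using shrink by blast
  next
    fix p assume "p \<in> D \<one>"
    then have p: "p \<in> Spec A" by (simp add: basic_open_one)
    show "\<exists>a\<in>carrier A. p \<in> D a \<and> Q (D a)"
      using extends_locally[OF f s p] unfolding Q_def E_def by blast
  qed simp
  moreover have "Spec A \<inter> D f = D f" by (auto simp: basic_open_def)
  ultimately show ?thesis unfolding Q_def E_def using res_id[OF Df fs] by (auto simp: basic_open_one)
qed

text \<open>Near each point, a section is a global section divided by a power of some \<open>f\<close>.
  This amounts to the generation of coherent sheaves on affine schemes by their global sections.\<close>

theorem submodule_sheaf_eq_if_global_eq:
  assumes P: "submodule_sheaf P" and glob: "Sec (Spec A) \<subseteq> P (Spec A)" and U: "zopen A U"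
  shows "P U = Sec U"
proof
  show "P U \<subseteq> Sec U" by (rule P_subset[OF P U])
  show "Sec U \<subseteq> P U"
  proof
    fix s assume s: "s \<in> Sec U"
    show "s \<in> P U" using P U s
    proof (rule P_local)
      fix p assume "p \<in> U"
      then obtain f where f: "f \<in> carrier A" "p \<in> D f" "D f \<subseteq> U" using basic_open_subset[OF U] by blast
      note Df = D_zopen[OF f(1)]
      let ?s = "res F U (D f) s"
      have s': "?s \<in> Sec (D f)" by (rule res_closed[OF U Df f(3) s])
      obtain N :: nat and m where m: "m \<in> Sec (Spec A)"
        "res F (Spec A) (D f) m = ascl (D f) (f [^] N) ?s"
        using extends_after_power[OF f(1) s'] by blast
      have fN: "f [^] N \<in> carrier A" using f by simp
      have u: "frac_sec A (D f) \<one> (f [^] N) \<in> Reg (D f)"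
        using D_power[OF f(1)] fN by (intro frac_sec_closed[OF Df]) auto
      have "res F (Spec A) (D f) m \<in> P (D f)"
        using P_res[OF P zopen_Spec Df zopen_subset_Spec[OF Df]] m(1) glob by blast
      then have "frac_sec A (D f) \<one> (f [^] N) \<odot>\<^bsub>sec F (D f)\<^esub> ascl (D f) (f [^] N) ?s \<in> P (D f)"
        unfolding m(2) by (rule submodule.smult_closed[OF P_submodule[OF P Df] u])
      then have "?s \<in> P (D f)" using divide_by_unit(1)[OF Df fN D_power[OF f(1)] s'] by simp
      then show "\<exists>W. zopen A W \<and> p \<in> W \<and> W \<subseteq> U \<and> res F U W s \<in> P W" using f Df by blast
    qed
  qed
qed

end

section \<open>Dimension\<close>

lemma CC_simps [simp]: "carrier CC = UNIV" "x \<otimes>\<^bsub>CC\<^esub> y = x * y" "x \<oplus>\<^bsub>CC\<^esub> y = x + y"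
  "\<one>\<^bsub>CC\<^esub> = 1" "\<zero>\<^bsub>CC\<^esub> = 0"
  by (simp_all add: ring_of_type_algebra_def)

lemma cring_CC: "cring CC"
  by (rule cring_from_type_algebra)

lemma a_inv_CC [simp]: "\<ominus>\<^bsub>CC\<^esub> x = - x"
proof -
  interpret cring CC by (rule cring_CC)
  show ?thesis using minus_equality[of "- x" x] by simp
qed

lemma cspace_carrier: "v \<in> carrier (cspace n) \<longleftrightarrow> (\<forall>i\<ge>n. v i = 0)"
  by (simp add: cspace_def)

lemma cspace_simps [simp]:
  "v \<oplus>\<^bsub>cspace n\<^esub> w = (\<lambda>i. v i + w i)" "c \<odot>\<^bsub>cspace n\<^esub> v = (\<lambda>i. c * v i)" "\<zero>\<^bsub>cspace n\<^esub> = (\<lambda>i. 0)"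
  by (simp_all add: cspace_def)

lemma cspace_closed:
  "v \<in> carrier (cspace n) \<Longrightarrow> w \<in> carrier (cspace n) \<Longrightarrow> (\<lambda>i. v i + w i) \<in> carrier (cspace n)"
  "v \<in> carrier (cspace n) \<Longrightarrow> (\<lambda>i. c * v i) \<in> carrier (cspace n)"
  by (simp_all add: cspace_carrier)

lemma module_cspace: "module CC (cspace n)"
proof (rule moduleI[OF cring_CC], rule abelian_groupI)
  show "\<exists>y\<in>carrier (cspace n). y \<oplus>\<^bsub>cspace n\<^esub> x = \<zero>\<^bsub>cspace n\<^esub>" if "x \<in> carrier (cspace n)" for x
    using that by (intro bexI[of _ "\<lambda>i. - x i"]) (auto simp: cspace_carrier)
qed (auto simp: algebra_simps cspace_carrier)

text \<open>In contrast to \<open>lin_maps\<close>, nothing is demanded of the values outside of the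
  carrier.\<close>

definition linear_map :: "(complex, 'v, 'x) module_scheme \<Rightarrow> (complex, 'w, 'y) module_scheme \<Rightarrow> ('v \<Rightarrow> 'w) \<Rightarrow> bool"
  where "linear_map V W f \<longleftrightarrow> f \<in> carrier V \<rightarrow> carrier W \<and>
     (\<forall>x\<in>carrier V. \<forall>y\<in>carrier V. f (x \<oplus>\<^bsub>V\<^esub> y) = f x \<oplus>\<^bsub>W\<^esub> f y) \<and>
     (\<forall>c. \<forall>x\<in>carrier V. f (c \<odot>\<^bsub>V\<^esub> x) = c \<odot>\<^bsub>W\<^esub> f x)"

lemma linear_mapD:
  assumes "linear_map V W f"
  shows "x \<in> carrier V \<Longrightarrow> f x \<in> carrier W"
    "x \<in> carrier V \<Longrightarrow> y \<in> carrier V \<Longrightarrow> f (x \<oplus>\<^bsub>V\<^esub> y) = f x \<oplus>\<^bsub>W\<^esub> f y"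
    "x \<in> carrier V \<Longrightarrow> f (c \<odot>\<^bsub>V\<^esub> x) = c \<odot>\<^bsub>W\<^esub> f x"
  using assms unfolding linear_map_def by blast+

context
  fixes V :: "(complex, 'v, 'x) module_scheme" and W :: "(complex, 'w, 'y) module_scheme" and f
  assumes V: "module CC V" and W: "module CC W" and f: "linear_map V W f"
begin

interpretation V: module CC V by (rule V)
interpretation W: module CC W by (rule W)

lemma linear_map_zero: "f \<zero>\<^bsub>V\<^esub> = \<zero>\<^bsub>W\<^esub>"
  using linear_mapD(3)[OF f, of "\<zero>\<^bsub>V\<^esub>" 0] linear_mapD(1)[OF f, of "\<zero>\<^bsub>V\<^esub>"] V.smult_l_null[of "\<zero>\<^bsub>V\<^esub>"]
    W.smult_l_null[of "f \<zero>\<^bsub>V\<^esub>"] by simp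

lemma linear_image_submodule:
  assumes S: "submodule S CC V" shows "submodule (f ` S) CC W"
proof (rule W.submoduleI_smult)
  note SE = V.submoduleE[OF S] V.submodule_zero[OF S]
  have Sd: "x \<in> carrier V" if "x \<in> S" for x using SE(1) that by blast
  show "f ` S \<subseteq> carrier W" using linear_mapD(1)[OF f Sd] by blast
  show "\<zero>\<^bsub>W\<^esub> \<in> f ` S" using SE linear_map_zero by (metis imageI)
  fix y assume "y \<in> f ` S"
  then obtain x where x: "x \<in> S" "y = f x" by blast
  show "c \<odot>\<^bsub>W\<^esub> y \<in> f ` S" for c
    using SE(4)[of c x] x linear_mapD(3)[OF f Sd[OF x(1)], of c] by (intro image_eqI[of _ _ "c \<odot>\<^bsub>V\<^esub> x"]) simp_all
  fix z assume "z \<in> f ` S"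
  then obtain w where w: "w \<in> S" "z = f w" by blast
  show "y \<oplus>\<^bsub>W\<^esub> z \<in> f ` S" using SE(5)[OF x(1) w(1)] x w linear_mapD(2)[OF f Sd[OF x(1)] Sd[OF w(1)]]
    by (intro image_eqI[of _ _ "x \<oplus>\<^bsub>V\<^esub> w"]) simp_all
qed

lemma linear_vimage_submodule:
  assumes S: "submodule S CC W" shows "submodule {x \<in> carrier V. f x \<in> S} CC V"
  by (rule V.submoduleI_smult)
    (use linear_map_zero linear_mapD[OF f] W.submoduleE(4,5)[OF S] W.submodule_zero[OF S] in auto)

end

context module
begin

lemma lin_span_insert:
  assumes \<phi>: "\<phi> \<in> insert a S \<rightarrow> carrier M" and x: "x \<in> lin_span R M \<phi> (insert a S)"
  shows "\<exists>y\<in>lin_span R M \<phi> S. \<exists>c\<in>carrier R. x = y \<oplus>\<^bsub>M\<^esub> c \<odot>\<^bsub>M\<^esub> \<phi> a"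
proof -
  obtain T c where T: "finite T" "T \<subseteq> insert a S" "c \<in> T \<rightarrow> carrier R" "x = (\<Oplus>\<^bsub>M\<^esub>e\<in>T. c e \<odot>\<^bsub>M\<^esub> \<phi> e)"
    using x by (auto simp: lin_span_def)
  have \<phi>c: "\<phi> e \<in> carrier M" if "e \<in> T" for e using \<phi> T that by auto
  have cc: "c e \<in> carrier R" if "e \<in> T" for e using T that by auto
  have sub: "(\<Oplus>\<^bsub>M\<^esub>e\<in>T - {a}. c e \<odot>\<^bsub>M\<^esub> \<phi> e) \<in> lin_span R M \<phi> S"
    unfolding lin_span_def mem_Collect_eq using T by (intro exI[of _ "T - {a}"] exI[of _ c]) auto
  have subc: "(\<Oplus>\<^bsub>M\<^esub>e\<in>T - {a}. c e \<odot>\<^bsub>M\<^esub> \<phi> e) \<in> carrier M"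
    using \<phi>c cc by (intro M.finsum_closed) auto
  show ?thesis
  proof (cases "a \<in> T")
    case True
    then have "x = (\<Oplus>\<^bsub>M\<^esub>e\<in>insert a (T - {a}). c e \<odot>\<^bsub>M\<^esub> \<phi> e)" using T by (simp add: insert_absorb)
    also have "\<dots> = c a \<odot>\<^bsub>M\<^esub> \<phi> a \<oplus>\<^bsub>M\<^esub> (\<Oplus>\<^bsub>M\<^esub>e\<in>T - {a}. c e \<odot>\<^bsub>M\<^esub> \<phi> e)"
      using T(1) \<phi>c cc True by (intro M.finsum_insert) auto
    also have "\<dots> = (\<Oplus>\<^bsub>M\<^esub>e\<in>T - {a}. c e \<odot>\<^bsub>M\<^esub> \<phi> e) \<oplus>\<^bsub>M\<^esub> c a \<odot>\<^bsub>M\<^esub> \<phi> a"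
      using \<phi>c cc True subc by (intro M.a_comm) auto
    finally show ?thesis using sub cc True by blast
  next
    case False
    then have "x = (\<Oplus>\<^bsub>M\<^esub>e\<in>T - {a}. c e \<odot>\<^bsub>M\<^esub> \<phi> e) \<oplus>\<^bsub>M\<^esub> \<zero> \<odot>\<^bsub>M\<^esub> \<phi> a"
      using T subc \<phi> by simp
    then show ?thesis using sub by blast
  qed
qed

lemma lin_span_mono: "S \<subseteq> S' \<Longrightarrow> lin_span R M \<phi> S \<subseteq> lin_span R M \<phi> S'"
  unfolding lin_span_def by blast

lemma lin_span_cong:
  assumes "\<And>e. e \<in> S \<Longrightarrow> \<phi> e = \<psi> e" "\<phi> \<in> S \<rightarrow> carrier M" shows "lin_span R M \<phi> S = lin_span R M \<psi> S"
proof -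
  have "\<psi> \<in> S \<rightarrow> carrier M" using assms by (metis Pi_cong)
  then show ?thesis
    using assms lin_span_base[of \<phi> S] lin_span_base[of \<psi> S]
    by (intro subset_antisym lin_span_least submodule_lin_span) auto
qed

lemma lin_span_empty: "lin_span R M \<phi> {} = {\<zero>\<^bsub>M\<^esub>}"
  by (auto simp: lin_span_def)

lemma submodule_Int: "submodule H R M \<Longrightarrow> submodule K R M \<Longrightarrow> submodule (H \<inter> K) R M"
  using submoduleE[of H] submoduleE[of K] submodule_zero[of H] submodule_zero[of K]
  by (intro submoduleI) auto

lemma submodule_minus: "submodule H R M \<Longrightarrow> x \<in> H \<Longrightarrow> y \<in> H \<Longrightarrow> x \<ominus>\<^bsub>M\<^esub> y \<in> H"
  unfolding a_minus_def using submoduleE[of H] by auto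

end

locale complex_space = module CC V for V :: "(complex, 'v, 'x) module_scheme" (structure)

context complex_space
begin

abbreviation span :: "('i \<Rightarrow> 'v) \<Rightarrow> 'i set \<Rightarrow> 'v set" where
  "span w I \<equiv> lin_span CC V w I"

text \<open>The dimension will turn out to be the least such \<open>n\<close>. Counting generators comes
  first, because it can be done for a subspace before a basis is known.\<close>

definition spanned_by :: "'v set \<Rightarrow> nat \<Rightarrow> bool" where
  "spanned_by W n \<longleftrightarrow> (\<exists>w\<in>{..<n} \<rightarrow> W. W = span w {..<n})"

lemma smult_inverse: "c \<noteq> 0 \<Longrightarrow> x \<in> carrier V \<Longrightarrow> inverse c \<odot> (c \<odot> x) = x"
  using smult_assoc1[of "inverse c" c x] smult_one[of x] by simp

lemma smult_mem_iff: "submodule H CC V \<Longrightarrow> c \<noteq> 0 \<Longrightarrow> x \<in> carrier V \<Longrightarrow> c \<odot> x \<in> H \<longleftrightarrow> x \<in> H"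
  using submodule.smult_closed[of H CC V c x] submodule.smult_closed[of H CC V "inverse c" "c \<odot> x"]
    smult_inverse[of c x] by auto

lemma add_mem_iff: "submodule H CC V \<Longrightarrow> x \<in> H \<Longrightarrow> y \<in> carrier V \<Longrightarrow> x \<oplus> y \<in> H \<longleftrightarrow> y \<in> H"
proof
  assume H: "submodule H CC V" "x \<in> H" "y \<in> carrier V"
  then have x: "x \<in> carrier V" using submoduleE by blast
  show "y \<in> H" if "x \<oplus> y \<in> H"
  proof -
    have "y = (x \<oplus> y) \<ominus> x" using H x by (simp add: M.minus_eq M.a_comm[of x y] M.a_assoc M.r_neg)
    then show ?thesis using submodule_minus[OF H(1) that H(2)] by simp
  qed
  show "x \<oplus> y \<in> H" if "y \<in> H" using submoduleE(5)[OF H(1)] that H by blast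
qed

text \<open>Let \<open>W'\<close> be spanned by all generators of \<open>W\<close> but the last. Then \<open>U\<close> is \<open>U \<inter> W'\<close>, or it is generated
  by \<open>U \<inter> W'\<close> and any one of its elements outside of \<open>W'\<close>; in the second case \<open>U \<inter> W' = W'\<close> would imply
  that \<open>U = W\<close>.\<close>

lemma spanned_by_subspace:
  assumes "spanned_by W n" "submodule W CC V" "submodule U CC V" "U \<subseteq> W"
  shows "\<exists>k\<le>n. spanned_by U k \<and> (U \<noteq> W \<longrightarrow> k < n)"
  using assms
proof (induction n arbitrary: W U)
  case 0
  then have "W = {\<zero>}" by (auto simp: spanned_by_def lin_span_empty)
  moreover have "U = {\<zero>}" using calculation 0 submodule_zero by blast
  ultimately show ?case using 0 by auto
next
  case (Suc n)
  obtain w where w: "w \<in> {..<Suc n} \<rightarrow> W" "W = span w {..<Suc n}"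
    using Suc.prems(1) by (auto simp: spanned_by_def)
  have Wc: "W \<subseteq> carrier V" by (rule submoduleE(1)[OF Suc.prems(2)])
  have wc: "w i \<in> carrier V" if "i < Suc n" for i using w Wc that by auto
  have wS: "w \<in> insert n {..<n} \<rightarrow> carrier V" and wn: "w \<in> {..<n} \<rightarrow> carrier V" using wc by auto
  define W' where "W' = span w {..<n}"
  have W': "submodule W' CC V" unfolding W'_def by (rule submodule_lin_span[OF wn])
  have W'W: "W' \<subseteq> W" unfolding W'_def w(2) by (rule lin_span_mono) auto
  have sp': "spanned_by W' n" unfolding spanned_by_def W'_def using lin_span_base[OF wn] by blast
  have dec: "\<exists>y\<in>W'. \<exists>c. x = y \<oplus> c \<odot> w n" if "x \<in> W" for x
    using lin_span_insert[OF wS, of x] that unfolding w(2) W'_def by (auto simp: lessThan_Suc)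
  have UW': "submodule (U \<inter> W') CC V" by (rule submodule_Int[OF Suc.prems(3) W'])
  from Suc.IH[OF sp' W' UW'] obtain k where k: "k \<le> n" "spanned_by (U \<inter> W') k" "U \<inter> W' \<noteq> W' \<Longrightarrow> k < n" by auto
  show ?case
  proof (cases "U \<subseteq> W'")
    case True
    then show ?thesis using k by (intro exI[of _ k]) (auto simp: Int_absorb2)
  next
    case False
    then obtain u where u: "u \<in> U" "u \<notin> W'" by blast
    then obtain y c where yc: "y \<in> W'" "u = y \<oplus> c \<odot> w n" using dec Suc.prems(4) by blast
    have yV: "y \<in> carrier V" using yc submoduleE(1)[OF W'] by blast
    have "c \<noteq> 0"
    proof
      assume "c = 0"
      then have "u = y" using yc yV wc[of n] smult_l_null[of "w n"] by simp
      then show False using u yc by simp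
    qed
    have uV: "u \<in> carrier V" using u Suc.prems(4) Wc by blast
    obtain v where v: "v \<in> {..<k} \<rightarrow> U \<inter> W'" "U \<inter> W' = span v {..<k}"
      using k by (auto simp: spanned_by_def)
    define v' where "v' = v(k := u)"
    have Uc: "U \<subseteq> carrier V" using Suc.prems(4) Wc by auto
    have v': "v' \<in> {..<Suc k} \<rightarrow> U" using v(1) u(1) by (auto simp: v'_def less_Suc_eq)
    then have v'c: "v' \<in> {..<Suc k} \<rightarrow> carrier V" using Uc by auto
    have sub': "submodule (span v' {..<Suc k}) CC V" by (rule submodule_lin_span[OF v'c])
    have inc: "U \<inter> W' \<subseteq> span v' {..<Suc k}"
    proof -
      have "span v {..<k} = span v' {..<k}"
        using v(1) Uc by (intro lin_span_cong) (auto simp: v'_def)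
      also have "\<dots> \<subseteq> span v' {..<Suc k}" by (rule lin_span_mono) auto
      finally show ?thesis using v by simp
    qed
    have uin: "u \<in> span v' {..<Suc k}" using lin_span_base[OF v'c, of k] by (simp add: v'_def)
    have "U = span v' {..<Suc k}"
    proof
      show "span v' {..<Suc k} \<subseteq> U" using v' by (intro lin_span_least[OF Suc.prems(3)]) auto
      show "U \<subseteq> span v' {..<Suc k}"
      proof
        fix x assume x: "x \<in> U"
        then obtain z d where z: "z \<in> W'" "x = z \<oplus> d \<odot> w n" using dec Suc.prems(4) by blast
        have zV: "z \<in> carrier V" using z submoduleE(1)[OF W'] by blast
        define q where "q = x \<ominus> (d / c) \<odot> u"
        have du: "(d / c) \<odot> u \<in> carrier V" using uV by simp
        have "(d / c) \<odot> u = (d / c) \<odot> y \<oplus> d \<odot> w n"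
          using yc(2) yV wc[of n] \<open>c \<noteq> 0\<close> smult_assoc1[of "d / c" c "w n"]
          by (simp add: smult_r_distr)
        then have "q = z \<ominus> (d / c) \<odot> y"
          unfolding q_def z(2) using zV yV wc[of n]
          by (simp add: M.minus_eq M.minus_add M.a_ac M.r_neg1 M.r_neg2)
        then have "q \<in> W'" using submodule_minus[OF W' z(1)] submodule.smult_closed[OF W' _ yc(1), of "d / c"] by simp
        moreover have "q \<in> U" unfolding q_def
          using submodule_minus[OF Suc.prems(3) x] submodule.smult_closed[OF Suc.prems(3) _ u(1), of "d / c"] by simp
        ultimately have "q \<in> span v' {..<Suc k}" using inc by blast
        moreover have "(d / c) \<odot> u \<in> span v' {..<Suc k}" by (rule submodule.smult_closed[OF sub' _ uin]) simp
        moreover have "x = q \<oplus> (d / c) \<odot> u" unfolding q_def using x Uc du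
          by (simp add: M.minus_eq M.a_assoc M.l_neg subset_iff)
        ultimately show "x \<in> span v' {..<Suc k}" using submoduleE(5)[OF sub'] by simp
      qed
    qed
    then have sk: "spanned_by U (Suc k)" unfolding spanned_by_def using v' by blast
    have "Suc k < Suc n" if "U \<noteq> W"
    proof -
      have "U \<inter> W' \<noteq> W'"
      proof
        assume "U \<inter> W' = W'"
        then have "y \<in> U" using yc by blast
        then have "c \<odot> w n \<in> U" using add_mem_iff[OF Suc.prems(3), of y "c \<odot> w n"] u yc wc[of n] by simp
        then have "w n \<in> U" using smult_mem_iff[OF Suc.prems(3) \<open>c \<noteq> 0\<close>] wc[of n] by simp
        moreover have "w i \<in> U" if "i < n" for i
          using lin_span_base[OF wn, of i] that \<open>U \<inter> W' = W'\<close> unfolding W'_def by blast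
        ultimately have "W \<subseteq> U" unfolding w(2)
          by (intro lin_span_least[OF Suc.prems(3)]) (auto simp: less_Suc_eq)
        then show False using that Suc.prems(4) by auto
      qed
      then show ?thesis using k by auto
    qed
    then show ?thesis using sk k by (intro exI[of _ "Suc k"]) auto
  qed
qed

abbreviation lin_on :: "nat \<Rightarrow> ((nat \<Rightarrow> complex) \<Rightarrow> 'v) \<Rightarrow> bool" where
  "lin_on n \<equiv> linear_map (cspace n) V"

definition dim_is :: "'v set \<Rightarrow> nat \<Rightarrow> bool" where
  "dim_is W n \<longleftrightarrow> (\<exists>f. lin_on n f \<and> bij_betw f (carrier (cspace n)) W)"

lemma has_dim_iff: "has_dim (V\<lparr>carrier := W\<rparr>) n \<longleftrightarrow> dim_is W n" if "W \<subseteq> carrier V"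
proof
  assume "has_dim (V\<lparr>carrier := W\<rparr>) n"
  then obtain f where f: "f \<in> lin_maps (cspace n) (V\<lparr>carrier := W\<rparr>)" "bij_betw f (carrier (cspace n)) W"
    by (auto simp: has_dim_def)
  then have "lin_on n f" using that unfolding linear_map_def lin_maps_def by (auto simp: PiE_iff)
  then show "dim_is W n" using f by (auto simp: dim_is_def)
next
  assume "dim_is W n"
  then obtain f where f: "lin_on n f" "bij_betw f (carrier (cspace n)) W" by (auto simp: dim_is_def)
  have "restrict f (carrier (cspace n)) \<in> lin_maps (cspace n) (V\<lparr>carrier := W\<rparr>)"
    using f unfolding linear_map_def lin_maps_def bij_betw_def by (auto simp: cspace_closed)
  moreover have "bij_betw (restrict f (carrier (cspace n))) (carrier (cspace n)) (carrier (V\<lparr>carrier := W\<rparr>))"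
    using f(2) by (subst bij_betw_cong[of _ _ f]) auto
  ultimately show "has_dim (V\<lparr>carrier := W\<rparr>) n" unfolding has_dim_def
    by (rule bexI[where x = "restrict f (carrier (cspace n))", rotated])
qed

lemmas lin_on_closed = linear_mapD(1)[of "cspace n" V for n]
  and lin_on_add = linear_mapD(2)[of "cspace n" V for n, unfolded cspace_simps]
  and lin_on_smult = linear_mapD(3)[of "cspace n" V for n, unfolded cspace_simps]

lemma lin_on_Suc: "lin_on (Suc n) f \<Longrightarrow> lin_on n f"
  unfolding linear_map_def by (auto simp: Pi_iff cspace_carrier)

lemma lin_on_zero: "lin_on n f \<Longrightarrow> f (\<lambda>_. 0) = \<zero>"
  using linear_map_zero[OF module_cspace module_axioms] by simp

lemma lin_on_image_submodule: "lin_on n f \<Longrightarrow> submodule (f ` carrier (cspace n)) CC V"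
  by (rule linear_image_submodule[OF module_cspace module_axioms _ module.carrier_is_submodule[OF module_cspace]])

lemma lin_on_decompose:
  assumes f: "lin_on (Suc n) f" and x: "x \<in> carrier (cspace (Suc n))"
  shows "f x = f (x(n := 0)) \<oplus> x n \<odot> f ((\<lambda>_. 0)(n := 1))"
proof -
  let ?e = "(\<lambda>_. 0)(n := 1) :: nat \<Rightarrow> complex"
  have 1: "x = (\<lambda>i. (x(n := 0)) i + (\<lambda>i. x n * ?e i) i)" by auto
  have e: "?e \<in> carrier (cspace (Suc n))" "(\<lambda>i. x n * ?e i) \<in> carrier (cspace (Suc n))"
    "x(n := 0) \<in> carrier (cspace (Suc n))" using x by (auto simp: cspace_carrier)
  have "f x = f (x(n := 0)) \<oplus> f (\<lambda>i. x n * ?e i)"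
    by (subst 1) (rule lin_on_add[OF f e(3,2)])
  then show ?thesis unfolding lin_on_smult[OF f e(1)] .
qed

lemma truncate_cspace: "x \<in> carrier (cspace (Suc n)) \<Longrightarrow> x(n := 0) \<in> carrier (cspace n)"
  by (auto simp: cspace_carrier Suc_le_eq)

lemma lin_on_image_spanned:
  assumes "lin_on n f" shows "spanned_by (f ` carrier (cspace n)) n"
proof -
  define w where "w = (\<lambda>k. f ((\<lambda>_. 0)(k := 1)))"
  have w: "w \<in> {..<n} \<rightarrow> f ` carrier (cspace n)" by (auto simp: w_def cspace_carrier)
  have wc: "w \<in> {..<n} \<rightarrow> carrier V"
    by (auto simp: w_def cspace_carrier intro!: lin_on_closed[OF assms])
  have "f ` carrier (cspace n) \<subseteq> span w {..<n}" using assms wc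
  proof (induction n)
    case 0
    have "carrier (cspace 0) = {\<lambda>_. 0}" by (auto simp: cspace_carrier)
    then show ?case using lin_on_zero[OF 0(1)] by (simp add: lin_span_empty)
  next
    case (Suc n)
    note sub = submodule_lin_span[OF Suc.prems(2)]
    show ?case
    proof
      fix y assume "y \<in> f ` carrier (cspace (Suc n))"
      then obtain x where x: "x \<in> carrier (cspace (Suc n))" "y = f x" by blast
      have "x(n := 0) \<in> carrier (cspace n)" by (rule truncate_cspace[OF x(1)])
      moreover have "w \<in> {..<n} \<rightarrow> carrier V" using Suc.prems(2) by auto
      ultimately have "f (x(n := 0)) \<in> span w {..<n}" using Suc.IH[OF lin_on_Suc[OF Suc.prems(1)]] by blast
      then have "f (x(n := 0)) \<in> span w {..<Suc n}" using lin_span_mono[of "{..<n}" "{..<Suc n}"] by auto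
      moreover have "x n \<odot> w n \<in> span w {..<Suc n}"
        using submodule.smult_closed[OF sub] lin_span_base[OF Suc.prems(2), of n] by simp
      ultimately have "f (x(n := 0)) \<oplus> x n \<odot> w n \<in> span w {..<Suc n}" by (rule submoduleE(5)[OF sub])
      then show "y \<in> span w {..<Suc n}"
        unfolding x(2) lin_on_decompose[OF Suc.prems(1) x(1)] w_def .
    qed
  qed
  moreover have "span w {..<n} \<subseteq> f ` carrier (cspace n)"
    using w by (intro lin_span_least[OF lin_on_image_submodule[OF assms]]) auto
  ultimately show ?thesis unfolding spanned_by_def using w by blast
qed

text \<open>The image of a smaller standard space is a proper subspace of the image of a larger one, and
  each proper inclusion lowers the number of generators.\<close>

lemma spanned_by_lower_bound:
  assumes "lin_on n f" "inj_on f (carrier (cspace n))" "spanned_by (f ` carrier (cspace n)) k"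
  shows "n \<le> k"
  using assms
proof (induction n arbitrary: k)
  case (Suc n)
  let ?U = "f ` carrier (cspace n)" and ?W = "f ` carrier (cspace (Suc n))"
  have sub: "carrier (cspace n) \<subseteq> carrier (cspace (Suc n))" by (auto simp: cspace_carrier)
  note f' = lin_on_Suc[OF Suc.prems(1)]
  define e :: "nat \<Rightarrow> complex" where "e = (\<lambda>_. 0)(n := 1)"
  have e: "e \<in> carrier (cspace (Suc n))" "e \<notin> carrier (cspace n)" by (auto simp: e_def cspace_carrier)
  have "f e \<notin> ?U" using e sub Suc.prems(2) by (simp add: inj_on_image_mem_iff)
  then have "?U \<noteq> ?W" using e by auto
  from spanned_by_subspace[OF Suc.prems(3) lin_on_image_submodule[OF Suc.prems(1)]
      lin_on_image_submodule[OF f'] image_mono[OF sub]] this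
  obtain k' where "k' < k" "spanned_by ?U k'" by auto
  moreover from this have "n \<le> k'" using Suc.IH[OF f'] inj_on_subset[OF Suc.prems(2) sub] by blast
  ultimately show ?case by simp
qed simp

lemma dim_is_spanned: "dim_is W n \<Longrightarrow> spanned_by W n"
  unfolding dim_is_def bij_betw_def using lin_on_image_spanned by blast

lemma dim_is_le_spanned: "dim_is W n \<Longrightarrow> spanned_by W k \<Longrightarrow> n \<le> k"
  unfolding dim_is_def bij_betw_def using spanned_by_lower_bound by blast

lemma dim_is_unique: "dim_is W n \<Longrightarrow> dim_is W k \<Longrightarrow> n = k"
  using dim_is_le_spanned dim_is_spanned by (meson le_antisym)

text \<open>The last generator is either redundant or supplies one more coordinate.\<close>

lemma spanned_by_dim:
  assumes "spanned_by W k" "W \<subseteq> carrier V" shows "\<exists>n\<le>k. dim_is W n"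
  using assms
proof (induction k arbitrary: W)
  case 0
  then have W: "W = {\<zero>}" by (auto simp: spanned_by_def lin_span_empty)
  have "carrier (cspace 0) = {\<lambda>_. 0}" by (auto simp: cspace_carrier)
  then have "lin_on 0 (\<lambda>_. \<zero>)" "bij_betw (\<lambda>_. \<zero>) (carrier (cspace 0)) W"
    unfolding linear_map_def W by (auto simp: bij_betw_def)
  then show ?case by (auto simp: dim_is_def)
next
  case (Suc k)
  obtain w where w: "w \<in> {..<Suc k} \<rightarrow> W" "W = span w {..<Suc k}"
    using Suc.prems(1) by (auto simp: spanned_by_def)
  have wc: "w \<in> {..<Suc k} \<rightarrow> carrier V" using w(1) Suc.prems(2) by auto
  then have wS: "w \<in> insert k {..<k} \<rightarrow> carrier V" and wk: "w \<in> {..<k} \<rightarrow> carrier V"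
    and wkV: "w k \<in> carrier V" by auto
  define W' where "W' = span w {..<k}"
  have W': "submodule W' CC V" unfolding W'_def by (rule submodule_lin_span[OF wk])
  have W'c: "W' \<subseteq> carrier V" by (rule submoduleE(1)[OF W'])
  have Ws: "submodule W CC V" unfolding w(2) by (rule submodule_lin_span[OF wc])
  have W'W: "W' \<subseteq> W" unfolding W'_def w(2) by (rule lin_span_mono) auto
  have wkW: "w k \<in> W" using w by auto
  have "spanned_by W' k" unfolding spanned_by_def W'_def using lin_span_base[OF wk] by blast
  then obtain n where n: "n \<le> k" "dim_is W' n" using Suc.IH[OF _ W'c] by blast
  have dec: "\<exists>y\<in>W'. \<exists>c. x = y \<oplus> c \<odot> w k" if "x \<in> W" for x
    using lin_span_insert[OF wS, of x] that unfolding w(2) W'_def by (auto simp: lessThan_Suc)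
  show ?case
  proof (cases "w k \<in> W'")
    case True
    have "W \<subseteq> W'"
    proof
      fix x assume "x \<in> W"
      then obtain y c where "y \<in> W'" "x = y \<oplus> c \<odot> w k" using dec by blast
      then show "x \<in> W'" using submoduleE(5)[OF W'] submodule.smult_closed[OF W' _ True, of c] by simp
    qed
    then have "W = W'" using W'W by simp
    then show ?thesis using n le_SucI by blast
  next
    case False
    obtain f where f: "lin_on n f" "bij_betw f (carrier (cspace n)) W'" using n by (auto simp: dim_is_def)
    define t where "t = (\<lambda>x::nat \<Rightarrow> complex. x(n := 0))"
    have t: "t x \<in> carrier (cspace n)" if "x \<in> carrier (cspace (Suc n))" for x
      unfolding t_def by (rule truncate_cspace[OF that])
    have ft: "f (t x) \<in> W'" if "x \<in> carrier (cspace (Suc n))" for x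
      using t[OF that] f(2) by (auto simp: bij_betw_def)
    define h where "h = (\<lambda>x. f (t x) \<oplus> x n \<odot> w k)"
    have ftV: "f (t x) \<in> carrier V" if "x \<in> carrier (cspace (Suc n))" for x using ft[OF that] W'c by blast
    have lin: "lin_on (Suc n) h"
      unfolding linear_map_def cspace_simps
    proof (intro conjI ballI allI)
      show "h \<in> carrier (cspace (Suc n)) \<rightarrow> carrier V" unfolding h_def using ftV wkV by auto
      fix x assume x: "x \<in> carrier (cspace (Suc n))"
      have cx: "t (\<lambda>i. c * x i) = (\<lambda>i. c * t x i)" for c by (auto simp: t_def)
      show "h (\<lambda>i. c * x i) = c \<odot> h x" for c
      proof -
        have "f (t (\<lambda>i. c * x i)) = c \<odot> f (t x)" unfolding cx by (rule lin_on_smult[OF f(1) t[OF x]])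
        then show ?thesis unfolding h_def using ftV[OF x] wkV smult_assoc1[of c "x n" "w k"]
          by (simp add: smult_r_distr)
      qed
      fix y assume y: "y \<in> carrier (cspace (Suc n))"
      have "t (\<lambda>i. x i + y i) = (\<lambda>i. t x i + t y i)" by (auto simp: t_def)
      then have "f (t (\<lambda>i. x i + y i)) = f (t x) \<oplus> f (t y)" using lin_on_add[OF f(1) t[OF x] t[OF y]] by simp
      then show "h (\<lambda>i. x i + y i) = h x \<oplus> h y"
        unfolding h_def using ftV[OF x] ftV[OF y] wkV smult_l_distr[of "x n" "y n" "w k"]
        by (simp add: M.a_ac)
    qed
    have inj: "inj_on h (carrier (cspace (Suc n)))"
    proof (rule inj_onI)
      fix x y assume x: "x \<in> carrier (cspace (Suc n))" and y: "y \<in> carrier (cspace (Suc n))" and eq: "h x = h y"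
      have "x n = y n"
      proof (rule ccontr)
        assume ne: "x n \<noteq> y n"
        have "h x \<ominus> (f (t y) \<oplus> x n \<odot> w k) = f (t x) \<ominus> f (t y)"
          unfolding h_def using ftV[OF x] ftV[OF y] wkV by (simp add: M.minus_eq M.minus_add M.a_ac M.r_neg M.r_neg1 M.r_neg2)
        moreover have "h y \<ominus> (f (t y) \<oplus> x n \<odot> w k) = (y n - x n) \<odot> w k"
        proof -
          have "h y = f (t y) \<oplus> x n \<odot> w k \<oplus> (y n - x n) \<odot> w k"
            unfolding h_def using ftV[OF y] wkV smult_l_distr[of "x n" "y n - x n" "w k"] by (simp add: M.a_assoc)
          then show ?thesis using ftV[OF y] wkV by (simp add: M.minus_eq M.minus_add M.a_ac M.r_neg M.r_neg1 M.r_neg2)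
        qed
        ultimately have "(y n - x n) \<odot> w k \<in> W'" using eq submodule_minus[OF W' ft[OF x] ft[OF y]] by simp
        then show False using smult_mem_iff[OF W', of "y n - x n" "w k"] ne wkV False by simp
      qed
      then have "f (t x) = f (t y)" using eq ftV[OF x] ftV[OF y] wkV by (simp add: h_def)
      then have "t x = t y" using f(2) t[OF x] t[OF y] by (auto simp: bij_betw_def inj_on_def)
      then show "x = y" using \<open>x n = y n\<close> unfolding t_def by (metis fun_upd_triv fun_upd_upd)
    qed
    have "h ` carrier (cspace (Suc n)) = W"
    proof
      show "h ` carrier (cspace (Suc n)) \<subseteq> W"
        using ft W'W submoduleE(5)[OF Ws] submodule.smult_closed[OF Ws _ wkW] by (auto simp: h_def subset_iff)
      show "W \<subseteq> h ` carrier (cspace (Suc n))"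
      proof
        fix x assume "x \<in> W"
        then obtain y c where y: "y \<in> W'" "x = y \<oplus> c \<odot> w k" using dec by blast
        then obtain a where a: "a \<in> carrier (cspace n)" "y = f a" using f(2) by (auto simp: bij_betw_def)
        have "t (a(n := c)) = a" using a by (auto simp: t_def cspace_carrier)
        then show "x \<in> h ` carrier (cspace (Suc n))" using y a
          by (intro image_eqI[of _ _ "a(n := c)"]) (auto simp: h_def cspace_carrier)
      qed
    qed
    then have "dim_is W (Suc n)" unfolding dim_is_def bij_betw_def using lin inj by blast
    then show ?thesis using n by auto
  qed
qed

lemma vdim_eq_iff:
  assumes "W \<subseteq> carrier V" shows "vdim (V\<lparr>carrier := W\<rparr>) = enat n \<longleftrightarrow> dim_is W n"
proof -
  have *: "has_dim (V\<lparr>carrier := W\<rparr>) k \<longleftrightarrow> dim_is W k" for k by (rule has_dim_iff[OF assms])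
  show ?thesis
  proof (cases "\<exists>k. dim_is W k")
    case True
    then obtain k where k: "dim_is W k" by blast
    then have "(THE n. dim_is W n) = k" using dim_is_unique by blast
    then have "vdim (V\<lparr>carrier := W\<rparr>) = enat k" unfolding vdim_def * using k by auto
    then show ?thesis using k dim_is_unique by auto
  qed (auto simp: vdim_def *)
qed

lemma vdim_carrier_eq_iff: "vdim V = enat n \<longleftrightarrow> dim_is (carrier V) n"
  using vdim_eq_iff[of "carrier V"] by simp

lemma vdim_submodule:
  assumes "vdim V = enat n" and W: "submodule W CC V"
  shows "\<exists>k\<le>n. vdim (V\<lparr>carrier := W\<rparr>) = enat k \<and> (k = n \<longrightarrow> W = carrier V)"
proof -
  have d: "dim_is (carrier V) n" using assms(1) by (simp add: vdim_carrier_eq_iff)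
  obtain j where j: "j \<le> n" "spanned_by W j" "W \<noteq> carrier V \<Longrightarrow> j < n"
    using spanned_by_subspace[OF dim_is_spanned[OF d] carrier_is_submodule W submoduleE(1)[OF W]] by blast
  obtain k where k: "k \<le> j" "dim_is W k" using spanned_by_dim[OF j(2) submoduleE(1)[OF W]] by blast
  have "k \<le> n" using k j by simp
  moreover have "vdim (V\<lparr>carrier := W\<rparr>) = enat k" using k(2) vdim_eq_iff[OF submoduleE(1)[OF W]] by blast
  moreover have "W = carrier V" if "k = n" using that k(1) j(1,3) by linarith
  ultimately show ?thesis by blast
qed

lemma zero_dim: "dim_is {\<zero>} n \<Longrightarrow> n = 0"
  using dim_is_le_spanned[of "{\<zero>}" n 0] by (auto simp: spanned_by_def lin_span_empty)

end

section \<open>Rational representations\<close>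

lemma (in module) finsum_lessThan_Suc:
  "f \<in> {..<Suc n} \<rightarrow> carrier M \<Longrightarrow> (\<Oplus>\<^bsub>M\<^esub>i\<in>{..<Suc n}. f i) = (\<Oplus>\<^bsub>M\<^esub>i\<in>{..<n}. f i) \<oplus>\<^bsub>M\<^esub> f n"
proof -
  assume f: "f \<in> {..<Suc n} \<rightarrow> carrier M"
  then have "(\<Oplus>\<^bsub>M\<^esub>i\<in>{..<Suc n}. f i) = f n \<oplus>\<^bsub>M\<^esub> (\<Oplus>\<^bsub>M\<^esub>i\<in>{..<n}. f i)"
    unfolding lessThan_Suc by (intro M.finsum_insert) auto
  moreover have "(\<Oplus>\<^bsub>M\<^esub>i\<in>{..<n}. f i) \<in> carrier M" using f by (intro M.finsum_closed) auto
  ultimately show ?thesis using f by (simp add: M.a_comm Pi_iff)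
qed

lemma g_moduleD:
  assumes "g_module G V act" "g \<in> carrier G"
  shows "v \<in> carrier V \<Longrightarrow> act g v \<in> carrier V"
    "v \<in> carrier V \<Longrightarrow> w \<in> carrier V \<Longrightarrow> act g (v \<oplus>\<^bsub>V\<^esub> w) = act g v \<oplus>\<^bsub>V\<^esub> act g w"
    "v \<in> carrier V \<Longrightarrow> act g (c \<odot>\<^bsub>V\<^esub> v) = c \<odot>\<^bsub>V\<^esub> act g v"
proof -
  interpret V: module CC V using assms(1) by (simp add: g_module_def)
  have r: "restrict (act g) (carrier V) \<in> lin_maps V V" using assms by (simp add: g_module_def)
  show c: "v \<in> carrier V \<Longrightarrow> act g v \<in> carrier V" for v
    using r by (auto simp: lin_maps_def PiE_iff)
  show "v \<in> carrier V \<Longrightarrow> w \<in> carrier V \<Longrightarrow> act g (v \<oplus>\<^bsub>V\<^esub> w) = act g v \<oplus>\<^bsub>V\<^esub> act g w"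
    using r by (auto simp: lin_maps_def)
  assume v: "v \<in> carrier V"
  have "restrict (act g) (carrier V) (c \<odot>\<^bsub>V\<^esub> v) = c \<odot>\<^bsub>V\<^esub> restrict (act g) (carrier V) v"
    using r v by (auto simp: lin_maps_def)
  then show "act g (c \<odot>\<^bsub>V\<^esub> v) = c \<odot>\<^bsub>V\<^esub> act g v" using v by simp
qed

lemma g_module_linear: "g_module G V act \<Longrightarrow> g \<in> carrier G \<Longrightarrow> linear_map V V (act g)"
  unfolding linear_map_def using g_moduleD[of G V act g] by auto

lemma g_moduleI:
  assumes "module CC V"
    and "\<And>g v. g \<in> carrier G \<Longrightarrow> v \<in> carrier V \<Longrightarrow> act g v \<in> carrier V"
    and "\<And>g v w. g \<in> carrier G \<Longrightarrow> v \<in> carrier V \<Longrightarrow> w \<in> carrier V \<Longrightarrow> act g (v \<oplus>\<^bsub>V\<^esub> w) = act g v \<oplus>\<^bsub>V\<^esub> act g w"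
    and "\<And>g v c. g \<in> carrier G \<Longrightarrow> v \<in> carrier V \<Longrightarrow> act g (c \<odot>\<^bsub>V\<^esub> v) = c \<odot>\<^bsub>V\<^esub> act g v"
    and "\<And>v. v \<in> carrier V \<Longrightarrow> act \<one>\<^bsub>G\<^esub> v = v"
    and "\<And>g h v. g \<in> carrier G \<Longrightarrow> h \<in> carrier G \<Longrightarrow> v \<in> carrier V \<Longrightarrow> act (g \<otimes>\<^bsub>G\<^esub> h) v = act g (act h v)"
  shows "g_module G V act"
proof -
  interpret V: module CC V by fact
  have "restrict (act g) (carrier V) \<in> lin_maps V V" if g: "g \<in> carrier G" for g
    unfolding lin_maps_def using assms(2-4)[OF g] by auto
  then show ?thesis using assms by (simp add: g_module_def)
qed

lemma g_module_module: "g_module G V act \<Longrightarrow> module CC V"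
  by (simp add: g_module_def)

lemma rational_g_module: "rational_module G V act \<Longrightarrow> g_module G V act"
  by (simp add: rational_module_def)

lemma hom_G_iff: "f \<in> carrier (hom_G G V a W b) \<longleftrightarrow> f \<in> carrier V \<rightarrow>\<^sub>E carrier W \<and>
   (\<forall>x\<in>carrier V. \<forall>y\<in>carrier V. f (x \<oplus>\<^bsub>V\<^esub> y) = f x \<oplus>\<^bsub>W\<^esub> f y) \<and>
   (\<forall>c. \<forall>x\<in>carrier V. f (c \<odot>\<^bsub>V\<^esub> x) = c \<odot>\<^bsub>W\<^esub> f x) \<and>
   (\<forall>g\<in>carrier G. \<forall>v\<in>carrier V. f (a g v) = b g (f v))"
  by (auto simp: hom_G_def lin_maps_def)

lemma hom_G_simps: "\<zero>\<^bsub>hom_G G V a W b\<^esub> = (\<lambda>v\<in>carrier V. \<zero>\<^bsub>W\<^esub>)"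
  "f \<oplus>\<^bsub>hom_G G V a W b\<^esub> h = (\<lambda>v\<in>carrier V. f v \<oplus>\<^bsub>W\<^esub> h v)"
  "c \<odot>\<^bsub>hom_G G V a W b\<^esub> f = (\<lambda>v\<in>carrier V. c \<odot>\<^bsub>W\<^esub> f v)"
  by (simp_all add: hom_G_def)

lemma hom_GD:
  assumes "f \<in> carrier (hom_G G V a W b)"
  shows "v \<in> carrier V \<Longrightarrow> f v \<in> carrier W"
    "v \<in> carrier V \<Longrightarrow> w \<in> carrier V \<Longrightarrow> f (v \<oplus>\<^bsub>V\<^esub> w) = f v \<oplus>\<^bsub>W\<^esub> f w"
    "v \<in> carrier V \<Longrightarrow> f (c \<odot>\<^bsub>V\<^esub> v) = c \<odot>\<^bsub>W\<^esub> f v"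
    "g \<in> carrier G \<Longrightarrow> v \<in> carrier V \<Longrightarrow> f (a g v) = b g (f v)"
    "v \<notin> carrier V \<Longrightarrow> f v = undefined"
  using assms unfolding hom_G_iff by (auto simp: PiE_iff extensional_def)

lemma module_hom_G:
  assumes V: "g_module G V a" and W: "g_module G W b"
  shows "module CC (hom_G G V a W b)"
proof -
  let ?H = "hom_G G V a W b"
  interpret V: module CC V by (rule g_module_module[OF V])
  interpret W: module CC W by (rule g_module_module[OF W])
  have closed: "f \<oplus>\<^bsub>?H\<^esub> h \<in> carrier ?H" if f: "f \<in> carrier ?H" and h: "h \<in> carrier ?H" for f h
    unfolding hom_G_iff hom_G_simps
    using hom_GD(1-4)[OF f] hom_GD(1-4)[OF h] g_moduleD[OF V] g_moduleD[OF W]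
    by (auto simp: W.M.a_ac W.smult_r_distr)
  have zero: "\<zero>\<^bsub>?H\<^esub> \<in> carrier ?H"
  proof -
    have "b g \<zero>\<^bsub>W\<^esub> = \<zero>\<^bsub>W\<^esub>" if "g \<in> carrier G" for g
      by (rule linear_map_zero[OF W.module_axioms W.module_axioms g_module_linear[OF W that]])
    then show ?thesis unfolding hom_G_iff hom_G_simps using g_moduleD[OF V] by auto
  qed
  have smult: "c \<odot>\<^bsub>?H\<^esub> f \<in> carrier ?H" if f: "f \<in> carrier ?H" for c f
    unfolding hom_G_iff hom_G_simps
    using hom_GD(1-4)[OF f] g_moduleD[OF V] g_moduleD[OF W]
    by (auto simp: W.smult_r_distr mult.commute simp flip: W.smult_assoc1[simplified])
  have ext: "f = h" if "f \<in> carrier ?H" "h \<in> carrier ?H" "\<And>v. v \<in> carrier V \<Longrightarrow> f v = h v" for f h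
    using that hom_GD(5)[OF that(1)] hom_GD(5)[OF that(2)] by (metis ext)
  have e: "f v \<in> carrier W" if "f \<in> carrier ?H" "v \<in> carrier V" for f v using hom_GD(1)[OF that] .
  show ?thesis
  proof (rule moduleI[OF cring_CC], rule abelian_groupI)
    show "\<exists>h\<in>carrier ?H. h \<oplus>\<^bsub>?H\<^esub> f = \<zero>\<^bsub>?H\<^esub>" if f: "f \<in> carrier ?H" for f
    proof (intro bexI[of _ "(- 1) \<odot>\<^bsub>?H\<^esub> f"] smult f ext closed zero)
      show "((- 1) \<odot>\<^bsub>?H\<^esub> f \<oplus>\<^bsub>?H\<^esub> f) v = \<zero>\<^bsub>?H\<^esub> v" if v: "v \<in> carrier V" for v
        using W.smult_l_minus[of 1 "f v"] W.smult_one[of "f v"] e[OF f v] v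
        by (simp add: hom_G_simps W.M.l_neg)
    qed
  qed ((intro closed zero smult; assumption) |
      (rule ext; ((intro closed zero smult; assumption) | assumption |
        (simp add: e hom_G_simps W.M.a_ac W.smult_r_distr
          W.smult_l_distr[simplified] W.smult_assoc1[simplified] W.smult_one[simplified]))))+
qed

lemma hom_G_restrict_codomain:
  assumes "P \<subseteq> carrier W"
  shows "hom_G G V a (W\<lparr>carrier := P\<rparr>) b =
    (hom_G G V a W b)\<lparr>carrier := {f \<in> carrier (hom_G G V a W b). f ` carrier V \<subseteq> P}\<rparr>"
proof -
  have "lin_maps V (W\<lparr>carrier := P\<rparr>) = {f \<in> lin_maps V W. f ` carrier V \<subseteq> P}"
    using assms by (auto simp: lin_maps_def PiE_iff)
  then show ?thesis unfolding hom_G_def by auto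
qed

lemma submodule_hom_G_restrict:
  assumes V: "g_module G V a" and W: "g_module G W b" and P: "submodule P CC W"
  shows "submodule {f \<in> carrier (hom_G G V a W b). f ` carrier V \<subseteq> P} CC (hom_G G V a W b)"
proof -
  let ?H = "hom_G G V a W b"
  interpret V: module CC V by (rule g_module_module[OF V])
  interpret W: module CC W by (rule g_module_module[OF W])
  interpret H: module CC ?H by (rule module_hom_G[OF V W])
  note PE = W.submoduleE[OF P] W.submodule_zero[OF P]
  show ?thesis
  proof (rule H.submoduleI_smult)
    show "\<zero>\<^bsub>?H\<^esub> \<in> {f \<in> carrier ?H. f ` carrier V \<subseteq> P}"
      using H.M.zero_closed PE by (auto simp: hom_G_simps(1))
    show "f \<oplus>\<^bsub>?H\<^esub> h \<in> {f \<in> carrier ?H. f ` carrier V \<subseteq> P}"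
      if "f \<in> {f \<in> carrier ?H. f ` carrier V \<subseteq> P}" "h \<in> {f \<in> carrier ?H. f ` carrier V \<subseteq> P}" for f h
      using that PE H.M.a_closed[of f h] by (auto simp: hom_G_simps(2) image_subset_iff)
    show "c \<odot>\<^bsub>?H\<^esub> f \<in> {f \<in> carrier ?H. f ` carrier V \<subseteq> P}"
      if "f \<in> {f \<in> carrier ?H. f ` carrier V \<subseteq> P}" for c f
      using that PE H.smult_closed[of c f] by (auto simp: hom_G_simps(3))
  qed auto
qed

lemma reg_fun_lin_comb:
  assumes G: "affine_algebraic_group G" and f: "f \<in> reg_fun G" and h: "h \<in> reg_fun G"
  shows "(\<lambda>x\<in>carrier G. f x + c * h x) \<in> reg_fun G"
proof -
  have "algebra CC (coord_ring G)"
    using G by (simp add: affine_algebraic_group_def finite_type_algebra_def)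
  then interpret C: algebra CC "coord_ring G" .
  have "f \<oplus>\<^bsub>coord_ring G\<^esub> c \<odot>\<^bsub>coord_ring G\<^esub> h \<in> carrier (coord_ring G)"
    using f h by (intro C.M.a_closed C.smult_closed) (auto simp: coord_ring_def)
  also have "f \<oplus>\<^bsub>coord_ring G\<^esub> c \<odot>\<^bsub>coord_ring G\<^esub> h = (\<lambda>x\<in>carrier G. f x + c * h x)"
    by (auto simp: coord_ring_def fun_eq_iff)
  finally have "(\<lambda>x\<in>carrier G. f x + c * h x) \<in> carrier (coord_ring G)" .
  moreover have "carrier (coord_ring G) = reg_fun G" by (simp add: coord_ring_def)
  ultimately show ?thesis by (simp only:)
qed

text \<open>The vectors of a coaction can be taken in every subspace that contains its values: if the last
  coefficient is nonzero at some \<open>g0\<close>, then the value \<open>u\<close> at \<open>g0\<close>, an element of \<open>W\<close>, replaces the last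
  vector, and a shorter coaction with values in \<open>W\<close> remains.\<close>

lemma (in complex_space) coaction_in_submodule:
  assumes G: "affine_algebraic_group G" and W: "submodule W CC V"
    and c: "c \<in> {..<n::nat} \<rightarrow> reg_fun G" and w: "w \<in> {..<n} \<rightarrow> carrier V"
    and inW: "\<And>g. g \<in> carrier G \<Longrightarrow> (\<Oplus>i\<in>{..<n}. c i g \<odot> w i) \<in> W"
  shows "\<exists>m. \<exists>d\<in>{..<m::nat} \<rightarrow> reg_fun G. \<exists>u\<in>{..<m} \<rightarrow> W. \<forall>g\<in>carrier G.
    (\<Oplus>i\<in>{..<n}. c i g \<odot> w i) = (\<Oplus>i\<in>{..<m}. d i g \<odot> u i)"
  using c w inW
proof (induction n arbitrary: c)
  case 0
  show ?case by (intro exI[of _ 0]) auto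
next
  case (Suc n)
  have wV: "w i \<in> carrier V" if "i < Suc n" for i using Suc.prems(2) that by auto
  have cr: "c i \<in> reg_fun G" if "i < Suc n" for i using Suc.prems(1) that by auto
  have split: "(\<Oplus>i\<in>{..<Suc n}. b i \<odot> w i) = (\<Oplus>i\<in>{..<n}. b i \<odot> w i) \<oplus> b n \<odot> w n" for b
    using wV by (intro finsum_lessThan_Suc) auto
  have sumc: "(\<Oplus>i\<in>{..<n}. b i \<odot> w i) \<in> carrier V" for b
    using wV by (intro M.finsum_closed) auto
  have w': "w \<in> {..<n} \<rightarrow> carrier V" using wV by auto
  show ?case
  proof (cases "\<forall>g\<in>carrier G. c n g = 0")
    case True
    have eq: "(\<Oplus>i\<in>{..<Suc n}. c i g \<odot> w i) = (\<Oplus>i\<in>{..<n}. c i g \<odot> w i)"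
      if "g \<in> carrier G" for g
      unfolding split using True that sumc wV[of n] smult_l_null[of "w n"] by simp
    have "c \<in> {..<n} \<rightarrow> reg_fun G" using cr by auto
    from Suc.IH[OF this w'] Suc.prems(3) eq show ?thesis by simp
  next
    case False
    then obtain g0 where g0: "g0 \<in> carrier G" "c n g0 \<noteq> 0" by blast
    define a where "a = c n g0"
    define u where "u = (\<Oplus>i\<in>{..<Suc n}. c i g0 \<odot> w i)"
    have u: "u \<in> W" "u \<in> carrier V" unfolding u_def using Suc.prems(3)[OF g0(1)] submoduleE(1)[OF W] by auto
    define d where "d = (\<lambda>i. \<lambda>x\<in>carrier G. c i x + (- c i g0 / a) * c n x)"
    have d: "d \<in> {..<n} \<rightarrow> reg_fun G" unfolding d_def
      by (intro Pi_I reg_fun_lin_comb[OF G]) (use cr in auto)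
    have key: "(\<Oplus>i\<in>{..<Suc n}. c i g \<odot> w i) =
       (\<Oplus>i\<in>{..<n}. d i g \<odot> w i) \<oplus> (c n g / a) \<odot> u" if g: "g \<in> carrier G" for g
    proof -
      have a0: "a \<noteq> 0" using g0 by (simp add: a_def)
      have 1: "(c n g / a) \<odot> (\<Oplus>i\<in>{..<n}. c i g0 \<odot> w i) =
        (\<Oplus>i\<in>{..<n}. ((c n g / a) * c i g0) \<odot> w i)"
      proof -
        have "(c n g / a) \<odot> (\<Oplus>i\<in>{..<n}. c i g0 \<odot> w i) =
           (\<Oplus>i\<in>{..<n}. (c n g / a) \<odot> (c i g0 \<odot> w i))"
          using wV by (intro finsum_smult_ldistr) auto
        also have "\<dots> = (\<Oplus>i\<in>{..<n}. ((c n g / a) * c i g0) \<odot> w i)"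
          using wV smult_assoc1[of "c n g / a"] by (intro M.finsum_cong') auto
        finally show ?thesis .
      qed
      have 2: "(c n g / a) \<odot> (c n g0 \<odot> w n) = c n g \<odot> w n"
        using smult_assoc1[of "c n g / a" "c n g0" "w n"] wV[of n] a0 by (simp add: a_def)
      have 3: "(c n g / a) \<odot> u = (\<Oplus>i\<in>{..<n}. ((c n g / a) * c i g0) \<odot> w i) \<oplus> c n g \<odot> w n"
        unfolding u_def split 1[symmetric] 2[symmetric]
        using sumc[of "\<lambda>i. c i g0"] wV[of n] by (simp add: smult_r_distr)
      have 4: "(\<Oplus>i\<in>{..<n}. d i g \<odot> w i) \<oplus> (\<Oplus>i\<in>{..<n}. ((c n g / a) * c i g0) \<odot> w i) =
        (\<Oplus>i\<in>{..<n}. c i g \<odot> w i)"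
      proof -
        have "(\<Oplus>i\<in>{..<n}. d i g \<odot> w i) \<oplus> (\<Oplus>i\<in>{..<n}. ((c n g / a) * c i g0) \<odot> w i) =
          (\<Oplus>i\<in>{..<n}. d i g \<odot> w i \<oplus> ((c n g / a) * c i g0) \<odot> w i)"
          using wV by (intro M.finsum_addf[symmetric]) auto
        also have "\<dots> = (\<Oplus>i\<in>{..<n}. c i g \<odot> w i)"
        proof (rule M.finsum_cong')
          fix i assume i: "i \<in> {..<n}"
          have "d i g + (c n g / a) * c i g0 = c i g" using g by (simp add: d_def)
          then show "d i g \<odot> w i \<oplus> ((c n g / a) * c i g0) \<odot> w i = c i g \<odot> w i"
            using smult_l_distr[of "d i g" "(c n g / a) * c i g0" "w i"] wV i by simp
        qed (use wV in auto)
        finally show ?thesis .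
      qed
      show ?thesis unfolding 3 split[of "\<lambda>i. c i g"] 4[symmetric]
        using sumc wV[of n] by (simp add: M.a_assoc)
    qed
    have dW: "(\<Oplus>i\<in>{..<n}. d i g \<odot> w i) \<in> W" if g: "g \<in> carrier G" for g
    proof -
      have cu: "(c n g / a) \<odot> u \<in> W" using submodule.smult_closed[OF W _ u(1)] by simp
      have "(\<Oplus>i\<in>{..<n}. d i g \<odot> w i) \<oplus> (c n g / a) \<odot> u \<in> W"
        using Suc.prems(3)[OF g] key[OF g] by simp
      then have "(c n g / a) \<odot> u \<oplus> (\<Oplus>i\<in>{..<n}. d i g \<odot> w i) \<in> W"
        using sumc[of "\<lambda>i. d i g"] u by (simp add: M.a_comm)
      then show ?thesis using add_mem_iff[OF W cu sumc] by simp
    qed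
    obtain m d' u' where IH: "d' \<in> {..<m::nat} \<rightarrow> reg_fun G" "u' \<in> {..<m} \<rightarrow> W"
      "\<And>g. g \<in> carrier G \<Longrightarrow> (\<Oplus>i\<in>{..<n}. d i g \<odot> w i) = (\<Oplus>i\<in>{..<m}. d' i g \<odot> u' i)"
      using Suc.IH[OF d w' dW] by blast
    \<comment> \<open>The function \<open>c n / a\<close>, written as a sum in order to apply
      \<open>reg_fun_lin_comb\<close>.\<close>
    define e where "e = (\<lambda>x\<in>carrier G. c n x + (1 / a - 1) * c n x)"
    have e: "e \<in> reg_fun G" unfolding e_def by (rule reg_fun_lin_comb[OF G cr cr]) auto
    show ?thesis
    proof (intro exI[of _ "Suc m"] bexI[of _ "d'(m := e)"] bexI[of _ "u'(m := u)"] ballI)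
      show "d'(m := e) \<in> {..<Suc m} \<rightarrow> reg_fun G" using IH e by (auto simp: less_Suc_eq)
      show uu: "u'(m := u) \<in> {..<Suc m} \<rightarrow> W" using IH u by (auto simp: less_Suc_eq)
      fix g assume g: "g \<in> carrier G"
      have u'V: "u' i \<in> carrier V" if "i < m" for i using IH(2) that submoduleE(1)[OF W] by auto
      have "(\<Oplus>i\<in>{..<Suc m}. (d'(m := e)) i g \<odot> (u'(m := u)) i) =
        (\<Oplus>i\<in>{..<m}. (d'(m := e)) i g \<odot> (u'(m := u)) i) \<oplus> e g \<odot> u"
        using u'V u by (subst finsum_lessThan_Suc) (auto simp: less_Suc_eq)
      also have "(\<Oplus>i\<in>{..<m}. (d'(m := e)) i g \<odot> (u'(m := u)) i) = (\<Oplus>i\<in>{..<m}. d' i g \<odot> u' i)"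
        using u'V by (intro M.finsum_cong') auto
      also have "e g = c n g / a" using g by (simp add: e_def algebra_simps)
      finally show "(\<Oplus>i\<in>{..<Suc n}. c i g \<odot> w i) = (\<Oplus>i\<in>{..<Suc m}. (d'(m := e)) i g \<odot> (u'(m := u)) i)"
        using key[OF g] IH(3)[OF g] by simp
    qed
  qed
qed

lemma rational_coaction_in_submodule:
  assumes G: "affine_algebraic_group G" and V: "rational_module G V act" and W: "submodule W CC V"
    and v: "v \<in> carrier V" and orbit: "\<And>g. g \<in> carrier G \<Longrightarrow> act g v \<in> W"
  shows "\<exists>m. \<exists>d\<in>{..<m::nat} \<rightarrow> reg_fun G. \<exists>u\<in>{..<m} \<rightarrow> W. \<forall>g\<in>carrier G.
    act g v = (\<Oplus>\<^bsub>V\<^esub>i\<in>{..<m}. d i g \<odot>\<^bsub>V\<^esub> u i)"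
proof -
  have "\<exists>n. \<exists>c\<in>{..<n::nat} \<rightarrow> reg_fun G. \<exists>w\<in>{..<n} \<rightarrow> carrier V.
        \<forall>g\<in>carrier G. act g v = (\<Oplus>\<^bsub>V\<^esub>i\<in>{..<n}. c i g \<odot>\<^bsub>V\<^esub> w i)"
    using V v by (simp add: rational_module_def)
  then obtain n c w where c: "c \<in> {..<n::nat} \<rightarrow> reg_fun G" "w \<in> {..<n} \<rightarrow> carrier V"
    "\<And>g. g \<in> carrier G \<Longrightarrow> act g v = (\<Oplus>\<^bsub>V\<^esub>i\<in>{..<n}. c i g \<odot>\<^bsub>V\<^esub> w i)" by blast
  have "\<And>g. g \<in> carrier G \<Longrightarrow> (\<Oplus>\<^bsub>V\<^esub>i\<in>{..<n}. c i g \<odot>\<^bsub>V\<^esub> w i) \<in> W" using orbit c(3) by simp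
  from complex_space.coaction_in_submodule[OF _ G W c(1,2) this] c(3) g_module_module[OF rational_g_module[OF V]]
  show ?thesis by (simp add: complex_space_def)
qed

lemma rational_submodule:
  assumes G: "affine_algebraic_group G" and V: "rational_module G V act" and W: "g_submodule G V act W"
  shows "rational_module G (V\<lparr>carrier := W\<rparr>) act"
proof -
  note gV = rational_g_module[OF V]
  interpret V: module CC V by (rule g_module_module[OF gV])
  have sub: "submodule W CC V" and stable: "\<And>g v. g \<in> carrier G \<Longrightarrow> v \<in> W \<Longrightarrow> act g v \<in> W"
    using W by (auto simp: g_submodule_def)
  note WV = V.submoduleE(1)[OF sub]
  have WVd: "v \<in> carrier V" if "v \<in> W" for v using WV that by blast
  have mW: "module CC (V\<lparr>carrier := W\<rparr>)" by (rule submodule.submodule_is_module[OF sub V.module_axioms])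
  have "g_module G (V\<lparr>carrier := W\<rparr>) act"
    by (rule g_moduleI[OF mW])
      (use gV stable WVd in \<open>auto simp: g_moduleD(2,3)[OF gV] g_module_def\<close>)
  moreover have "\<exists>n. \<exists>c\<in>{..<n::nat} \<rightarrow> reg_fun G. \<exists>w\<in>{..<n} \<rightarrow> W.
        \<forall>g\<in>carrier G. act g v = (\<Oplus>\<^bsub>V\<lparr>carrier := W\<rparr>\<^esub>i\<in>{..<n}. c i g \<odot>\<^bsub>V\<^esub> w i)" if v: "v \<in> W" for v
  proof -
    obtain m d u where m: "d \<in> {..<m::nat} \<rightarrow> reg_fun G" "u \<in> {..<m} \<rightarrow> W"
      "\<And>g. g \<in> carrier G \<Longrightarrow> act g v = (\<Oplus>\<^bsub>V\<^esub>i\<in>{..<m}. d i g \<odot>\<^bsub>V\<^esub> u i)"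
      using rational_coaction_in_submodule[OF G V sub WVd[OF v] stable[OF _ v]] by blast
    have "(\<Oplus>\<^bsub>V\<lparr>carrier := W\<rparr>\<^esub>i\<in>{..<m}. d i g \<odot>\<^bsub>V\<^esub> u i) = (\<Oplus>\<^bsub>V\<^esub>i\<in>{..<m}. d i g \<odot>\<^bsub>V\<^esub> u i)" for g
      using m(2) submodule.smult_closed[OF sub]
      by (intro finsum_restrict_carrier V.abelian_group_axioms WV module.axioms(2)[OF mW]) auto
    then show ?thesis using m by (intro exI[of _ m] bexI[of _ d] bexI[of _ u]) auto
  qed
  ultimately show ?thesis by (simp add: rational_module_def)
qed

lemma hom_G_linear_map: "f \<in> carrier (hom_G G V a W b) \<Longrightarrow> linear_map V W f"
  unfolding hom_G_iff linear_map_def by auto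

lemma bij_linear_inverse:
  assumes V: "module CC V" and W: "module CC W" and f: "linear_map V W f"
    and bij: "bij_betw f (carrier V) (carrier W)"
  defines "k \<equiv> the_inv_into (carrier V) f"
  shows "y \<in> carrier W \<Longrightarrow> k y \<in> carrier V" "y \<in> carrier W \<Longrightarrow> f (k y) = y" "x \<in> carrier V \<Longrightarrow> k (f x) = x"
    "y \<in> carrier W \<Longrightarrow> z \<in> carrier W \<Longrightarrow> k (y \<oplus>\<^bsub>W\<^esub> z) = k y \<oplus>\<^bsub>V\<^esub> k z"
    "y \<in> carrier W \<Longrightarrow> k (c \<odot>\<^bsub>W\<^esub> y) = c \<odot>\<^bsub>V\<^esub> k y"
proof -
  interpret V: module CC V by fact
  interpret W: module CC W by fact
  note add = linear_mapD(2)[OF f] and smult = linear_mapD(3)[OF f]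
  have inj: "inj_on f (carrier V)" and im: "f ` carrier V = carrier W" using bij by (auto simp: bij_betw_def)
  show k: "y \<in> carrier W \<Longrightarrow> k y \<in> carrier V" for y
    unfolding k_def using the_inv_into_into[OF inj, of y "carrier V"] im by simp
  show fk: "y \<in> carrier W \<Longrightarrow> f (k y) = y" for y
    unfolding k_def using f_the_inv_into_f[OF inj] im by simp
  show kf: "x \<in> carrier V \<Longrightarrow> k (f x) = x" for x
    unfolding k_def using the_inv_into_f_f[OF inj] by simp
  show "y \<in> carrier W \<Longrightarrow> z \<in> carrier W \<Longrightarrow> k (y \<oplus>\<^bsub>W\<^esub> z) = k y \<oplus>\<^bsub>V\<^esub> k z"
    using kf[of "k y \<oplus>\<^bsub>V\<^esub> k z"] k fk add[of "k y" "k z"] by simp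
  show "y \<in> carrier W \<Longrightarrow> k (c \<odot>\<^bsub>W\<^esub> y) = c \<odot>\<^bsub>V\<^esub> k y"
    using kf[of "c \<odot>\<^bsub>V\<^esub> k y"] k fk smult[of "k y" c] by simp
qed

lemma hom_G_inverse:
  assumes V: "g_module G V a" and W: "g_module G W b"
    and f: "f \<in> carrier (hom_G G V a W b)" and bij: "bij_betw f (carrier V) (carrier W)"
  shows "restrict (the_inv_into (carrier V) f) (carrier W) \<in> carrier (hom_G G W b V a)"
proof -
  interpret V: module CC V by (rule g_module_module[OF V])
  interpret W: module CC W by (rule g_module_module[OF W])
  note inv = bij_linear_inverse[OF V.module_axioms W.module_axioms hom_G_linear_map[OF f] bij]
  have "the_inv_into (carrier V) f (b g y) = a g (the_inv_into (carrier V) f y)"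
    if g: "g \<in> carrier G" and y: "y \<in> carrier W" for g y
  proof -
    have "f (a g (the_inv_into (carrier V) f y)) = b g y"
      using hom_GD(4)[OF f g inv(1)[OF y]] inv(2)[OF y] by simp
    then show ?thesis using inv(3)[OF g_moduleD(1)[OF V g inv(1)[OF y]]] by simp
  qed
  then show ?thesis unfolding hom_G_iff using inv g_moduleD(1)[OF W] by auto
qed

lemma hom_G_comp:
  assumes U: "g_module G U a" and f: "f \<in> carrier (hom_G G U a V b)" and k: "k \<in> carrier (hom_G G V b W c)"
  shows "(\<lambda>x\<in>carrier U. k (f x)) \<in> carrier (hom_G G U a W c)"
proof -
  interpret U: module CC U by (rule g_module_module[OF U])
  show ?thesis unfolding hom_G_iff
    using hom_GD(1-4)[OF f] hom_GD(1-4)[OF k] g_moduleD(1)[OF U] by auto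
qed

lemma hom_G_id:
  assumes U: "g_module G U a" shows "(\<lambda>x\<in>carrier U. x) \<in> carrier (hom_G G U a U a)"
proof -
  interpret U: module CC U by (rule g_module_module[OF U])
  show ?thesis unfolding hom_G_iff using g_moduleD(1)[OF U] by auto
qed

lemma hom_G_image:
  assumes U: "g_module G U a" and V: "g_module G V b" and f: "f \<in> carrier (hom_G G U a V b)"
    and S: "g_submodule G U a S"
  shows "g_submodule G V b (f ` S)"
proof -
  have S': "submodule S CC U" and st: "\<And>g x. g \<in> carrier G \<Longrightarrow> x \<in> S \<Longrightarrow> a g x \<in> S"
    using S by (auto simp: g_submodule_def)
  have SU: "x \<in> carrier U" if "x \<in> S" for x
    using module.submoduleE(1)[OF g_module_module[OF U] S'] that by blast
  have "b g (f x) \<in> f ` S" if "g \<in> carrier G" "x \<in> S" for g x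
    using hom_GD(4)[OF f that(1) SU[OF that(2)]] st[OF that] by (metis imageI)
  then show ?thesis
    using linear_image_submodule[OF g_module_module[OF U] g_module_module[OF V] hom_G_linear_map[OF f] S']
    unfolding g_submodule_def by blast
qed

text \<open>Irreducibility and complete reducibility refer to the standard spaces, so that
  finite-dimensional representations have to be moved there by means of coordinates.\<close>

lemma rational_transport:
  assumes M: "rational_module G M act" and N: "module CC N"
    and lin: "linear_map N M f"
    and bij: "bij_betw f (carrier N) (carrier M)"
    and G: "group G"
  defines "k \<equiv> the_inv_into (carrier N) f"
  shows "rational_module G N (\<lambda>g x. k (act g (f x)))"
    and "restrict f (carrier N) \<in> carrier (hom_G G N (\<lambda>g x. k (act g (f x))) M act)"
proof -
  note gM = rational_g_module[OF M]
  interpret M: module CC M by (rule g_module_module[OF gM])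
  interpret N: module CC N by fact
  interpret G: group G by fact
  note f = linear_mapD[OF lin]
  note inv = bij_linear_inverse[OF N M.module_axioms lin bij, folded k_def]
  note aD = g_moduleD[OF gM]
  have one: "act \<one>\<^bsub>G\<^esub> v = v" if "v \<in> carrier M" for v using gM that by (simp add: g_module_def)
  have mult: "act (g \<otimes>\<^bsub>G\<^esub> h) v = act g (act h v)" if "g \<in> carrier G" "h \<in> carrier G" "v \<in> carrier M" for g h v
    using gM that by (simp add: g_module_def)
  have "g_module G N (\<lambda>g x. k (act g (f x)))"
    by (rule g_moduleI[OF N]) (simp_all add: f inv aD one mult)
  moreover have "\<exists>n. \<exists>c\<in>{..<n::nat} \<rightarrow> reg_fun G. \<exists>w\<in>{..<n} \<rightarrow> carrier N.
        \<forall>g\<in>carrier G. k (act g (f x)) = (\<Oplus>\<^bsub>N\<^esub>i\<in>{..<n}. c i g \<odot>\<^bsub>N\<^esub> w i)" if x: "x \<in> carrier N" for x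
  proof -
    obtain n c w where c: "c \<in> {..<n::nat} \<rightarrow> reg_fun G" "w \<in> {..<n} \<rightarrow> carrier M"
      "\<And>g. g \<in> carrier G \<Longrightarrow> act g (f x) = (\<Oplus>\<^bsub>M\<^esub>i\<in>{..<n}. c i g \<odot>\<^bsub>M\<^esub> w i)"
      using M f(1)[OF x] unfolding rational_module_def by blast
    have "k (act g (f x)) = (\<Oplus>\<^bsub>N\<^esub>i\<in>{..<n}. c i g \<odot>\<^bsub>N\<^esub> k (w i))" if g: "g \<in> carrier G" for g
    proof -
      have "k (act g (f x)) = (\<Oplus>\<^bsub>N\<^esub>i\<in>{..<n}. k (c i g \<odot>\<^bsub>M\<^esub> w i))" unfolding c(3)[OF g]
        using c(2) inv(1,4) by (intro finsum_additive(1)[OF M.abelian_group_axioms N.abelian_group_axioms]) auto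
      also have "\<dots> = (\<Oplus>\<^bsub>N\<^esub>i\<in>{..<n}. c i g \<odot>\<^bsub>N\<^esub> k (w i))"
        using c(2) inv(1,5) by (intro N.M.finsum_cong') (auto simp: Pi_iff)
      finally show ?thesis .
    qed
    moreover have "(\<lambda>i. k (w i)) \<in> {..<n} \<rightarrow> carrier N" using c(2) inv(1) by auto
    ultimately show ?thesis using c(1) by (intro exI[of _ n] bexI[of _ c] bexI[of _ "\<lambda>i. k (w i)"]) auto
  qed
  ultimately show "rational_module G N (\<lambda>g x. k (act g (f x)))" by (simp add: rational_module_def)
  show "restrict f (carrier N) \<in> carrier (hom_G G N (\<lambda>g x. k (act g (f x))) M act)"
    unfolding hom_G_iff using f inv aD by auto
qed

section \<open>Irreducible representations\<close>

lemma irreps_g_module: "(n, a) \<in> irreps G \<Longrightarrow> g_module G (cspace n) a"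
  by (auto simp: irreps_def dest: rational_g_module)

lemma rep_of_Irr:
  assumes "r \<in> irreps G"
  shows "rep_iso G `` {r} \<in> Irr G" "(r, rep_of (rep_iso G `` {r})) \<in> rep_iso G"
proof -
  show "rep_iso G `` {r} \<in> Irr G" unfolding Irr_def using assms by (rule quotientI)
  obtain n a where r: "r = (n, a)" by (cases r)
  have "(\<lambda>x\<in>carrier (cspace n). x) \<in> carrier (hom_G G (cspace n) a (cspace n) a)"
    using hom_G_id irreps_g_module assms r by blast
  moreover have "bij_betw (\<lambda>x\<in>carrier (cspace n). x) (carrier (cspace n)) (carrier (cspace n))"
    by (subst bij_betw_cong[of _ _ "\<lambda>x. x"]) (auto simp: bij_betw_def)
  ultimately have "(r, r) \<in> rep_iso G" unfolding rep_iso_def using assms r by blast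
  then have "r \<in> rep_iso G `` {r}" by (rule ImageI) simp
  then have "rep_of (rep_iso G `` {r}) \<in> rep_iso G `` {r}" unfolding rep_of_def by (rule someI)
  then show "(r, rep_of (rep_iso G `` {r})) \<in> rep_iso G" by blast
qed

lemma rep_of_irreps: assumes "\<rho> \<in> Irr G" shows "rep_of \<rho> \<in> irreps G"
proof -
  obtain r where "r \<in> irreps G" "\<rho> = rep_iso G `` {r}" using assms unfolding Irr_def by (rule quotientE)
  then have "(r, rep_of \<rho>) \<in> rep_iso G" using rep_of_Irr by blast
  then show ?thesis unfolding rep_iso_def by (cases r; cases "rep_of \<rho>") simp
qed

lemma rep_g_module: "\<rho> \<in> Irr G \<Longrightarrow> g_module G (rep_space \<rho>) (rep_act \<rho>)"
  unfolding rep_space_def rep_act_def using rep_of_irreps[of \<rho> G] irreps_g_module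
  by (metis prod.collapse)

lemma irrep_iso_rep:
  assumes "(n, a) \<in> irreps G"
  shows "\<exists>\<rho>\<in>Irr G. \<exists>k\<in>carrier (hom_G G (cspace n) a (rep_space \<rho>) (rep_act \<rho>)).
    bij_betw k (carrier (cspace n)) (carrier (rep_space \<rho>))"
proof -
  let ?\<rho> = "rep_iso G `` {(n, a)}"
  have "((n, a), rep_of ?\<rho>) \<in> rep_iso G" by (rule rep_of_Irr(2)[OF assms])
  then have "\<exists>k\<in>carrier (hom_G G (cspace n) a (rep_space ?\<rho>) (rep_act ?\<rho>)).
    bij_betw k (carrier (cspace n)) (carrier (rep_space ?\<rho>))"
    unfolding rep_iso_def rep_space_def rep_act_def by (cases "rep_of ?\<rho>") auto
  then show ?thesis using rep_of_Irr(1)[OF assms] by blast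
qed

lemma cspace_zero_imp:  "carrier (cspace 0) = {\<zero>\<^bsub>cspace 0\<^esub>}"
  by (auto simp: cspace_carrier)

text \<open>Induction on the dimension: an irreducible \<open>W\<close> is the image of some
  \<open>V\<^sub>\<rho>\<close>, and otherwise \<open>W\<close> is the sum of two proper
  subrepresentations. A submodule \<open>H\<close> that contains all images takes the place of their
  sum.\<close>

lemma finite_dim_submodule_in_image_sum:
  fixes V :: "(complex, 'v, 'x) module_scheme"
  assumes red: "reductive_group G" and V: "rational_module G V act" and H: "submodule H CC V"
    and hom: "\<And>\<rho> f v. \<rho> \<in> Irr G \<Longrightarrow> f \<in> carrier (hom_G G (rep_space \<rho>) (rep_act \<rho>) V act) \<Longrightarrow>
       v \<in> carrier (rep_space \<rho>) \<Longrightarrow> f v \<in> H"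
    and W: "g_submodule G V act W" "complex_space.dim_is V W n"
  shows "W \<subseteq> H"
proof -
  note gV = rational_g_module[OF V]
  have aff: "affine_algebraic_group G" using red by (simp add: reductive_group_def)
  then have grp: "group G" by (simp add: affine_algebraic_group_def)
  interpret complex_space V using g_module_module[OF gV] by (simp add: complex_space_def)
  show ?thesis using W
  proof (induction n arbitrary: W rule: less_induct)
    case (less n)
    have subW: "submodule W CC V" using less.prems(1) by (simp add: g_submodule_def)
    have WV: "W \<subseteq> carrier V" by (rule submoduleE(1)[OF subW])
    obtain f where f: "lin_on n f" "bij_betw f (carrier (cspace n)) W"
      using less.prems(2) unfolding dim_is_def by blast
    let ?W = "V\<lparr>carrier := W\<rparr>"
    have ratW: "rational_module G ?W act" by (rule rational_submodule[OF aff V less.prems(1)])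
    have flin: "linear_map (cspace n) ?W f" unfolding linear_map_def
      using f(2) lin_on_add[OF f(1)] lin_on_smult[OF f(1)] by (auto simp: bij_betw_def)
    have fbij: "bij_betw f (carrier (cspace n)) (carrier ?W)" using f(2) by simp
    define a where "a = (\<lambda>g x. the_inv_into (carrier (cspace n)) f (act g (f x)))"
    have rat: "rational_module G (cspace n) a"
      and fh: "restrict f (carrier (cspace n)) \<in> carrier (hom_G G (cspace n) a ?W act)"
      unfolding a_def by (rule rational_transport[OF ratW module_cspace flin fbij grp])+
    define \<phi> where "\<phi> = restrict f (carrier (cspace n))"
    have \<phi>: "\<phi> \<in> carrier (hom_G G (cspace n) a V act)"
      using fh WV unfolding \<phi>_def hom_G_iff by (auto simp: PiE_iff)
    have \<phi>im: "\<phi> ` carrier (cspace n) = W" using f(2) by (simp add: \<phi>_def bij_betw_def)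
    have \<phi>inj: "inj_on \<phi> (carrier (cspace n))" using f(2) by (simp add: \<phi>_def bij_betw_def)
    note ga = rational_g_module[OF rat]
    interpret C: module CC "cspace n" by (rule module_cspace)
    show "W \<subseteq> H"
    proof (cases "n = 0")
      case True
      have "W = {f (\<lambda>_. 0)}" using \<phi>im True cspace_zero_imp by (auto simp: \<phi>_def)
      then show ?thesis using lin_on_zero[OF f(1)] submodule_zero[OF H] by simp
    next
      case n: False
      show ?thesis
      proof (cases "(n, a) \<in> irreps G")
        case True
        then obtain \<rho> k where k: "\<rho> \<in> Defs.Irr G" "k \<in> carrier (hom_G G (cspace n) a (rep_space \<rho>) (rep_act \<rho>))"
          "bij_betw k (carrier (cspace n)) (carrier (rep_space \<rho>))" using irrep_iso_rep by blast
        note gr = rep_g_module[OF k(1)]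
        define j where "j = restrict (the_inv_into (carrier (cspace n)) k) (carrier (rep_space \<rho>))"
        have j: "j \<in> carrier (hom_G G (rep_space \<rho>) (rep_act \<rho>) (cspace n) a)"
          unfolding j_def by (rule hom_G_inverse[OF ga gr k(2,3)])
        define l where "l = (\<lambda>x\<in>carrier (rep_space \<rho>). \<phi> (j x))"
        have l: "l \<in> carrier (hom_G G (rep_space \<rho>) (rep_act \<rho>) V act)"
          unfolding l_def by (rule hom_G_comp[OF gr j \<phi>])
        show ?thesis
        proof
          fix w assume "w \<in> W"
          then obtain x where x: "x \<in> carrier (cspace n)" "w = \<phi> x" using \<phi>im by blast
          have kx: "k x \<in> carrier (rep_space \<rho>)" by (rule hom_GD(1)[OF k(2) x(1)])
          have "j (k x) = x" using kx k(3) x(1) by (simp add: j_def the_inv_into_f_f bij_betw_def)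
          then have "l (k x) = w" using kx x by (simp add: l_def)
          then show "w \<in> H" using hom[OF k(1) l kx] by simp
        qed
      next
        case False
        then obtain U where U: "g_submodule G (cspace n) a U" "U \<noteq> {\<zero>\<^bsub>cspace n\<^esub>}" "U \<noteq> carrier (cspace n)"
          using rat n unfolding irreps_def by blast
        then obtain U' where U': "g_submodule G (cspace n) a U'" "U \<inter> U' = {\<zero>\<^bsub>cspace n\<^esub>}"
          "U <+>\<^bsub>cspace n\<^esub> U' = carrier (cspace n)"
          using red rat unfolding reductive_group_def by blast
        have Uc: "U \<subseteq> carrier (cspace n)" and U'c: "U' \<subseteq> carrier (cspace n)"
          using U U' C.submoduleE(1) by (auto simp: g_submodule_def)
        have "U' \<noteq> carrier (cspace n)" using U(2) U'(2) Uc by auto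
        have small: "\<phi> ` T \<subseteq> H" if T: "g_submodule G (cspace n) a T" "T \<subseteq> carrier (cspace n)" "T \<noteq> carrier (cspace n)" for T
        proof -
          have gT: "g_submodule G V act (\<phi> ` T)" by (rule hom_G_image[OF ga gV \<phi> T(1)])
          then have sT: "submodule (\<phi> ` T) CC V" by (simp add: g_submodule_def)
          have "\<phi> ` T \<noteq> W" using \<phi>im \<phi>inj T(2,3) by (metis inj_on_image_eq_iff subset_refl)
          moreover have "\<phi> ` T \<subseteq> W" using \<phi>im T(2) by blast
          ultimately obtain k where k: "k < n" "spanned_by (\<phi> ` T) k"
            using spanned_by_subspace[OF dim_is_spanned[OF less.prems(2)] subW sT] by blast
          obtain k' where "k' \<le> k" "dim_is (\<phi> ` T) k'" using spanned_by_dim[OF k(2) submoduleE(1)[OF sT]] by blast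
          then show ?thesis using less.IH[of k' "\<phi> ` T"] gT k by simp
        qed
        show ?thesis
        proof
          fix w assume "w \<in> W"
          then obtain x where x: "x \<in> carrier (cspace n)" "w = \<phi> x" using \<phi>im by blast
          then obtain u u' where u: "u \<in> U" "u' \<in> U'" "x = u \<oplus>\<^bsub>cspace n\<^esub> u'"
            using U'(3) unfolding set_add_def' by blast
          have "w = \<phi> u \<oplus>\<^bsub>V\<^esub> \<phi> u'" unfolding x(2) u(3) using hom_GD(2)[OF \<phi>] u Uc U'c by blast
          moreover have "\<phi> u \<in> H" using small[OF U(1) Uc U(3)] u by blast
          moreover have "\<phi> u' \<in> H" using small[OF U'(1) U'c \<open>U' \<noteq> carrier (cspace n)\<close>] u by blast
          ultimately show "w \<in> H" using submoduleE(5)[OF H] by simp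
        qed
      qed
    qed
  qed
qed

text \<open>Every vector lies in a finite-dimensional subrepresentation, namely the span of its orbit;
  this is spanned by the vectors of the coaction.\<close>

theorem rational_module_is_sum_of_irreducible_images:
  fixes V :: "(complex, 'v, 'x) module_scheme"
  assumes red: "reductive_group G" and V: "rational_module G V act" and H: "submodule H CC V"
    and hom: "\<And>\<rho> f v. \<rho> \<in> Irr G \<Longrightarrow> f \<in> carrier (hom_G G (rep_space \<rho>) (rep_act \<rho>) V act) \<Longrightarrow>
       v \<in> carrier (rep_space \<rho>) \<Longrightarrow> f v \<in> H"
  shows "H = carrier V"
proof -
  note gV = rational_g_module[OF V]
  have aff: "affine_algebraic_group G" using red by (simp add: reductive_group_def)
  then have grp: "group G" by (simp add: affine_algebraic_group_def)
  interpret G: group G by (rule grp)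
  interpret complex_space V using g_module_module[OF gV] by (simp add: complex_space_def)
  have "v \<in> H" if v: "v \<in> carrier V" for v
  proof -
    define W where "W = span (\<lambda>g. act g v) (carrier G)"
    have orb: "(\<lambda>g. act g v) \<in> carrier G \<rightarrow> carrier V" using g_moduleD(1)[OF gV] v by auto
    have W: "submodule W CC V" unfolding W_def by (rule submodule_lin_span[OF orb])
    have in_W: "act g v \<in> W" if "g \<in> carrier G" for g unfolding W_def using lin_span_base[OF orb that] .
    have stable: "act h x \<in> W" if h: "h \<in> carrier G" and x: "x \<in> W" for h x
    proof -
      let ?K = "{x \<in> carrier V. act h x \<in> W}"
      have "submodule ?K CC V"
        by (rule linear_vimage_submodule[OF module_axioms module_axioms g_module_linear[OF gV h] W])
      moreover have "act g v \<in> ?K" if g: "g \<in> carrier G" for g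
      proof -
        have "act h (act g v) = act (h \<otimes>\<^bsub>G\<^esub> g) v" using gV h g v by (simp add: g_module_def)
        then show ?thesis using in_W[of "h \<otimes>\<^bsub>G\<^esub> g"] h g orb by auto
      qed
      ultimately have "W \<subseteq> ?K" unfolding W_def by (intro lin_span_least) auto
      then show ?thesis using x by blast
    qed
    have gW: "g_submodule G V act W" unfolding g_submodule_def using W stable by blast
    obtain m d u where m: "d \<in> {..<m::nat} \<rightarrow> reg_fun G" "u \<in> {..<m} \<rightarrow> W"
      "\<And>g. g \<in> carrier G \<Longrightarrow> act g v = (\<Oplus>\<^bsub>V\<^esub>i\<in>{..<m}. d i g \<odot>\<^bsub>V\<^esub> u i)"
      using rational_coaction_in_submodule[OF aff V W v in_W] by blast
    have WV: "W \<subseteq> carrier V" by (rule submoduleE(1)[OF W])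
    have uV: "u \<in> {..<m} \<rightarrow> carrier V" using m(2) WV by auto
    have "W = span u {..<m}"
    proof
      show "span u {..<m} \<subseteq> W" using m(2) by (intro lin_span_least[OF W]) auto
      show "W \<subseteq> span u {..<m}"
        unfolding W_def
      proof (rule lin_span_least[OF submodule_lin_span[OF uV]])
        fix g assume g: "g \<in> carrier G"
        show "act g v \<in> span u {..<m}" unfolding m(3)[OF g] lin_span_def mem_Collect_eq
            by (intro exI[of _ "{..<m}"] exI[of _ "\<lambda>i. d i g"]) auto
      qed
    qed
    then have "spanned_by W m" unfolding spanned_by_def using m(2) by blast
    then obtain n where n: "dim_is W n" using spanned_by_dim[OF _ WV] by blast
    have "W \<subseteq> H" by (rule finite_dim_submodule_in_image_sum[OF red V H _ gW n]) (rule hom)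
    moreover have "act \<one>\<^bsub>G\<^esub> v = v" using gV v by (simp add: g_module_def)
    ultimately show ?thesis using in_W[OF G.one_closed] by auto
  qed
  then show ?thesis using submoduleE(1)[OF H] by blast
qed

text \<open>One can take the values of a basis of the space of homomorphisms at a basis of \<open>V\<^sub>\<rho>\<close>.\<close>

lemma images_finitely_spanned:
  assumes \<rho>: "\<rho> \<in> Irr G" and V: "g_module G V act"
    and dim: "vdim (hom_G G (rep_space \<rho>) (rep_act \<rho>) V act) = enat k"
  shows "\<exists>S. finite S \<and>
    S \<subseteq> {f v | f v. f \<in> carrier (hom_G G (rep_space \<rho>) (rep_act \<rho>) V act) \<and> v \<in> carrier (rep_space \<rho>)} \<and>
    (\<forall>H. submodule H CC V \<and> S \<subseteq> H \<longrightarrow>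
      {f v | f v. f \<in> carrier (hom_G G (rep_space \<rho>) (rep_act \<rho>) V act) \<and> v \<in> carrier (rep_space \<rho>)} \<subseteq> H)"
proof -
  let ?U = "rep_space \<rho>" and ?a = "rep_act \<rho>"
  let ?M = "hom_G G ?U ?a V act"
  note U = rep_g_module[OF \<rho>]
  interpret V: module CC V by (rule g_module_module[OF V])
  interpret M: complex_space ?M using module_hom_G[OF U V] by (simp add: complex_space_def)
  interpret U: complex_space ?U using g_module_module[OF U] by (simp add: complex_space_def)
  obtain n where n: "?U = cspace n" by (simp add: rep_space_def)
  have "U.lin_on n (\<lambda>x. x)" unfolding linear_map_def n by auto
  then have "U.spanned_by (carrier ?U) n" using U.lin_on_image_spanned[of n "\<lambda>x. x"] n by simp
  then obtain e where e: "e \<in> {..<n} \<rightarrow> carrier ?U" "carrier ?U = U.span e {..<n}"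
    by (auto simp: U.spanned_by_def)
  have "M.spanned_by (carrier ?M) k" using dim M.vdim_carrier_eq_iff M.dim_is_spanned by blast
  then obtain b where b: "b \<in> {..<k} \<rightarrow> carrier ?M" "carrier ?M = M.span b {..<k}"
    by (auto simp: M.spanned_by_def)
  define S where "S = (\<lambda>(i, j). b i (e j)) ` ({..<k} \<times> {..<n})"
  have "f v \<in> H" if H: "submodule H CC V" "S \<subseteq> H" and f: "f \<in> carrier ?M" and v: "v \<in> carrier ?U" for H f v
  proof -
    have bv: "b i v \<in> H" if i: "i < k" for i
    proof -
      have "b i \<in> carrier ?M" using b i by auto
      then have "submodule {v \<in> carrier ?U. b i v \<in> H} CC ?U"
        by (intro linear_vimage_submodule[OF U.module_axioms V.module_axioms _ H(1)] hom_G_linear_map)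
      moreover have "e j \<in> {v \<in> carrier ?U. b i v \<in> H}" if "j \<in> {..<n}" for j
        using that e(1) H(2) i by (auto simp: S_def)
      ultimately have "U.span e {..<n} \<subseteq> {v \<in> carrier ?U. b i v \<in> H}" by (intro U.lin_span_least) auto
      then show ?thesis using v e(2) by blast
    qed
    have "linear_map ?M V (\<lambda>f. f v)"
      unfolding linear_map_def using v hom_GD(1)[of _ G ?U ?a V act] by (auto simp: hom_G_simps)
    then have "submodule {f \<in> carrier ?M. f v \<in> H} CC ?M"
      by (rule linear_vimage_submodule[OF M.module_axioms V.module_axioms _ H(1)])
    then have "M.span b {..<k} \<subseteq> {f \<in> carrier ?M. f v \<in> H}" using bv b(1) by (intro M.lin_span_least) auto
    then show ?thesis using f b(2) by blast
  qed
  moreover have "S \<subseteq> {f v | f v. f \<in> carrier ?M \<and> v \<in> carrier ?U}"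
    using b(1) e(1) by (auto simp: S_def)
  moreover have "finite S" by (simp add: S_def)
  ultimately show ?thesis by (intro exI[of _ S]) blast
qed

section \<open>Sums with finitely many negative terms\<close>

text \<open>Addition of extended reals is not continuous everywhere, but adding the finite value
  \<open>sum f N\<close> is.\<close>

lemma infsum_ereal_split_finite:
  fixes f :: "'i \<Rightarrow> ereal"
  assumes N: "finite N" "N \<subseteq> I" and fin: "\<And>i. i \<in> N \<Longrightarrow> \<bar>f i\<bar> \<noteq> \<infinity>" and nonneg: "\<And>i. i \<in> I - N \<Longrightarrow> f i \<ge> 0"
  shows "infsum f I = sum f N + infsum f (I - N)"
proof -
  have "(f has_sum infsum f (I - N)) (I - N)"
    using nonneg_summable_on_complete[of "I - N" f] nonneg by (intro has_sum_infsum) auto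
  then have lim: "tendsto (sum f) (infsum f (I - N)) (finite_subsets_at_top (I - N))" by (simp add: has_sum_def)
  have "filterlim (\<lambda>F. F - N) (finite_subsets_at_top (I - N)) (finite_subsets_at_top I)"
    unfolding filterlim_finite_subsets_at_top
  proof (intro allI impI)
    fix Y assume "finite Y \<and> Y \<subseteq> I - N"
    then have "finite Y" "Y \<subseteq> I" "\<And>F. Y \<subseteq> F \<Longrightarrow> Y \<subseteq> F - N" by auto
    then show "\<forall>\<^sub>F F in finite_subsets_at_top I. finite (F - N) \<and> Y \<subseteq> F - N \<and> F - N \<subseteq> I - N"
      unfolding eventually_finite_subsets_at_top by (intro exI[of _ Y]) auto
  qed
  from filterlim_compose[OF lim this]
  have "tendsto (\<lambda>F. sum f (F - N)) (infsum f (I - N)) (finite_subsets_at_top I)" .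
  moreover have c: "\<bar>sum f N\<bar> \<noteq> \<infinity>" using fin N(1) by (simp add: sum_Inf)
  ultimately have "tendsto (\<lambda>F. sum f (F - N) + sum f N) (infsum f (I - N) + sum f N) (finite_subsets_at_top I)"
    by (intro tendsto_add_ereal_general1 tendsto_const)
  moreover have "\<forall>\<^sub>F F in finite_subsets_at_top I. sum f (F - N) + sum f N = sum f F"
    unfolding eventually_finite_subsets_at_top
    using N by (intro exI[of _ N]) (auto simp: sum.subset_diff add.commute)
  ultimately have "tendsto (sum f) (infsum f (I - N) + sum f N) (finite_subsets_at_top I)"
    by (rule Lim_transform_eventually)
  then have "(f has_sum (sum f N + infsum f (I - N))) I" by (simp add: has_sum_def add.commute)
  then show ?thesis by (rule infsumI)
qed

context
  fixes a b :: "'i \<Rightarrow> real" and I N :: "'i set"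
  assumes N: "finite N" "N \<subseteq> I" and le: "\<And>i. i \<in> I \<Longrightarrow> a i \<le> b i" and eq: "\<And>i. i \<in> N \<Longrightarrow> a i = b i"
    and nonneg: "\<And>i. i \<in> I - N \<Longrightarrow> 0 \<le> a i"
begin

lemma infsum_ereal_mono_outside_finite: "infsum (\<lambda>i. ereal (a i)) I \<le> infsum (\<lambda>i. ereal (b i)) I"
proof -
  have nb: "0 \<le> b i" if "i \<in> I - N" for i using nonneg[OF that] le[of i] that by auto
  have "infsum (\<lambda>i. ereal (a i)) I = sum (\<lambda>i. ereal (a i)) N + infsum (\<lambda>i. ereal (a i)) (I - N)"
    using N nonneg by (intro infsum_ereal_split_finite) auto
  also have "\<dots> \<le> sum (\<lambda>i. ereal (b i)) N + infsum (\<lambda>i. ereal (b i)) (I - N)"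
  proof (intro add_mono)
    show "infsum (\<lambda>i. ereal (a i)) (I - N) \<le> infsum (\<lambda>i. ereal (b i)) (I - N)"
      using nonneg nb le by (intro infsum_mono nonneg_summable_on_complete) auto
  qed (use eq in auto)
  also have "\<dots> = infsum (\<lambda>i. ereal (b i)) I"
    using N nb by (intro infsum_ereal_split_finite[symmetric]) auto
  finally show ?thesis .
qed

text \<open>Adding \<open>i\<close> to the exceptional set isolates the terms at \<open>i\<close>. The
  remaining sums are finite, because the sum of the larger family is, and can be cancelled.\<close>

lemma eq_if_infsum_ereal_ge:
  assumes "infsum (\<lambda>i. ereal (b i)) I = 0" "0 \<le> infsum (\<lambda>i. ereal (a i)) I" and i: "i \<in> I"
  shows "a i = b i"
proof (cases "i \<in> N")
  case False
  let ?N = "insert i N"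
  have nb: "0 \<le> b i" if "i \<in> I - ?N" for i using nonneg[of i] le[of i] that by auto
  have N': "finite ?N" "?N \<subseteq> I" using N i by auto
  have A: "infsum (\<lambda>i. ereal (a i)) I = ereal (sum a ?N) + infsum (\<lambda>i. ereal (a i)) (I - ?N)"
    using N' nonneg by (subst infsum_ereal_split_finite[where N = ?N]) auto
  have B: "infsum (\<lambda>i. ereal (b i)) I = ereal (sum b ?N) + infsum (\<lambda>i. ereal (b i)) (I - ?N)"
    using N' nb by (subst infsum_ereal_split_finite[where N = ?N]) auto
  have AB: "infsum (\<lambda>i. ereal (a i)) (I - ?N) \<le> infsum (\<lambda>i. ereal (b i)) (I - ?N)"
    using nonneg nb le by (intro infsum_mono nonneg_summable_on_complete) auto
  have "sum a ?N - a i = sum b ?N - b i" using False N(1) eq by simp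
  moreover have "sum b ?N \<le> sum a ?N"
    using A B AB assms(1,2)
    by (cases "infsum (\<lambda>i. ereal (a i)) (I - ?N)"; cases "infsum (\<lambda>i. ereal (b i)) (I - ?N)")
      (auto simp: zero_ereal_def)
  ultimately show ?thesis using le[OF i] by linarith
qed (rule eq)

end

section \<open>Equivariant subsheaves generated by invariant sets of sections\<close>

lemma (in module_sheaf) generates_subsheaf:
  assumes S: "S \<subseteq> Sec (Spec A)" and P: "submodule_sheaf P"
    and eq: "\<And>U. zopen A U \<Longrightarrow> P U = gen S U"
  shows "generates A (subsheaf F P) (Spec A) S"
  unfolding generates_def
proof (intro conjI allI impI ballI)
  show "S \<subseteq> carrier (sec (subsheaf F P) (Spec A))" using gen_in[OF S] eq[OF zopen_Spec] by auto
  fix V s p assume V: "zopen A V \<and> V \<subseteq> Spec A" and s: "s \<in> carrier (sec (subsheaf F P) V)" and p: "p \<in> V"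
  then have "s \<in> gen S V" using eq by simp
  then obtain W where W: "zopen A W" "p \<in> W" "W \<subseteq> V"
    "res F V W s \<in> local_span S W" using p unfolding gen_def by blast
  then obtain T c where T: "finite T" "T \<subseteq> S" "c \<in> T \<rightarrow> Reg W"
    "res F V W s = (\<Oplus>\<^bsub>sec F W\<^esub>e\<in>T. c e \<odot>\<^bsub>sec F W\<^esub> res F (Spec A) W e)" unfolding lin_span_def by blast
  have "(\<Oplus>\<^bsub>(sec F W)\<lparr>carrier := P W\<rparr>\<^esub>e\<in>T. c e \<odot>\<^bsub>sec F W\<^esub> res F (Spec A) W e) =
    (\<Oplus>\<^bsub>sec F W\<^esub>e\<in>T. c e \<odot>\<^bsub>sec F W\<^esub> res F (Spec A) W e)"
  proof (rule P_finsum[OF P W(1)], rule Pi_I)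
    fix e assume e: "e \<in> T"
    then have "c e \<in> Reg W" "res F (Spec A) W e \<in> P W"
      using T gen_base[OF S W(1)] eq[OF W(1)] by auto
    then show "c e \<odot>\<^bsub>sec F W\<^esub> res F (Spec A) W e \<in> P W"
      by (rule submodule.smult_closed[OF P_submodule[OF P W(1)]])
  qed
  then show "\<exists>W T. zopen A W \<and> p \<in> W \<and> W \<subseteq> V \<and> finite T \<and> T \<subseteq> S \<and>
          (\<exists>c\<in>T \<rightarrow> Reg W. res (subsheaf F P) V W s =
          (\<Oplus>\<^bsub>sec (subsheaf F P) W\<^esub>e\<in>T. c e \<odot>\<^bsub>sec (subsheaf F P) W\<^esub> res (subsheaf F P) (Spec A) W e))"
    using W T by (intro exI[of _ W] exI[of _ T] conjI bexI[of _ c]) auto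
qed

lemma (in coherent_sheaf) coherent_subsheaf:
  assumes P: "submodule_sheaf P" and ft: "finite_type_sheaf A (subsheaf F P)"
  shows "coherent A (subsheaf F P)"
  unfolding coherent_iff
proof (intro conjI sheaf_subsheaf[OF P] ft allI ballI impI)
  fix U and n :: nat and e p
  assume e: "e \<in> {..<n} \<rightarrow> carrier (sec (subsheaf F P) U)" and U: "zopen A U" and p: "p \<in> U"
  have eP: "e \<in> {..<n} \<rightarrow> P U" using e by simp
  have eF: "e \<in> {..<n} \<rightarrow> Sec U" using eP P_subset[OF P U] by auto
  have eq: "relations A (subsheaf F P) U n e W = relations A F U n e W" if "zopen A W" "W \<subseteq> V" "V \<subseteq> U" for W V
    by (rule relations_subsheaf[OF P U that(1) order_trans[OF that(2,3)] eP])
  have "\<forall>U n. \<forall>e\<in>{..<n} \<rightarrow> Sec U. zopen A U \<longrightarrow> (\<forall>p\<in>U. relations_fg_at A F U n e p)"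
    using coherent by (simp add: coherent_iff)
  then have "relations_fg_at A F U n e p" using U eF p by blast
  then obtain V R where VR: "zopen A V" "p \<in> V" "V \<subseteq> U" "finite R" "R \<subseteq> relations A F U n e V"
    "\<forall>W. zopen A W \<and> W \<subseteq> V \<longrightarrow> (\<forall>r\<in>relations A F U n e W. \<forall>q\<in>W.
          \<exists>W'. zopen A W' \<and> q \<in> W' \<and> W' \<subseteq> W \<and> (\<exists>d\<in>R \<rightarrow> Reg W'. \<forall>i<n.
             restrict (r i) W' = (\<Oplus>\<^bsub>str_sheaf A W'\<^esub>x\<in>R. d x \<otimes>\<^bsub>str_sheaf A W'\<^esub> restrict (x i) W')))"
    unfolding relations_fg_at_def by (elim exE conjE) (rule that)
  then show "relations_fg_at A (subsheaf F P) U n e p"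
    unfolding relations_fg_at_def by (intro exI[of _ V] exI[of _ R]) (simp add: eq[OF _ _ VR(3)])
qed

lemma affine_g_scheme_cring: "affine_g_scheme G A \<Longrightarrow> cring A"
  by (simp add: affine_g_scheme_def finite_type_algebra_def algebra_def)

locale equivariant_sheaf =
  fixes G :: "'g alg_group" and A :: "('g, 'a) g_scheme" and F :: "('g, 'a, 'm) g_sheaf"
  assumes reductive: "reductive_group G" and scheme: "affine_g_scheme G A"
    and equivariant: "equivariant_coherent G A F"

sublocale equivariant_sheaf \<subseteq> coherent_sheaf A F
  using affine_g_scheme_cring[OF scheme] equivariant
  by (intro coherent_sheaf.intro coherent_sheaf_axioms.intro) (auto simp: equivariant_coherent_def)

context equivariant_sheaf
begin

lemma affine_group: "affine_algebraic_group G"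
  using reductive by (simp add: reductive_group_def)

lemma group_G: "group G"
  using affine_group by (simp add: affine_algebraic_group_def)

lemma gact_aut: assumes g: "g \<in> carrier G" shows "ring_aut A (gact A g) (gact A (inv\<^bsub>G\<^esub> g))"
proof -
  interpret G: group G by (rule group_G)
  have gA: "g_module G A (gact A)" using scheme by (simp add: affine_g_scheme_def rational_module_def)
  have hom: "gact A h \<in> ring_hom A A" if "h \<in> carrier G" for h using scheme that by (simp add: affine_g_scheme_def)
  have act: "gact A h (gact A k x) = gact A (h \<otimes>\<^bsub>G\<^esub> k) x" "gact A \<one>\<^bsub>G\<^esub> x = x"
    if "h \<in> carrier G" "k \<in> carrier G" "x \<in> carrier A" for h k x using gA that by (auto simp: g_module_def)
  show ?thesis using hom g act by unfold_locales auto
qed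

lemma move_eq: "move A g U = (`) (gact A g) ` U"
  by (simp add: move_def)

context
  fixes g assumes g: "g \<in> carrier G"
begin

interpretation aut: ring_aut A "gact A g" "gact A (inv\<^bsub>G\<^esub> g)" by (rule gact_aut[OF g])

lemma move_zopen: "zopen A U \<Longrightarrow> zopen A (move A g U)"
  unfolding move_eq by (rule aut.image_zopen)

lemma move_Spec: "move A g (Spec A) = Spec A"
  unfolding move_eq by (rule aut.image_Spec_eq)

lemma move_fun_closed: "zopen A U \<Longrightarrow> c \<in> Reg U \<Longrightarrow>
   move_fun G A g U c \<in> Reg (move A g U)"
  unfolding move_fun_def move_eq by (rule aut.transport_section_closed)

lemmas lin_axioms = equivariant[unfolded equivariant_coherent_def, THEN conjunct2, THEN conjunct1,
  THEN spec, THEN mp, THEN conjunct1, THEN bspec, OF _ g]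

lemma lin_Pi: "zopen A U \<Longrightarrow> lin F g U \<in> Sec U \<rightarrow> Sec (move A g U)"
  using lin_axioms[THEN conjunct1] .

lemma lin_add: "zopen A U \<Longrightarrow> s \<in> Sec U \<Longrightarrow> t \<in> Sec U \<Longrightarrow>
    lin F g U (s \<oplus>\<^bsub>sec F U\<^esub> t) = lin F g U s \<oplus>\<^bsub>sec F (move A g U)\<^esub> lin F g U t"
  using lin_axioms[THEN conjunct2, THEN conjunct1] by blast

lemma lin_smult: "zopen A U \<Longrightarrow> c \<in> Reg U \<Longrightarrow> s \<in> Sec U \<Longrightarrow>
    lin F g U (c \<odot>\<^bsub>sec F U\<^esub> s) = move_fun G A g U c \<odot>\<^bsub>sec F (move A g U)\<^esub> lin F g U s"
  using lin_axioms[THEN conjunct2, THEN conjunct2, THEN conjunct1] by blast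

lemma lin_res: "zopen A U \<Longrightarrow> zopen A V \<Longrightarrow> V \<subseteq> U \<Longrightarrow> s \<in> Sec U \<Longrightarrow>
   res F (move A g U) (move A g V) (lin F g U s) = lin F g V (res F U V s)"
  using lin_axioms[THEN conjunct2, THEN conjunct2, THEN conjunct2] by blast

text \<open>A local combination of elements of \<open>S\<close> is carried to the combination of their
  translates with the transported coefficients.\<close>

lemma gen_lin_closed:
  assumes S: "S \<subseteq> Sec (Spec A)" and stable: "\<And>e. e \<in> S \<Longrightarrow> lin F g (Spec A) e \<in> S"
    and U: "zopen A U" and s: "s \<in> gen S U"
  shows "lin F g U s \<in> gen S (move A g U)"
  unfolding gen_def mem_Collect_eq
proof (intro conjI ballI)
  have sF: "s \<in> Sec U" using s by (auto simp: gen_def)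
  show "lin F g U s \<in> Sec (move A g U)" using lin_Pi[OF U] sF by blast
  fix q assume "q \<in> move A g U"
  then obtain p where p: "p \<in> U" "q = gact A g ` p" by (auto simp: move_eq)
  obtain W where W: "zopen A W" "p \<in> W" "W \<subseteq> U"
    "res F U W s \<in> local_span S W" using s p(1) unfolding gen_def by blast
  then obtain T c where T: "finite T" "T \<subseteq> S" "c \<in> T \<rightarrow> Reg W"
    "res F U W s = (\<Oplus>\<^bsub>sec F W\<^esub>e\<in>T. c e \<odot>\<^bsub>sec F W\<^esub> res F (Spec A) W e)" unfolding lin_span_def by blast
  note mW = move_zopen[OF W(1)]
  let ?L = "local_span S (move A g W)"
  have L: "submodule ?L (str_sheaf A (move A g W)) (sec F (move A g W))" by (rule submodule_span[OF S mW])
  interpret W: module "str_sheaf A W" "sec F W" by (rule sec_module[OF W(1)])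
  have tc: "c e \<odot>\<^bsub>sec F W\<^esub> res F (Spec A) W e \<in> Sec W" if "e \<in> T" for e
    using that T res_S[OF S W(1)] by (intro W.smult_closed) auto
  have "res F (move A g U) (move A g W) (lin F g U s) = lin F g W (res F U W s)"
    by (rule lin_res[OF U W(1,3) sF])
  also have "\<dots> = (\<Oplus>\<^bsub>sec F (move A g W)\<^esub>e\<in>T. lin F g W (c e \<odot>\<^bsub>sec F W\<^esub> res F (Spec A) W e))"
    unfolding T(4) using tc
    by (intro finsum_additive(1)[OF sec_abelian[OF W(1)] sec_abelian[OF mW] lin_Pi[OF W(1)]] lin_add[OF W(1)]) auto
  also have "\<dots> \<in> ?L"
  proof (rule module.finsum_in_submodule[OF sec_module[OF mW] L], rule Pi_I)
    fix e assume e: "e \<in> T"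
    then have ce: "c e \<in> Reg W" and eS: "e \<in> S" using T by auto
    have eW: "res F (Spec A) W e \<in> Sec W" using res_S[OF S W(1)] eS by blast
    have eG: "e \<in> Sec (Spec A)" using eS S by blast
    have "lin F g W (c e \<odot>\<^bsub>sec F W\<^esub> res F (Spec A) W e) =
      move_fun G A g W (c e) \<odot>\<^bsub>sec F (move A g W)\<^esub> res F (Spec A) (move A g W) (lin F g (Spec A) e)"
      using lin_smult[OF W(1) ce eW] lin_res[OF zopen_Spec W(1) zopen_subset_Spec[OF W(1)] eG]
      by (simp add: move_Spec)
    also have "\<dots> \<in> ?L"
      using move_fun_closed[OF W(1) ce] module.lin_span_base[OF sec_module[OF mW] res_S[OF S mW] stable[OF eS]]
      by (rule submodule.smult_closed[OF L])
    finally show "lin F g W (c e \<odot>\<^bsub>sec F W\<^esub> res F (Spec A) W e) \<in> ?L" .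
  qed
  finally show "\<exists>W. zopen A W \<and> q \<in> W \<and> W \<subseteq> move A g U \<and> res F (move A g U) W (lin F g U s)
     \<in> local_span S W"
    using mW W(2,3) p(2) by (intro exI[of _ "move A g W"]) (auto simp: move_eq)
qed

end

abbreviation act :: "'g \<Rightarrow> 'm \<Rightarrow> 'm" where "act \<equiv> \<lambda>g. lin F g (Spec A)"

lemma rational_H0: "rational_module G (H0 A F) act"
  using equivariant by (simp add: equivariant_coherent_def)

lemma H0_carrier: "carrier (H0 A F) = Sec (Spec A)"
  by (simp add: H0_def)

lemma submodule_H0:
  assumes "submodule Q (str_sheaf A (Spec A)) (sec F (Spec A))" shows "submodule Q CC (H0 A F)"
proof -
  have "algebra CC A" using scheme by (simp add: affine_g_scheme_def finite_type_algebra_def)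
  then interpret alg: algebra CC A .
  have "const_fun A c = const_sec (Spec A) (c \<odot>\<^bsub>A\<^esub> \<one>\<^bsub>A\<^esub>)" for c
    by (simp add: const_fun_def frac_sec_def)
  then have c: "const_fun A c \<in> Reg (Spec A)" for c
    using const_sec_closed[OF zopen_Spec] by simp
  have "subgroup Q (add_monoid (H0 A F)) = subgroup Q (add_monoid (sec F (Spec A)))"
    by (simp add: subgroup_def m_inv_def H0_def)
  then have "subgroup Q (add_monoid (H0 A F))" using submodule.axioms(1)[OF assms] by simp
  moreover have "a \<odot>\<^bsub>H0 A F\<^esub> x \<in> Q" if "x \<in> Q" for a x
    using submodule.smult_closed[OF assms c that] by (simp add: H0_def)
  ultimately show ?thesis by (simp add: submodule_def submodule_axioms_def)
qed

lemma H0_subsheaf: "H0 A (subsheaf F P) = (H0 A F)\<lparr>carrier := P (Spec A)\<rparr>"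
  by (simp add: H0_def)

text \<open>Finite type is the point of the last assumption: \<open>S\<close> and the finite set
  \<open>S'\<close> generate the same subsheaf. Rationality holds because the global sections form a
  subrepresentation.\<close>

lemma equivariant_coherent_subsheaf_gen:
  assumes S: "S \<subseteq> Sec (Spec A)"
    and stable: "\<And>g e. g \<in> carrier G \<Longrightarrow> e \<in> S \<Longrightarrow> lin F g (Spec A) e \<in> S"
    and fin: "finite S'" "S' \<subseteq> S" "S \<subseteq> gen S' (Spec A)"
  shows "equivariant_coherent_subsheaf G A F (gen S)"
proof -
  note P = submodule_sheaf_gen[OF S]
  have S': "S' \<subseteq> Sec (Spec A)" using fin S by blast
  have gen_eq: "gen S U = gen S' U" if "zopen A U" for U
  proof
    show "gen S U \<subseteq> gen S' U" by (rule gen_least[OF S submodule_sheaf_gen[OF S'] fin(3) that])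
    show "gen S' U \<subseteq> gen S U" using gen_in[OF S] fin(2) by (intro gen_least[OF S' P _ that]) auto
  qed
  have "finite_type_sheaf A (subsheaf F (gen S))"
    unfolding finite_type_sheaf_def
  proof
    fix p assume p: "p \<in> Spec A"
    have "generates A (subsheaf F (gen S)) (Spec A) S'" by (rule generates_subsheaf[OF S' P gen_eq])
    then show "\<exists>U T. zopen A U \<and> p \<in> U \<and> finite T \<and> generates A (subsheaf F (gen S)) U T"
      using zopen_Spec p fin(1) by blast
  qed
  then have coh: "coherent A (subsheaf F (gen S))" by (rule coherent_subsheaf[OF P])
  have sub: "gen S U \<subseteq> Sec U" for U by (auto simp: gen_def)
  have subD: "s \<in> Sec U" if "s \<in> gen S U" for s U using sub that by blast
  have one_mult: "lin F \<one>\<^bsub>G\<^esub> U s = s"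
    "\<forall>g\<in>carrier G. \<forall>h\<in>carrier G. lin F (g \<otimes>\<^bsub>G\<^esub> h) U s = lin F g (move A h U) (lin F h U s)"
    if "zopen A U" "s \<in> Sec U" for U s
    using equivariant that unfolding equivariant_coherent_def by blast+
  have gS: "g_submodule G (H0 A F) act (gen S (Spec A))"
    unfolding g_submodule_def
    using submodule_H0[OF P_submodule[OF P zopen_Spec]] gen_lin_closed[OF _ S stable zopen_Spec] move_Spec by auto
  have "rational_module G (H0 A (subsheaf F (gen S))) (\<lambda>g. lin (subsheaf F (gen S)) g (Spec A))"
    unfolding H0_subsheaf using rational_submodule[OF affine_group rational_H0 gS] by simp
  then have "equivariant_coherent G A (subsheaf F (gen S))"
    unfolding equivariant_coherent_def using coh
    by (auto simp: subD lin_add lin_smult lin_res one_mult gen_lin_closed[OF _ S stable])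
  then show ?thesis using sub by (simp add: equivariant_coherent_subsheaf_def)
qed

section \<open>The subsheaf generated by the negative components\<close>

text \<open>The values of homomorphisms \<open>V\<^sub>\<rho> \<rightarrow> H\<^sup>0(\<F>)\<close>,
  which span the isotypic components \<open>\<F>\<^sub>\<rho> \<otimes> V\<^sub>\<rho>\<close>.\<close>

definition comp_sections :: "'g rep set set \<Rightarrow> 'm set" where
  "comp_sections \<Delta> = {f v | f v \<rho>. \<rho> \<in> \<Delta> \<and> f \<in> carrier (F_comp G A F \<rho>) \<and> v \<in> carrier (rep_space \<rho>)}"

lemma generated_in_iff: "generated_in G A \<Delta> F \<longleftrightarrow> generates A F (Spec A) (comp_sections \<Delta>)"
  by (simp add: generated_in_def comp_sections_def)

lemma F_comp_g_module: "\<rho> \<in> Defs.Irr G \<Longrightarrow> module CC (F_comp G A F \<rho>)"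
  unfolding F_comp_def by (rule module_hom_G[OF rep_g_module rational_g_module[OF rational_H0]])

lemma F_comp_value:
  assumes "f \<in> carrier (F_comp G A F \<rho>)" "v \<in> carrier (rep_space \<rho>)"
  shows "f v \<in> Sec (Spec A)"
  using hom_GD(1)[OF assms(1)[unfolded F_comp_def] assms(2)] by (simp add: H0_carrier)

lemma comp_sections_subset: "comp_sections \<Delta> \<subseteq> Sec (Spec A)"
  using F_comp_value by (auto simp: comp_sections_def)

lemma comp_sections_stable:
  assumes \<Delta>: "\<Delta> \<subseteq> Defs.Irr G" and g: "g \<in> carrier G" and e: "e \<in> comp_sections \<Delta>"
  shows "lin F g (Spec A) e \<in> comp_sections \<Delta>"
proof -
  obtain f v \<rho> where f: "\<rho> \<in> \<Delta>" "f \<in> carrier (F_comp G A F \<rho>)" "v \<in> carrier (rep_space \<rho>)" "e = f v"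
    using e by (auto simp: comp_sections_def)
  have "f (rep_act \<rho> g v) = lin F g (Spec A) (f v)"
    using hom_GD(4)[OF _ g f(3)] f(2) unfolding F_comp_def by blast
  moreover have "rep_act \<rho> g v \<in> carrier (rep_space \<rho>)"
    using g_moduleD(1)[OF rep_g_module g f(3)] \<Delta> f(1) by blast
  ultimately show ?thesis using f unfolding comp_sections_def by (metis (mono_tags, lifting) mem_Collect_eq)
qed

lemma F_comp_subsheaf:
  assumes P: "submodule_sheaf P"
  shows "F_comp G A (subsheaf F P) \<rho> =
    (F_comp G A F \<rho>)\<lparr>carrier := {f \<in> carrier (F_comp G A F \<rho>). f ` carrier (rep_space \<rho>) \<subseteq> P (Spec A)}\<rparr>"
  unfolding F_comp_def H0_subsheaf subsheaf_simps
  by (rule hom_G_restrict_codomain) (use P_subset[OF P zopen_Spec] H0_carrier in simp)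

text \<open>The component of a subsheaf consists of the homomorphisms with values in the subsheaf, and a
  subspace of full dimension is the whole space.\<close>

lemma vdim_F_comp_subsheaf:
  assumes P: "submodule_sheaf P" and \<rho>: "\<rho> \<in> Defs.Irr G" and dim: "vdim (F_comp G A F \<rho>) = enat n"
  shows "\<exists>k\<le>n. vdim (F_comp G A (subsheaf F P) \<rho>) = enat k \<and>
    (k = n \<longrightarrow> (\<forall>f\<in>carrier (F_comp G A F \<rho>). \<forall>v\<in>carrier (rep_space \<rho>). f v \<in> P (Spec A)))"
proof -
  interpret M: complex_space "F_comp G A F \<rho>" using F_comp_g_module[OF \<rho>] by (simp add: complex_space_def)
  have "submodule {f \<in> carrier (F_comp G A F \<rho>). f ` carrier (rep_space \<rho>) \<subseteq> P (Spec A)} CC (F_comp G A F \<rho>)"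
    unfolding F_comp_def by (rule submodule_hom_G_restrict[OF rep_g_module[OF \<rho>] rational_g_module[OF rational_H0]
      submodule_H0[OF P_submodule[OF P zopen_Spec]]])
  from M.vdim_submodule[OF dim this] show ?thesis unfolding F_comp_subsheaf[OF P] by blast
qed

lemma comp_sections_finitely_generated:
  assumes \<Delta>: "\<Delta> \<subseteq> Defs.Irr G" "finite \<Delta>" and dim: "\<And>\<rho>. \<rho> \<in> \<Delta> \<Longrightarrow> vdim (F_comp G A F \<rho>) = enat (h \<rho>)"
  shows "\<exists>S. finite S \<and> S \<subseteq> comp_sections \<Delta> \<and> comp_sections \<Delta> \<subseteq> gen S (Spec A)"
proof -
  let ?E = "\<lambda>\<rho>. {f v | f v. f \<in> carrier (F_comp G A F \<rho>) \<and> v \<in> carrier (rep_space \<rho>)}"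
  have "\<forall>\<rho>\<in>\<Delta>. \<exists>S. finite S \<and> S \<subseteq> ?E \<rho> \<and> (\<forall>H. submodule H CC (H0 A F) \<and> S \<subseteq> H \<longrightarrow> ?E \<rho> \<subseteq> H)"
    using images_finitely_spanned[OF _ rational_g_module[OF rational_H0]] \<Delta>(1) dim unfolding F_comp_def by blast
  from bchoice[OF this] obtain S where S': "\<forall>\<rho>\<in>\<Delta>. finite (S \<rho>) \<and> S \<rho> \<subseteq> ?E \<rho> \<and>
    (\<forall>H. submodule H CC (H0 A F) \<and> S \<rho> \<subseteq> H \<longrightarrow> ?E \<rho> \<subseteq> H)" ..
  note S = bspec[OF S', THEN conjunct1] bspec[OF S', THEN conjunct2, THEN conjunct1]
    bspec[OF S', THEN conjunct2, THEN conjunct2, THEN spec, THEN mp, OF _ conjI]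
  let ?S = "\<Union>\<rho>\<in>\<Delta>. S \<rho>"
  have sub: "?S \<subseteq> comp_sections \<Delta>" using S(2) unfolding comp_sections_def by blast
  have Sc: "?S \<subseteq> Sec (Spec A)" using sub comp_sections_subset by blast
  have H: "submodule (gen ?S (Spec A)) CC (H0 A F)"
    by (rule submodule_H0[OF submodule_gen[OF Sc zopen_Spec]])
  have "?E \<rho> \<subseteq> gen ?S (Spec A)" if "\<rho> \<in> \<Delta>" for \<rho>
    using S(3)[OF that H] gen_in[OF Sc] that by blast
  then have "comp_sections \<Delta> \<subseteq> gen ?S (Spec A)" unfolding comp_sections_def by blast
  moreover have "finite ?S" using \<Delta>(2) S(1) by blast
  ultimately show ?thesis using sub by blast
qed

lemma generated_in_gen_comp_sections:
  "generated_in G A \<Delta> (subsheaf F (gen (comp_sections \<Delta>)))"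
proof -
  note S = comp_sections_subset[of \<Delta>]
  note P = submodule_sheaf_gen[OF S]
  have "f ` carrier (rep_space \<rho>) \<subseteq> gen (comp_sections \<Delta>) (Spec A)"
    if "\<rho> \<in> \<Delta>" "f \<in> carrier (F_comp G A F \<rho>)" for f \<rho>
    using gen_in[OF S] that unfolding comp_sections_def by blast
  then have "carrier (F_comp G A (subsheaf F (gen (comp_sections \<Delta>))) \<rho>) = carrier (F_comp G A F \<rho>)"
    if "\<rho> \<in> \<Delta>" for \<rho>
    unfolding F_comp_subsheaf[OF P] using that by auto
  then have "{f v | f v \<rho>. \<rho> \<in> \<Delta> \<and> f \<in> carrier (F_comp G A (subsheaf F (gen (comp_sections \<Delta>))) \<rho>) \<and>
      v \<in> carrier (rep_space \<rho>)} =
    {f v | f v \<rho>. \<rho> \<in> \<Delta> \<and> f \<in> carrier (F_comp G A F \<rho>) \<and> v \<in> carrier (rep_space \<rho>)}"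
    by (intro Collect_cong ex_cong1 conj_cong refl) simp
  from trans[OF this comp_sections_def[symmetric]]
  show ?thesis unfolding generated_in_def by (simp only: generates_subsheaf[OF S P refl])
qed

lemma generated_in_if_full:
  assumes "\<And>U. zopen A U \<Longrightarrow> gen (comp_sections \<Delta>) U = Sec U"
  shows "generated_in G A \<Delta> F"
  unfolding generated_in_iff using assms by (intro generates_if_gen_eq comp_sections_subset) simp

text \<open>Complete reducibility settles the global sections, and on an affine scheme these determine a
  coherent sheaf.\<close>

lemma full_if_all_components:
  assumes "\<And>\<rho> f v. \<rho> \<in> Defs.Irr G \<Longrightarrow> f \<in> carrier (F_comp G A F \<rho>) \<Longrightarrow> v \<in> carrier (rep_space \<rho>) \<Longrightarrow>
      f v \<in> P (Spec A)"
    and P: "submodule_sheaf P" and U: "zopen A U"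
  shows "P U = Sec U"
proof -
  have "P (Spec A) = carrier (H0 A F)"
    by (rule rational_module_is_sum_of_irreducible_images[OF reductive rational_H0
          submodule_H0[OF P_submodule[OF P zopen_Spec]]])
      (use assms(1) in \<open>simp add: F_comp_def\<close>)
  then show ?thesis using submodule_sheaf_eq_if_global_eq[OF P _ U] by (simp add: H0_carrier)
qed

end

locale constellation_sheaf = equivariant_sheaf G A F
  for G :: "'g alg_group" and A :: "('g, 'a) g_scheme" and F :: "('g, 'a, 'm) g_sheaf" +
  fixes h :: "'g rep set \<Rightarrow> nat" and \<theta> :: "'g rep set \<Rightarrow> rat"
  assumes dims: "\<rho> \<in> Defs.Irr G \<Longrightarrow> vdim (F_comp G A F \<rho>) = enat (h \<rho>)"
    and finite_neg: "finite (D_neg G \<theta>)"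
    and theta_zero: "theta_val G A \<theta> F = 0"
    and neg_supp: "D_neg G \<theta> \<inter> supp G h \<noteq> {}"
begin

abbreviation neg_sub :: "'a set set \<Rightarrow> 'm set" where "neg_sub \<equiv> gen (comp_sections (D_neg G \<theta>))"

lemma D_neg_Irr: "D_neg G \<theta> \<subseteq> Defs.Irr G"
  by (auto simp: D_neg_def)

lemma submodule_sheaf_neg_sub: "submodule_sheaf neg_sub"
  by (rule submodule_sheaf_gen[OF comp_sections_subset])

lemma neg_sub_equivariant: "equivariant_coherent_subsheaf G A F neg_sub"
proof -
  obtain S where S: "finite S" "S \<subseteq> comp_sections (D_neg G \<theta>)" "comp_sections (D_neg G \<theta>) \<subseteq> gen S (Spec A)"
    using comp_sections_finitely_generated[OF D_neg_Irr finite_neg, of h] dims D_neg_Irr by blast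
  show ?thesis
    by (rule equivariant_coherent_subsheaf_gen[OF comp_sections_subset comp_sections_stable[OF D_neg_Irr] S])
qed

lemma neg_sub_component:
  assumes "\<rho> \<in> D_neg G \<theta>" "f \<in> carrier (F_comp G A F \<rho>)" "v \<in> carrier (rep_space \<rho>)"
  shows "f v \<in> neg_sub (Spec A)"
  by (rule gen_in[OF comp_sections_subset]) (use assms in \<open>auto simp: comp_sections_def\<close>)

text \<open>Otherwise all homomorphisms from \<open>V\<^sub>\<rho>\<close> would vanish for some
  \<open>\<rho>\<close> with \<open>h \<rho> > 0\<close>.\<close>

lemma neg_sub_nonzero: "neg_sub (Spec A) \<noteq> {(zero_sec (Spec A))}"
proof
  assume zero: "neg_sub (Spec A) = {(zero_sec (Spec A))}"
  obtain \<rho> where \<rho>: "\<rho> \<in> D_neg G \<theta>" "\<rho> \<in> supp G h" using neg_supp by blast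
  have \<rho>I: "\<rho> \<in> Defs.Irr G" using \<rho> D_neg_Irr by blast
  interpret M: complex_space "F_comp G A F \<rho>" using F_comp_g_module[OF \<rho>I] by (simp add: complex_space_def)
  have "f = \<zero>\<^bsub>F_comp G A F \<rho>\<^esub>" if f: "f \<in> carrier (F_comp G A F \<rho>)" for f
  proof
    fix v
    show "f v = \<zero>\<^bsub>F_comp G A F \<rho>\<^esub> v"
    proof (cases "v \<in> carrier (rep_space \<rho>)")
      case True
      then have "f v = zero_sec (Spec A)" using neg_sub_component[OF \<rho>(1) f] zero by blast
      then show ?thesis using True by (simp add: F_comp_def hom_G_simps H0_def)
    next
      case False
      then show ?thesis using hom_GD(5)[OF f[unfolded F_comp_def]] by (simp add: F_comp_def hom_G_simps)
    qed
  qed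
  then have "carrier (F_comp G A F \<rho>) = {\<zero>\<^bsub>F_comp G A F \<rho>\<^esub>}" using M.M.zero_closed by blast
  then have "h \<rho> = 0" using dims[OF \<rho>I] M.vdim_carrier_eq_iff M.zero_dim by simp
  then show False using \<rho>(2) by (simp add: supp_def)
qed

lemma neg_sub_dims:
  shows "\<exists>m. \<forall>\<rho>\<in>Defs.Irr G. m \<rho> \<le> h \<rho> \<and> vdim (F_comp G A (subsheaf F neg_sub) \<rho>) = enat (m \<rho>) \<and>
    (m \<rho> = h \<rho> \<longrightarrow> (\<forall>f\<in>carrier (F_comp G A F \<rho>). \<forall>v\<in>carrier (rep_space \<rho>). f v \<in> neg_sub (Spec A))) \<and>
    (\<rho> \<in> D_neg G \<theta> \<longrightarrow> m \<rho> = h \<rho>)"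
proof (rule bchoice, rule ballI)
  fix \<rho> assume \<rho>: "\<rho> \<in> Defs.Irr G"
  obtain k where k: "k \<le> h \<rho>" "vdim (F_comp G A (subsheaf F neg_sub) \<rho>) = enat k"
    "k = h \<rho> \<longrightarrow> (\<forall>f\<in>carrier (F_comp G A F \<rho>). \<forall>v\<in>carrier (rep_space \<rho>). f v \<in> neg_sub (Spec A))"
    using vdim_F_comp_subsheaf[OF submodule_sheaf_neg_sub \<rho> dims[OF \<rho>]] by blast
  have "k = h \<rho>" if "\<rho> \<in> D_neg G \<theta>"
  proof -
    have "{f \<in> carrier (F_comp G A F \<rho>). f ` carrier (rep_space \<rho>) \<subseteq> neg_sub (Spec A)} = carrier (F_comp G A F \<rho>)"
      using neg_sub_component[OF that] by blast
    then have "F_comp G A (subsheaf F neg_sub) \<rho> = F_comp G A F \<rho>"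
      unfolding F_comp_subsheaf[OF submodule_sheaf_neg_sub] by simp
    then show ?thesis using k(2) dims[OF \<rho>] by simp
  qed
  then show "\<exists>k\<le>h \<rho>. vdim (F_comp G A (subsheaf F neg_sub) \<rho>) = enat k \<and>
    (k = h \<rho> \<longrightarrow> (\<forall>f\<in>carrier (F_comp G A F \<rho>). \<forall>v\<in>carrier (rep_space \<rho>). f v \<in> neg_sub (Spec A))) \<and>
    (\<rho> \<in> D_neg G \<theta> \<longrightarrow> k = h \<rho>)" using k by blast
qed

lemma theta_val_eq:
  assumes "\<And>\<rho>. \<rho> \<in> Defs.Irr G \<Longrightarrow> vdim (F_comp G A F' \<rho>) = enat (m \<rho>)"
  shows "theta_val G A \<theta> F' = (\<Sum>\<^sub>\<infinity>\<rho>\<in>Defs.Irr G. ereal (of_rat (\<theta> \<rho>) * real (m \<rho>)))"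
  unfolding theta_val_def by (rule infsum_cong) (simp add: assms)

text \<open>On \<open>D\<^sub>-\<close> the terms of \<open>\<theta>(P)\<close> and
  \<open>\<theta>(\<F>)\<close> agree, elsewhere those of \<open>\<theta>(P)\<close> are at most as
  large. Hence \<open>\<theta>(P) \<le> 0\<close>, with equality only if all terms agree.\<close>

lemma theta_neg_sub:
  shows "theta_val G A \<theta> (subsheaf F neg_sub) \<le> 0"
    and "0 \<le> theta_val G A \<theta> (subsheaf F neg_sub) \<Longrightarrow> \<rho> \<in> Defs.Irr G \<Longrightarrow> \<theta> \<rho> \<noteq> 0 \<Longrightarrow>
      f \<in> carrier (F_comp G A F \<rho>) \<Longrightarrow> v \<in> carrier (rep_space \<rho>) \<Longrightarrow> f v \<in> neg_sub (Spec A)"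
proof -
  obtain m where m: "\<And>\<rho>. \<rho> \<in> Defs.Irr G \<Longrightarrow> m \<rho> \<le> h \<rho>"
    "\<And>\<rho>. \<rho> \<in> Defs.Irr G \<Longrightarrow> vdim (F_comp G A (subsheaf F neg_sub) \<rho>) = enat (m \<rho>)"
    "\<And>\<rho> f v. \<rho> \<in> Defs.Irr G \<Longrightarrow> m \<rho> = h \<rho> \<Longrightarrow> f \<in> carrier (F_comp G A F \<rho>) \<Longrightarrow>
       v \<in> carrier (rep_space \<rho>) \<Longrightarrow> f v \<in> neg_sub (Spec A)"
    "\<And>\<rho>. \<rho> \<in> D_neg G \<theta> \<Longrightarrow> m \<rho> = h \<rho>"
    using neg_sub_dims D_neg_Irr by blast
  let ?a = "\<lambda>\<rho>. of_rat (\<theta> \<rho>) * real (m \<rho>)" and ?b = "\<lambda>\<rho>. of_rat (\<theta> \<rho>) * real (h \<rho>)"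
  have a: "theta_val G A \<theta> (subsheaf F neg_sub) = (\<Sum>\<^sub>\<infinity>\<rho>\<in>Defs.Irr G. ereal (?a \<rho>))"
    by (rule theta_val_eq[OF m(2)])
  have b: "(\<Sum>\<^sub>\<infinity>\<rho>\<in>Defs.Irr G. ereal (?b \<rho>)) = 0"
    using theta_val_eq[OF dims] theta_zero by simp
  have le: "?a \<rho> \<le> ?b \<rho>" if "\<rho> \<in> Defs.Irr G" for \<rho>
  proof (cases "\<theta> \<rho> < 0")
    case True
    then show ?thesis using m(4)[of \<rho>] that by (simp add: D_neg_def)
  next
    case False
    then show ?thesis using m(1)[OF that] by (intro mult_left_mono) auto
  qed
  have eq: "?a \<rho> = ?b \<rho>" if "\<rho> \<in> D_neg G \<theta>" for \<rho> using m(4)[OF that] by simp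
  have nonneg: "0 \<le> ?a \<rho>" if "\<rho> \<in> Defs.Irr G - D_neg G \<theta>" for \<rho>
    using that by (auto simp: D_neg_def)
  show "theta_val G A \<theta> (subsheaf F neg_sub) \<le> 0"
    unfolding a b[symmetric] by (rule infsum_ereal_mono_outside_finite[OF finite_neg D_neg_Irr le eq nonneg])
  assume ge: "0 \<le> theta_val G A \<theta> (subsheaf F neg_sub)" and \<rho>: "\<rho> \<in> Defs.Irr G" "\<theta> \<rho> \<noteq> 0"
    and f: "f \<in> carrier (F_comp G A F \<rho>)" "v \<in> carrier (rep_space \<rho>)"
  have "?a \<rho> = ?b \<rho>"
    by (rule eq_if_infsum_ereal_ge[OF finite_neg D_neg_Irr le eq nonneg b ge[unfolded a] \<rho>(1)])
  then show "f v \<in> neg_sub (Spec A)" using m(3)[OF \<rho>(1) _ f] \<rho>(2) by simp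
qed

lemma neg_sub_full_or_proper:
  "(\<forall>U. zopen A U \<longrightarrow> neg_sub U = Sec U) \<or> nonzero_proper A F neg_sub"
  using neg_sub_nonzero zopen_Spec unfolding nonzero_proper_def by blast

lemma stable_generated:
  assumes "theta_stable G A h \<theta> F" shows "generated_in G A (D_neg G \<theta>) F"
proof (rule generated_in_if_full)
  have "\<not> nonzero_proper A F neg_sub"
  proof
    assume "nonzero_proper A F neg_sub"
    then have "0 < theta_val G A \<theta> (subsheaf F neg_sub)"
      using assms neg_sub_equivariant generated_in_gen_comp_sections unfolding theta_stable_def by blast
    then show False using theta_neg_sub(1) by simp
  qed
  then show "neg_sub U = Sec U" if "zopen A U" for U using neg_sub_full_or_proper that by blast
qed

text \<open>If the subsheaf were proper, its value of \<open>\<theta>\<close> would be \<open>0\<close>;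
  then all components with \<open>\<theta> \<rho> \<noteq> 0\<close> are contained in it, and those with
  \<open>\<theta> \<rho> = 0\<close> vanish.\<close>

lemma semistable_generated:
  assumes "theta_semistable G A h \<theta> F" and zero: "\<And>\<rho>. \<rho> \<in> Defs.Irr G \<Longrightarrow> \<theta> \<rho> = 0 \<Longrightarrow> h \<rho> = 0"
  shows "generated_in G A (D_neg G \<theta>) F"
proof (rule generated_in_if_full)
  fix U assume U: "zopen A U"
  show "neg_sub U = Sec U"
  proof (cases "nonzero_proper A F neg_sub")
    case True
    then have ge: "0 \<le> theta_val G A \<theta> (subsheaf F neg_sub)"
      using assms neg_sub_equivariant generated_in_gen_comp_sections unfolding theta_semistable_def by blast
    show ?thesis
    proof (rule full_if_all_components[OF _ submodule_sheaf_neg_sub U])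
      fix \<rho> f v assume \<rho>: "\<rho> \<in> Defs.Irr G" and f: "f \<in> carrier (F_comp G A F \<rho>)" "v \<in> carrier (rep_space \<rho>)"
      show "f v \<in> neg_sub (Spec A)"
      proof (cases "\<theta> \<rho> = 0")
        case True
        then have "vdim (F_comp G A F \<rho>) = enat 0" using zero[OF \<rho>] dims[OF \<rho>] by simp
        then show ?thesis
          using vdim_F_comp_subsheaf[OF submodule_sheaf_neg_sub \<rho>, of 0] f by auto
      next
        case False
        then show ?thesis using theta_neg_sub(2)[OF ge \<rho> _ f] by blast
      qed
    qed
  next
    case False
    then show ?thesis using neg_sub_full_or_proper U by blast
  qed
qed

end

theorem theorem1p7:
  fixes G :: "'g alg_group"
    and A :: "('g, 'a) g_scheme"
    and h :: "'g rep set \<Rightarrow> nat"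
    and \<theta> :: "'g rep set \<Rightarrow> rat"
  assumes "reductive_group G" and "infinite (carrier G)"
    and "affine_g_scheme G A"
    and "finite (D_neg G \<theta>)"
    and "D_neg G \<theta> \<inter> supp G h \<noteq> {}"
    and "D_pos G \<theta> \<inter> supp G h \<noteq> {}"
    and "\<forall>\<rho>\<in>Irr G. h \<rho> = 0 \<longrightarrow> \<theta> \<rho> = 0"
  shows "(\<forall>F :: ('g, 'a, 'm) g_sheaf. theta_stable G A h \<theta> F \<longrightarrow> generated_in G A (D_neg G \<theta>) F) \<and>
    (D_zero G \<theta> = {\<rho> \<in> Irr G. h \<rho> = 0} \<longrightarrow>
      (\<forall>F :: ('g, 'a, 'm) g_sheaf. theta_semistable G A h \<theta> F \<longrightarrow> generated_in G A (D_neg G \<theta>) F))"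
proof (intro conjI allI impI)
  have loc: "constellation_sheaf G A F h \<theta>"
    if "constellation G A h F" "theta_val G A \<theta> F = 0" for F :: "('g, 'a, 'm) g_sheaf"
    using assms that by unfold_locales (auto simp: constellation_def)
  show "generated_in G A (D_neg G \<theta>) F" if "theta_stable G A h \<theta> F" for F :: "('g, 'a, 'm) g_sheaf"
    using constellation_sheaf.stable_generated[OF loc that] that by (simp add: theta_stable_def)
  show "generated_in G A (D_neg G \<theta>) F"
    if "D_zero G \<theta> = {\<rho> \<in> Irr G. h \<rho> = 0}" "theta_semistable G A h \<theta> F" for F :: "('g, 'a, 'm) g_sheaf"
  proof (rule constellation_sheaf.semistable_generated[OF loc that(2)])
    show "h \<rho> = 0" if "\<rho> \<in> Irr G" "\<theta> \<rho> = 0" for \<rho>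
      using that \<open>D_zero G \<theta> = _\<close> by (auto simp: D_zero_def)
  qed (use that(2) in \<open>simp_all add: theta_semistable_def\<close>)
qed

end
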